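(* The candidate surface branched covers of degree $d$ inducing a candidate 2-orbifold cover $S(3,3,3)\dashrightarrow S(2,3,6)$ are the following, with $\widetilde\Sigma=\Sigma=S$ and $k\geq 1$: \begin{enumerate} \item $d=6k$, partitions $(2^{3k}),(3^{2k-1},1,1,1),(6^k)$; \item $d=6k+2$, partitions $(2^{3k+1}),(3^{2k},1,1),(6^k,2)$; \item $d=6k+4$, partitions $(2^{3k+2}),(3^{2k+1},1),(6^k,2,2)$; \item $d=6k+6$, partitions $(2^{3k+3}),(3^{2k+2}),(6^k,2,2,2)$; \end{enumerate} and they are realizable, respectively: \begin{enumerate} \item if and only if $d=6(x^2+3xy+3y^2)$ for some $x,y\in\mathbb{N}$; \item if and only if $d=2(x^2+xy+y^2)$ for some $x,y\in\mathbb{N}$ with $x\not\equiv y\pmod 3$; \item never; \item if and only if $d=6(x^2+3xy+3y^2)$ for some $x,y\in\mathbb{N}$. \end{enumerate}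
   Context: $\mathbb{N}$ denotes the non-negative integers and $S$ the 2-sphere. A partition of $d$ is a finite unordered list (multiset) of positive integers with sum $d$; $\ell(\Pi)$ is the number of entries of $\Pi$; $(a^m,b,\ldots)$ means that $a$ is repeated $m$ times. For closed connected orientable surfaces $\widetilde\Sigma,\Sigma$, a branched cover $f:\widetilde\Sigma\to\Sigma$ is a map locally modelled on $(\mathbb{C},0)\to(\mathbb{C},0)$, $z\mapsto z^k$ with $k\geq 1$; $k$ is the local degree at the source point, and a point of $\Sigma$ having a preimage with local degree $>1$ is a branching point. The degree $d$ of $f$ is the degree of the genuine cover obtained by removing the branching points and their preimages; the local degrees at the preimages of a branching point form a partition of $d$. A candidate surface branched cover consists of closed connected orientable surfaces $\widetilde\Sigma,\Sigma$ (up to homeomorphism), integers $d\geq 2$ and $n\geq 1$, and an unordered collection (repetitions allowed) $\Pi_1,\ldots,\Pi_n$ of partitions of $d$, each with at least one entry $>1$, satisfying the Riemann-Hurwitz condition $\chi(\widetilde\Sigma)-\sum_i\ell(\Pi_i)=d\,(\chi(\Sigma)-n)$. It is realizable if there is a degree-$d$ branched cover $f:\widetilde\Sigma\to\Sigma$ with $n$ branching points whose associated partitions of local degrees are $\Pi_1,\ldots,\Pi_n$. A 2-orbifold $\Sigma(p_1,\ldots,p_n)$ is a closed connected orientable surface $\Sigma$ with $n$ cone points of orders $p_i\geq 2$. With $\Pi_i=(d_{ij})_j$, set $p_i=\mathrm{lcm}_j\, d_{ij}$ and $p_{ij}=p_i/d_{ij}$. The induced candidate 2-orbifold cover is $\widetilde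 X\dashrightarrow X$ with $X=\Sigma(p_1,\ldots,p_n)$ and $\widetilde X=\widetilde\Sigma((p_{ij})_{i,j})$, where orders equal to $1$ are dropped. *)

theory Defs
  imports "HOL-Homology.Homology" "HOL-Library.Multiset"
    "HOL-Number_Theory.Cong"
begin

text \<open>Orientability is the existence of a locally consistent choice of generators of the
  local homology groups \<open>H\<^sub>2(X, X - {x})\<close>.\<close>

definition local_orientation :: "'a topology \<Rightarrow> ('a \<Rightarrow> 'a chain set) \<Rightarrow> bool" where
  "local_orientation X \<mu> \<longleftrightarrow>
     (\<forall>x \<in> topspace X.
        \<mu> x \<in> carrier (relative_homology_group 2 X (topspace X - {x})) \<and>
        generate (relative_homology_group 2 X (topspace X - {x})) {\<mu> x}
          = carrier (relative_homology_group 2 X (topspace X - {x}))) \<and>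
     (\<forall>x \<in> topspace X. \<exists>U c. openin X U \<and> x \<in> U \<and>
        c \<in> carrier (relative_homology_group 2 X (topspace X - U)) \<and>
        (\<forall>y \<in> U. hom_induced 2 X (topspace X - U) X (topspace X - {y}) id c = \<mu> y))"

definition orientable_surface :: "'a topology \<Rightarrow> bool" where
  "orientable_surface X \<longleftrightarrow> (\<exists>\<mu>. local_orientation X \<mu>)"

definition locally_planar :: "'a topology \<Rightarrow> bool" where
  "locally_planar X \<longleftrightarrow>
     (\<forall>x \<in> topspace X. \<exists>U (A :: complex set). openin X U \<and> x \<in> U \<and> open A \<and>
        subtopology X U homeomorphic_space top_of_set A)"

definition closed_connected_orientable_surface :: "'a topology \<Rightarrow> bool" where
  "closed_connected_orientable_surface X \<longleftrightarrow>
     topspace X \<noteq> {} \<and> compact_space X \<and> Hausdorff_space X \<and> connected_space X \<and>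
     locally_planar X \<and> orientable_surface X"

abbreviation two_sphere :: "(nat \<Rightarrow> real) topology" where
  "two_sphere \<equiv> nsphere 2"

text \<open>The rank of an abelian group, written multiplicatively, is the maximal size of a
  \<open>\<int>\<close>-linearly independent subset; it is only meaningful when that size is bounded.\<close>

definition Z_independent :: "('a, 'm) monoid_scheme \<Rightarrow> 'a set \<Rightarrow> bool" where
  "Z_independent G B \<longleftrightarrow>
     (\<forall>c :: 'a \<Rightarrow> int. finprod G (\<lambda>b. b [^]\<^bsub>G\<^esub> c b) B = \<one>\<^bsub>G\<^esub> \<longrightarrow> (\<forall>b \<in> B. c b = 0))"

definition abelian_rank :: "('a, 'm) monoid_scheme \<Rightarrow> nat" where
  "abelian_rank G =
     (GREATEST r. \<exists>B. finite B \<and> B \<subseteq> carrier G \<and> card B = r \<and> Z_independent G B)"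

text \<open>The Euler characteristic is only used for closed surfaces, whose homology vanishes
  above dimension 2.\<close>

definition euler_char :: "'a topology \<Rightarrow> int" where
  "euler_char X =
     int (abelian_rank (homology_group 0 X)) - int (abelian_rank (homology_group 1 X))
     + int (abelian_rank (homology_group 2 X))"

text \<open>Near \<open>x\<close> the map \<open>f\<close> is, in charts centred at \<open>x\<close> and \<open>f x\<close>, the map \<open>z \<mapsto> z ^ k\<close>.\<close>

definition has_local_degree ::
  "'a topology \<Rightarrow> 'b topology \<Rightarrow> ('a \<Rightarrow> 'b) \<Rightarrow> 'a \<Rightarrow> nat \<Rightarrow> bool" where
  "has_local_degree X Y f x k \<longleftrightarrow> k \<ge> 1 \<and>
     (\<exists>U V (A :: complex set) (B :: complex set) \<phi> \<psi>.
        openin X U \<and> x \<in> U \<and> openin Y V \<and> f ` U \<subseteq> V \<and> open A \<and> open B \<and>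
        homeomorphic_map (subtopology X U) (top_of_set A) \<phi> \<and> \<phi> x = 0 \<and>
        homeomorphic_map (subtopology Y V) (top_of_set B) \<psi> \<and> \<psi> (f x) = 0 \<and>
        (\<forall>u \<in> U. \<psi> (f u) = \<phi> u ^ k))"

definition branched_cover :: "'a topology \<Rightarrow> 'b topology \<Rightarrow> ('a \<Rightarrow> 'b) \<Rightarrow> bool" where
  "branched_cover X Y f \<longleftrightarrow>
     continuous_map X Y f \<and> (\<forall>x \<in> topspace X. \<exists>k. has_local_degree X Y f x k)"

definition local_degree :: "'a topology \<Rightarrow> 'b topology \<Rightarrow> ('a \<Rightarrow> 'b) \<Rightarrow> 'a \<Rightarrow> nat" where
  "local_degree X Y f x = (THE k. has_local_degree X Y f x k)"

definition fibre :: "'a topology \<Rightarrow> ('a \<Rightarrow> 'b) \<Rightarrow> 'b \<Rightarrow> 'a set" where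
  "fibre X f y = {x \<in> topspace X. f x = y}"

definition branching_points :: "'a topology \<Rightarrow> 'b topology \<Rightarrow> ('a \<Rightarrow> 'b) \<Rightarrow> 'b set" where
  "branching_points X Y f = {y \<in> topspace Y. \<exists>x \<in> fibre X f y. local_degree X Y f x > 1}"

text \<open>The degree is the number of sheets of the genuine cover over the complement of the
  branching points.\<close>

definition has_degree :: "'a topology \<Rightarrow> 'b topology \<Rightarrow> ('a \<Rightarrow> 'b) \<Rightarrow> nat \<Rightarrow> bool" where
  "has_degree X Y f d \<longleftrightarrow>
     (\<forall>y \<in> topspace Y - branching_points X Y f. finite (fibre X f y) \<and> card (fibre X f y) = d)"

definition local_degrees_over ::
  "'a topology \<Rightarrow> 'b topology \<Rightarrow> ('a \<Rightarrow> 'b) \<Rightarrow> 'b \<Rightarrow> nat multiset" where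
  "local_degrees_over X Y f y = image_mset (local_degree X Y f) (mset_set (fibre X f y))"

definition is_partition :: "nat \<Rightarrow> nat multiset \<Rightarrow> bool" where
  "is_partition d P \<longleftrightarrow> 0 \<notin># P \<and> sum_mset P = d"

text \<open>A candidate consists of the covering surface \<open>X\<close>, the base surface \<open>Y\<close>, the degree
  \<open>d\<close> and the multiset \<open>Ps\<close> of partitions; the number of partitions is \<open>size Ps\<close>.
  All the notions below are invariant under homeomorphisms of \<open>X\<close> and \<open>Y\<close>.\<close>

definition candidate_surface_branched_cover ::
  "'a topology \<Rightarrow> 'b topology \<Rightarrow> nat \<Rightarrow> nat multiset multiset \<Rightarrow> bool" where
  "candidate_surface_branched_cover X Y d Ps \<longleftrightarrow>
     closed_connected_orientable_surface X \<and> closed_connected_orientable_surface Y \<and>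
     d \<ge> 2 \<and> size Ps \<ge> 1 \<and>
     (\<forall>P \<in># Ps. is_partition d P \<and> (\<exists>e \<in># P. e > 1)) \<and>
     euler_char X - int (\<Sum>P \<in># Ps. size P) = int d * (euler_char Y - int (size Ps))"

definition realizable ::
  "'a topology \<Rightarrow> 'b topology \<Rightarrow> nat \<Rightarrow> nat multiset multiset \<Rightarrow> bool" where
  "realizable X Y d Ps \<longleftrightarrow>
     (\<exists>f. branched_cover X Y f \<and> has_degree X Y f d \<and>
        finite (branching_points X Y f) \<and> card (branching_points X Y f) = size Ps \<and>
        image_mset (local_degrees_over X Y f) (mset_set (branching_points X Y f)) = Ps)"

text \<open>A 2-orbifold is recorded by its underlying surface and the multiset of its cone orders;
  up to homeomorphism the positions of the cone points on a connected surface do not matter.\<close>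

type_synonym 'a orbifold = "'a topology \<times> nat multiset"

definition same_orbifold :: "'a orbifold \<Rightarrow> 'b orbifold \<Rightarrow> bool" where
  "same_orbifold P Q \<longleftrightarrow> fst P homeomorphic_space fst Q \<and> snd P = snd Q"

definition lcm_partition :: "nat multiset \<Rightarrow> nat" where
  "lcm_partition P = Lcm (set_mset P)"

definition induced_base :: "'b topology \<Rightarrow> nat multiset multiset \<Rightarrow> 'b orbifold" where
  "induced_base Y Ps = (Y, filter_mset (\<lambda>p. p \<noteq> 1) (image_mset lcm_partition Ps))"

definition induced_total :: "'a topology \<Rightarrow> nat multiset multiset \<Rightarrow> 'a orbifold" where
  "induced_total X Ps =
     (X, filter_mset (\<lambda>p. p \<noteq> 1) (\<Sum>P \<in># Ps. image_mset (\<lambda>e. lcm_partition P div e) P))"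

definition induces_candidate_orbifold_cover ::
  "'a topology \<Rightarrow> 'b topology \<Rightarrow> nat multiset multiset \<Rightarrow> 'c orbifold \<Rightarrow> 'd orbifold \<Rightarrow> bool" where
  "induces_candidate_orbifold_cover X Y Ps P Q \<longleftrightarrow>
     same_orbifold (induced_total X Ps) P \<and> same_orbifold (induced_base Y Ps) Q"

end

theory Submission
  imports Defs "HOL-Complex_Analysis.Complex_Analysis" "HOL-Computational_Algebra.Fundamental_Theorem_Algebra"
begin

text \<open>Let \<open>p3\<close> and \<open>p6\<close> be the quotient maps of the plane by the groups generated by the translations by
  Eisenstein integers and a rotation of order 3, respectively 6; exponentials of the weights of the root
  system \<open>A\<^sub>2\<close> give explicit versions with values in the sphere. An affine map \<open>z \<mapsto> \<lambda> z + c\<close> with \<open>\<lambda>\<close>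
  Eisenstein and suitable \<open>c\<close> induces a branched cover of degree \<open>2 \<bar>\<lambda>\<bar>\<^sup>2\<close> between the quotients, and \<open>c\<close>
  decides over which branching points the three cone points lie; this gives the realizations.
  Conversely, a realizing map \<open>f\<close> branches at most as much as \<open>p6\<close>, so \<open>p6\<close> lifts through \<open>f\<close>. The
  translations fixing a lift form an ideal of the Eisenstein integers, and counting lifts shows that
  the degree of \<open>f\<close> is twice the norm of a generator. Finally a norm is never \<open>2\<close> modulo \<open>3\<close>, and
  \<open>x\<^sup>2 + x y + y\<^sup>2\<close> becomes \<open>3 (x\<^sup>2 + 3 x y + 3 y\<^sup>2)\<close> when it is divisible by \<open>3\<close>.\<close>

section \<open>The Eisenstein integers\<close>

text \<open>The factor 2 in the degree is the index of the rotation group of order 3 in the one of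
  order 6; the other factor is the index of an ideal. The branching points of a realizing map may
  lie anywhere, so a homeomorphism of the sphere moves them to the three cone values of
  \<open>p6\<close>. The main obstacle is that \<open>f\<close> is itself branched, so lifting
  through it is not lifting through a covering map: near a cone point it means extracting a
  continuous k-th root, which exists because the local degree k divides the order of the stabiliser
  there. A value at a cone point need not determine the lift, so uniqueness and counting start from
  generic points. In all four families the partitions force two facts about lifts: some rotation of
  order 3 fixes a lift, since a 2 occurs over the point of order 6 or a 1 over the point of order 3,
  and no rotation of order 6 fixes any, since no local degree over the point of order 6 is 1. Hence
  the group fixing a lift consists of the translations by an ideal extended by rotations of order 3.
  The last family at k has the degree of the first at k + 1 and comes from the same linear part with
  another constant c.\<close>

definition omega :: complex ("\<omega>") where "\<omega> = Complex (- 1 / 2) (sqrt 3 / 2)"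

definition eis :: "complex set" where "eis = {of_int a + of_int b * \<omega> | a b. True}"

lemma omega_square: "\<omega> * \<omega> = - 1 - \<omega>"
  by (simp add: omega_def complex_eq_iff)

lemma omega_power2: "\<omega>\<^sup>2 = - 1 - \<omega>"
  by (simp add: power2_eq_square omega_square)

lemma omega_cube: "\<omega> ^ 3 = 1"
  by (simp add: power3_eq_cube omega_square algebra_simps)

lemma cnj_omega: "cnj \<omega> = - 1 - \<omega>"
  by (simp add: omega_def complex_eq_iff)

lemma norm_omega [simp]: "cmod \<omega> = 1"
  by (simp add: omega_def cmod_def power_divide)

lemma omega_ne [simp]: "\<omega> \<noteq> 0" "\<omega> \<noteq> 1" "1 - \<omega> \<noteq> 0" "1 + \<omega> \<noteq> 0"
  by (auto simp: omega_def complex_eq_iff)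

lemma omega_coords_norm:
  "(cmod (of_real x + of_real y * \<omega>))\<^sup>2 = x\<^sup>2 - x * y + y\<^sup>2"
proof -
  have "(cmod (of_real x + of_real y * \<omega>))\<^sup>2 = (x - y / 2)\<^sup>2 + (y * sqrt 3 / 2)\<^sup>2"
    by (simp add: cmod_power2 omega_def)
  also have "\<dots> = x\<^sup>2 - x * y + y\<^sup>2"
    by (simp add: power2_eq_square field_simps)
  finally show ?thesis .
qed

lemma eis_norm_square:
  "(cmod (of_int a + of_int b * \<omega>))\<^sup>2 = of_int (a\<^sup>2 - a * b + b\<^sup>2)"
  using omega_coords_norm[of "of_int a" "of_int b"] by simp

lemma omega_coords_eq_iff:
  "of_real x + of_real y * \<omega> = of_real x' + of_real y' * \<omega> \<longleftrightarrow> x = x' \<and> y = y'"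
  by (auto simp: omega_def complex_eq_iff)

lemma omega_coords_exist: "\<exists>x y. z = of_real x + of_real y * \<omega>"
proof -
  have "z = of_real (Re z + Im z / sqrt 3) + of_real (2 * Im z / sqrt 3) * \<omega>"
    by (simp add: omega_def complex_eq_iff)
  then show ?thesis by blast
qed

lemma eisI: "of_int a + of_int b * \<omega> \<in> eis"
  by (auto simp: eis_def)

lemma eisE:
  assumes "z \<in> eis" obtains a b where "z = of_int a + of_int b * \<omega>"
  using assms by (auto simp: eis_def)

lemma eis_of_int [simp]: "of_int a \<in> eis"
  using eisI[of a 0] by simp

lemma eis_of_nat [simp]: "of_nat a \<in> eis"
  using eis_of_int[of "int a"] by simp

lemma eis_0 [simp]: "0 \<in> eis" and eis_1 [simp]: "1 \<in> eis" and eis_omega [simp]: "\<omega> \<in> eis"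
  using eis_of_int[of 0] eis_of_int[of 1] eisI[of 0 1] by auto

lemma eis_numeral [simp]: "numeral n \<in> eis"
  using eis_of_nat[of "numeral n"] by simp

lemma eis_add [intro]: "x \<in> eis \<Longrightarrow> y \<in> eis \<Longrightarrow> x + y \<in> eis"
proof (elim eisE)
  fix a b c d assume "x = of_int a + of_int b * \<omega>" "y = of_int c + of_int d * \<omega>"
  then have "x + y = of_int (a + c) + of_int (b + d) * \<omega>" by (simp add: algebra_simps)
  then show ?thesis by (simp only: eisI)
qed

lemma eis_minus [intro]: "x \<in> eis \<Longrightarrow> - x \<in> eis"
proof (elim eisE)
  fix a b assume "x = of_int a + of_int b * \<omega>"
  then have "- x = of_int (- a) + of_int (- b) * \<omega>" by (simp add: algebra_simps)
  then show ?thesis by (simp only: eisI)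
qed

lemma eis_minus_iff [simp]: "- x \<in> eis \<longleftrightarrow> x \<in> eis"
  using eis_minus by fastforce

lemma eis_diff [intro]: "x \<in> eis \<Longrightarrow> y \<in> eis \<Longrightarrow> x - y \<in> eis"
  using eis_add[of x "- y"] by auto

lemma eis_mult [intro]: "x \<in> eis \<Longrightarrow> y \<in> eis \<Longrightarrow> x * y \<in> eis"
proof (elim eisE)
  fix a b c d assume *: "x = of_int a + of_int b * \<omega>" "y = of_int c + of_int d * \<omega>"
  have "x * y = of_int a * of_int c + (of_int a * of_int d + of_int b * of_int c) * \<omega>
      + of_int b * of_int d * (\<omega> * \<omega>)"
    by (simp add: * algebra_simps)
  also have "\<dots> = of_int (a * c - b * d) + of_int (a * d + b * c - b * d) * \<omega>"
    by (simp add: omega_square algebra_simps)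
  finally show ?thesis by (simp only: eisI)
qed

lemma eis_power [intro]: "x \<in> eis \<Longrightarrow> x ^ n \<in> eis"
  by (induction n) auto

lemma eis_cnj [simp, intro]: "x \<in> eis \<Longrightarrow> cnj x \<in> eis"
  by (elim eisE) (auto simp: cnj_omega intro!: eis_add eis_diff eis_mult)

lemma norm_square_in_Ints: "x \<in> eis \<Longrightarrow> (cmod x)\<^sup>2 \<in> \<int>"
  by (elim eisE) (simp only: eis_norm_square Ints_of_int)

text \<open>Squared norms are integers, so one below 1 is 0; distinct Eisenstein integers are
  therefore at distance at least 1.\<close>

lemma eis_discrete:
  assumes "x \<in> eis" "cmod x < 1" shows "x = 0"
proof -
  obtain n where n: "(cmod x)\<^sup>2 = of_int n" using norm_square_in_Ints[OF assms(1)] by (auto elim: Ints_cases)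
  have "(cmod x)\<^sup>2 < 1" using assms(2) by (simp add: power_less_one_iff)
  then have "n < 1" using n by simp
  moreover have "0 \<le> n" using n by (metis of_int_0_le_iff zero_le_power2)
  ultimately have "n = 0" by simp
  then show ?thesis using n by simp
qed

text \<open>Rounding both coordinates leaves \<open>u\<close> and \<open>v\<close> of size at most
  1/2, and u^2 - u v + v^2 is then at most 3/4. This gives Euclidean division as well as a bounded
  set that meets every orbit of translations.\<close>

lemma eis_approx: "\<exists>q\<in>eis. cmod (w - q) < 1"
proof -
  obtain x y where w: "w = of_real x + of_real y * \<omega>" using omega_coords_exist by blast
  define u v where "u = x - round x" and "v = y - round y"
  have uv: "\<bar>u\<bar> \<le> 1/2" "\<bar>v\<bar> \<le> 1/2"
    using of_int_round_abs_le[of x] of_int_round_abs_le[of y] by (auto simp: u_def v_def abs_minus_commute)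
  have "w - (of_int (round x) + of_int (round y) * \<omega>) = of_real u + of_real v * \<omega>"
    by (simp add: w u_def v_def algebra_simps)
  moreover have "(cmod (of_real u + of_real v * \<omega>))\<^sup>2 < 1\<^sup>2"
  proof -
    have "u\<^sup>2 \<le> (1/2)\<^sup>2" "v\<^sup>2 \<le> (1/2)\<^sup>2"
      using uv power_mono[of "\<bar>u\<bar>" "1/2" 2] power_mono[of "\<bar>v\<bar>" "1/2" 2] by auto
    moreover have "- (u * v) \<le> 1/2 * (1/2)"
      using mult_mono[OF uv] by (simp add: abs_mult[symmetric])
    ultimately show ?thesis by (simp add: omega_coords_norm power_divide)
  qed
  then have "cmod (of_real u + of_real v * \<omega>) < 1" by (simp add: power_less_one_iff abs_square_less_1)
  ultimately show ?thesis using eisI by metis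
qed

section \<open>Residue systems modulo an Eisenstein integer, and principal ideals\<close>

definition eis_reps :: "complex \<Rightarrow> complex set \<Rightarrow> bool" where
  "eis_reps m R \<longleftrightarrow> R \<subseteq> eis \<and> (\<forall>x\<in>eis. \<exists>!r. r \<in> R \<and> (\<exists>q\<in>eis. x - r = m * q))"

definition eis_mod :: "complex \<Rightarrow> complex \<Rightarrow> complex \<Rightarrow> bool" where
  "eis_mod m x y \<longleftrightarrow> (\<exists>q\<in>eis. x - y = m * q)"

lemma eis_mod_refl: "eis_mod m x x"
  by (auto simp: eis_mod_def intro!: bexI[of _ 0])

lemma eis_mod_sym: "eis_mod m x y \<Longrightarrow> eis_mod m y x"
  unfolding eis_mod_def by (metis eis_minus minus_diff_eq mult_minus_right)

lemma eis_mod_trans: "eis_mod m x y \<Longrightarrow> eis_mod m y z \<Longrightarrow> eis_mod m x z"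
proof -
  assume "eis_mod m x y" "eis_mod m y z"
  then obtain q q' where "q \<in> eis" "q' \<in> eis" "x - y = m * q" "y - z = m * q'"
    by (auto simp: eis_mod_def)
  then have "q + q' \<in> eis" "x - z = m * (q + q')" by (auto simp: algebra_simps)
  then show ?thesis unfolding eis_mod_def by blast
qed

text \<open>Congruence is an equivalence, so one representative per class amounts to every class
  being met and no two members of \<open>R\<close> being congruent. The systems below are checked in
  this form.\<close>

lemma eis_reps_alt:
  "eis_reps m R \<longleftrightarrow> R \<subseteq> eis \<and> (\<forall>x\<in>eis. \<exists>r\<in>R. eis_mod m x r) \<and> (\<forall>r\<in>R. \<forall>s\<in>R. eis_mod m r s \<longrightarrow> r = s)"
proof -
  have "(\<forall>x\<in>eis. \<exists>!r. r \<in> R \<and> eis_mod m x r) \<longleftrightarrow>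
    (\<forall>x\<in>eis. \<exists>r\<in>R. eis_mod m x r) \<and> (\<forall>r\<in>R. \<forall>s\<in>R. eis_mod m r s \<longrightarrow> r = s)" if "R \<subseteq> eis"
  proof (intro iffI conjI ballI impI)
    assume *: "\<forall>x\<in>eis. \<exists>!r. r \<in> R \<and> eis_mod m x r"
    show "\<exists>r\<in>R. eis_mod m x r" if "x \<in> eis" for x using bspec[OF * that] by (elim ex1E) auto
    fix r s assume "r \<in> R" "s \<in> R" "eis_mod m r s"
    moreover from this have "\<exists>!t. t \<in> R \<and> eis_mod m r t" using * \<open>R \<subseteq> eis\<close> by blast
    ultimately show "r = s" using eis_mod_refl[of m r] by (elim ex1E) metis
  next
    fix x assume *: "(\<forall>x\<in>eis. \<exists>r\<in>R. eis_mod m x r) \<and> (\<forall>r\<in>R. \<forall>s\<in>R. eis_mod m r s \<longrightarrow> r = s)" "x \<in> eis"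
    then obtain r where "r \<in> R" "eis_mod m x r" by blast
    moreover have "s = r" if "s \<in> R" "eis_mod m x s" for s
      using * that calculation eis_mod_sym[of m x s] eis_mod_trans[of m s x r] by blast
    ultimately show "\<exists>!r. r \<in> R \<and> eis_mod m x r" by blast
  qed
  then show ?thesis unfolding eis_reps_def eis_mod_def[symmetric] by (rule conj_cong[OF refl])
qed

lemma eis_reps_ex: "eis_reps m R \<Longrightarrow> x \<in> eis \<Longrightarrow> \<exists>r\<in>R. eis_mod m x r"
  by (simp add: eis_reps_alt)

lemma eis_reps_unique: "eis_reps m R \<Longrightarrow> r \<in> R \<Longrightarrow> s \<in> R \<Longrightarrow> eis_mod m r s \<Longrightarrow> r = s"
  by (simp add: eis_reps_alt)

lemma eis_reps_subset: "eis_reps m R \<Longrightarrow> R \<subseteq> eis"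
  by (simp add: eis_reps_alt)

text \<open>Sending each \<open>r\<close> to the member of \<open>S\<close> congruent to it is
  invertible, so the number of residues depends on \<open>m\<close> only.\<close>

lemma eis_reps_bij:
  assumes R: "eis_reps m R" and S: "eis_reps m S"
  shows "\<exists>f. bij_betw f R S"
proof -
  define f where "f r = (SOME s. s \<in> S \<and> eis_mod m r s)" for r
  have f: "f r \<in> S \<and> eis_mod m r (f r)" if "r \<in> R" for r
  proof -
    have "r \<in> eis" using R that unfolding eis_reps_alt by blast
    then have "\<exists>s. s \<in> S \<and> eis_mod m r s" using eis_reps_ex[OF S] by blast
    then show ?thesis unfolding f_def by (rule someI_ex)
  qed
  have "inj_on f R"
  proof (rule inj_onI)
    fix x y assume "x \<in> R" "y \<in> R" "f x = f y"
    then have "eis_mod m x y" using f[of x] f[of y] eis_mod_sym[of m y "f y"] eis_mod_trans[of m x "f x" y] by metis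
    then show "x = y" using R \<open>x \<in> R\<close> \<open>y \<in> R\<close> unfolding eis_reps_alt by blast
  qed
  moreover have "f ` R = S"
  proof
    show "S \<subseteq> f ` R"
    proof
      fix s assume s: "s \<in> S"
      then have "s \<in> eis" using S unfolding eis_reps_alt by blast
      then obtain r where "r \<in> R" "eis_mod m s r" using R unfolding eis_reps_alt by blast
      then have "eis_mod m s (f r)" using f[of r] eis_mod_trans[of m s r "f r"] by blast
      then have "f r = s" using S s f[OF \<open>r \<in> R\<close>] unfolding eis_reps_alt by blast
      then show "s \<in> f ` R" using \<open>r \<in> R\<close> by blast
    qed
  qed (use f in auto)
  ultimately show ?thesis by (auto simp: bij_betw_def)
qed

lemma eis_reps_card_eq:
  assumes "eis_reps m R" "eis_reps m S" shows "card R = card S" "finite R \<longleftrightarrow> finite S"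
  using eis_reps_bij[OF assms] bij_betw_same_card bij_betw_finite by blast+

lemma eis_reps_of_nat:
  assumes n: "n > 0"
  shows "\<exists>R. eis_reps (of_nat n) R \<and> finite R \<and> card R = n * n"
proof -
  define g where "g p = (of_nat (fst p) + of_nat (snd p) * \<omega> :: complex)" for p :: "nat \<times> nat"
  define R where "R = g ` ({..<n} \<times> {..<n})"
  have g_eq: "fst p = fst q \<and> snd p = snd q" if "g p = g q" for p q
    using that omega_coords_eq_iff[of "real (fst p)" "real (snd p)" "real (fst q)" "real (snd q)"]
    by (simp add: g_def)
  then have "inj_on g ({..<n} \<times> {..<n})" by (intro inj_onI prod_eqI) blast+
  then have card: "card R = n * n" by (simp add: R_def card_image)
  have "eis_reps (of_nat n) R" unfolding eis_reps_alt
  proof (intro conjI ballI impI)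
    show "R \<subseteq> eis" by (auto simp: R_def g_def intro!: eis_add eis_mult)
    fix x assume "x \<in> eis"
    then obtain a b where x: "x = of_int a + of_int b * \<omega>" by (elim eisE)
    define r where "r = g (nat (a mod int n), nat (b mod int n))"
    have "x - r = of_int (a - a mod int n) + of_int (b - b mod int n) * \<omega>"
      using n by (simp add: x r_def g_def algebra_simps)
    also have "\<dots> = of_nat n * (of_int (a div int n) + of_int (b div int n) * \<omega>)"
      by (simp only: minus_mod_eq_mult_div of_int_mult of_int_of_nat_eq distrib_left mult.assoc)
    finally have "eis_mod (of_nat n) x r" unfolding eis_mod_def using eisI by blast
    moreover have "r \<in> R"
      using n unfolding R_def r_def
      by (intro imageI) (simp add: nat_less_iff)
    ultimately show "\<exists>r\<in>R. eis_mod (of_nat n) x r" by blast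
  next
    fix r s assume "r \<in> R" "s \<in> R" and m: "eis_mod (of_nat n) r s"
    then obtain i j i' j' where rs: "r = g (i, j)" "s = g (i', j')" "i < n" "j < n" "i' < n" "j' < n"
      by (auto simp: R_def)
    obtain a b where "r - s = of_nat n * (of_int a + of_int b * \<omega>)"
      using m by (auto simp: eis_mod_def elim!: eisE)
    then have "of_real (real i - real i') + of_real (real j - real j') * \<omega>
       = of_real (real n * of_int a) + of_real (real n * of_int b) * \<omega>"
      by (simp add: rs g_def algebra_simps)
    then have "real i - real i' = real n * of_int a" "real j - real j' = real n * of_int b"
      unfolding omega_coords_eq_iff by auto
    then have "int i - int i' = int n * a" "int j - int j' = int n * b"
      by (simp_all flip: of_int_eq_iff[where 'a=real])
    then have "int i mod int n = int i' mod int n" "int j mod int n = int j' mod int n"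
      by (simp_all add: mod_eq_dvd_iff)
    then show "r = s" using rs by simp
  qed
  then show ?thesis using card n by (auto intro!: exI[of _ R] simp: R_def)
qed

lemma eis_reps_exist:
  assumes "m \<in> eis" "m \<noteq> 0" shows "\<exists>R. eis_reps m R \<and> finite R"
proof -
  obtain a b where ab: "m = of_int a + of_int b * \<omega>" using assms by (elim eisE)
  define n where "n = nat (a\<^sup>2 - a * b + b\<^sup>2)"
  have mm: "(cmod m)\<^sup>2 = of_int (a\<^sup>2 - a * b + b\<^sup>2)" using eis_norm_square ab by simp
  have pos: "0 < a\<^sup>2 - a * b + b\<^sup>2" using mm assms(2)
    by (metis norm_eq_zero of_int_0_less_iff zero_less_power2)
  then have n: "n > 0" "m * cnj m = of_nat n"
    using mm by (auto simp: n_def complex_norm_square[symmetric])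
  obtain T where T: "eis_reps (of_nat n) T" "finite T" using eis_reps_of_nat[OF n(1)] by blast
  \<comment> \<open>Since \<open>m * cnj m\<close> is the integer \<open>n\<close>, congruence
    modulo \<open>n\<close> implies congruence modulo \<open>m\<close>. So every class modulo
    \<open>m\<close> meets \<open>T\<close>, and choosing one member of \<open>T\<close> per class
    gives a finite system.\<close>
  define f where "f x = (SOME t. t \<in> T \<and> eis_mod m x t)" for x
  have ex: "\<exists>t. t \<in> T \<and> eis_mod m x t" if x: "x \<in> eis" for x
  proof -
    obtain t q where "t \<in> T" "q \<in> eis" "x - t = m * (cnj m * q)"
      using eis_reps_ex[OF T(1) x] n
      by (auto simp: eis_mod_def mult.assoc[symmetric])
    then show ?thesis using assms(1) unfolding eis_mod_def by blast
  qed
  have f: "f x \<in> T \<and> eis_mod m x (f x)" if "x \<in> eis" for x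
    unfolding f_def by (rule someI_ex) (rule ex[OF that])
  have f_eq: "f x = f y" if "eis_mod m x y" for x y
    unfolding f_def using that by (metis eis_mod_sym eis_mod_trans)
  have "eis_reps m (f ` eis)" unfolding eis_reps_alt
  proof (intro conjI ballI impI)
    show "f ` eis \<subseteq> eis" using f T by (auto simp: eis_reps_alt)
    show "\<exists>r\<in>f ` eis. eis_mod m x r" if "x \<in> eis" for x using f that by blast
    fix r s assume "r \<in> f ` eis" "s \<in> f ` eis" "eis_mod m r s"
    then show "r = s" using f_eq f by (metis eis_mod_trans image_iff eis_mod_sym)
  qed
  moreover have "f ` eis \<subseteq> T" using f by auto
  ultimately show ?thesis using T(2) finite_subset by blast
qed

text \<open>A two-digit expansion: \<open>r\<close> is the digit modulo \<open>m\<close>, and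
  \<open>s\<close> is the digit modulo \<open>n\<close> of the quotient. Injectivity is recorded
  too, because it makes the numbers of residues multiply.\<close>

lemma eis_reps_mult:
  assumes m: "m \<in> eis" "m \<noteq> 0" and n: "n \<in> eis" and R: "eis_reps m R" and S: "eis_reps n S"
  shows "eis_reps (m * n) ((\<lambda>(r, s). r + m * s) ` (R \<times> S))"
    and "inj_on (\<lambda>(r, s). r + m * s) (R \<times> S)"
proof -
  have sub: "R \<subseteq> eis" "S \<subseteq> eis" using R S by (auto simp: eis_reps_alt)
  have key: "r = r' \<and> s = s'"
    if "r \<in> R" "r' \<in> R" "s \<in> S" "s' \<in> S" "eis_mod (m * n) (r + m * s) (r' + m * s')" for r r' s s'
  proof -
    obtain q where q: "q \<in> eis" "r + m * s - (r' + m * s') = m * n * q"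
      using \<open>eis_mod _ _ _\<close> by (auto simp: eis_mod_def)
    have nq: "n * q - s + s' = (r - r') / m"
      using q(2) m(2) by (simp add: field_simps)
    have "n * q - s + s' \<in> eis" using q sub that n by blast
    then have "eis_mod m r r'" using nq m(2) unfolding eis_mod_def
      by (metis nonzero_mult_div_cancel_left times_divide_eq_right)
    then have "r = r'" using R that unfolding eis_reps_alt by blast
    then have "s - s' = n * q" using nq by (simp add: algebra_simps)
    then have "eis_mod n s s'" using q(1) unfolding eis_mod_def by blast
    then show ?thesis using \<open>r = r'\<close> S that unfolding eis_reps_alt by blast
  qed
  show "inj_on (\<lambda>(r, s). r + m * s) (R \<times> S)"
  proof (rule inj_onI)
    fix x y assume xy: "x \<in> R \<times> S" "y \<in> R \<times> S" "(\<lambda>(r, s). r + m * s) x = (\<lambda>(r, s). r + m * s) y"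
    obtain r s r' s' where rs: "x = (r, s)" "y = (r', s')" by fastforce
    show "x = y" using key[of r r' s s'] xy eis_mod_refl[of "m * n" "r + m * s"] by (simp add: rs)
  qed
  show "eis_reps (m * n) ((\<lambda>(r, s). r + m * s) ` (R \<times> S))" unfolding eis_reps_alt
  proof (intro conjI ballI impI)
    show "(\<lambda>(r, s). r + m * s) ` (R \<times> S) \<subseteq> eis" using sub m by (auto intro!: eis_add eis_mult)
    fix x assume "x \<in> eis"
    from eis_reps_ex[OF R this] obtain r q where r: "r \<in> R" "q \<in> eis" "x - r = m * q" by (auto simp: eis_mod_def)
    from eis_reps_ex[OF S r(2)] obtain s q' where s: "s \<in> S" "q' \<in> eis" "q - s = n * q'" by (auto simp: eis_mod_def)
    have "x - (r + m * s) = m * (q - s)" using r(3) by (simp add: algebra_simps)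
    then have "eis_mod (m * n) x (r + m * s)" using s unfolding eis_mod_def by (metis mult.assoc)
    then show "\<exists>r\<in>(\<lambda>(r, s). r + m * s) ` (R \<times> S). eis_mod (m * n) x r" using r s
      by (intro bexI[of _ "r + m * s"]) auto
  next
    fix x y assume xy: "x \<in> (\<lambda>(r, s). r + m * s) ` (R \<times> S)" "y \<in> (\<lambda>(r, s). r + m * s) ` (R \<times> S)" "eis_mod (m * n) x y"
    then obtain r s r' s' where "r \<in> R" "s \<in> S" "r' \<in> R" "s' \<in> S" "x = r + m * s" "y = r' + m * s'" by auto
    then show "x = y" using key[of r r' s s'] xy(3) by simp
  qed
qed

lemma eis_reps_cnj:
  assumes "eis_reps m R" shows "eis_reps (cnj m) (cnj ` R)"
proof -
  have *: "eis_mod m x y" if as: "eis_mod (cnj m) (cnj x) (cnj y)" for x y m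
  proof -
    obtain q where q: "q \<in> eis" "cnj x - cnj y = cnj m * q" using as by (auto simp: eis_mod_def)
    then have "cnj (x - y) = cnj (m * cnj q)" by simp
    then have "x - y = m * cnj q" by (simp only: complex_cnj_cancel_iff)
    then show ?thesis unfolding eis_mod_def using q(1) by (intro bexI[of _ "cnj q"]) auto
  qed
  show ?thesis unfolding eis_reps_alt
  proof (intro conjI ballI impI)
    show "cnj ` R \<subseteq> eis" using assms by (auto simp: eis_reps_alt)
    fix x assume "x \<in> eis"
    then have "cnj x \<in> eis" by simp
    then obtain r where "r \<in> R" "eis_mod m (cnj x) r" using assms unfolding eis_reps_alt by blast
    then have "eis_mod (cnj m) x (cnj r)" using *[of "cnj m" x "cnj r"] by simp
    then show "\<exists>r\<in>cnj ` R. eis_mod (cnj m) x r" using \<open>r \<in> R\<close> by blast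
  next
    fix r s assume rs: "r \<in> cnj ` R" "s \<in> cnj ` R" "eis_mod (cnj m) r s"
    then obtain r' s' where "r' \<in> R" "s' \<in> R" "r = cnj r'" "s = cnj s'" by blast
    then show "r = s" using *[of m r' s'] rs assms unfolding eis_reps_alt by blast
  qed
qed

text \<open>The ideals of \<open>m\<close> and of its conjugate have the same index, and the product of the two indices
  is the index \<open>\<bar>m\<bar>\<^sup>4\<close> of the ideal of the integer \<open>\<bar>m\<bar>\<^sup>2\<close>.\<close>

lemma eis_reps_card:
  assumes "m \<in> eis" "m \<noteq> 0" "eis_reps m R"
  shows "finite R" "real (card R) = (cmod m)\<^sup>2"
proof -
  show fin: "finite R" using eis_reps_exist[OF assms(1,2)] eis_reps_card_eq assms(3) by blast
  obtain k where k: "(cmod m)\<^sup>2 = of_int k" using norm_square_in_Ints[OF assms(1)] by (auto elim: Ints_cases)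
  define n where "n = nat k"
  have "0 < (cmod m)\<^sup>2" using assms(2) by simp
  then have "k > 0" using k by simp
  then have n: "n > 0" "(cmod m)\<^sup>2 = real n" using k by (auto simp: n_def)
  then have mm: "m * cnj m = of_nat n" by (simp add: complex_norm_square[symmetric])
  obtain T where T: "eis_reps (of_nat n) T" "card T = n * n" using eis_reps_of_nat[OF n(1)] by blast
  have "cnj m \<in> eis" using assms(1) by simp
  note mult = eis_reps_mult[OF assms(1,2) this assms(3) eis_reps_cnj[OF assms(3)]]
  have "card R * card R = n * n"
    using eis_reps_card_eq(1)[OF mult(1)[unfolded mm] T(1)] T(2) card_image[OF mult(2)]
    by (simp add: card_cartesian_product card_image inj_on_def)
  then have "card R = n" by (metis power2_eq_square power2_eq_iff_nonneg le0)
  then show "real (card R) = (cmod m)\<^sup>2" using n by simp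
qed

text \<open>The Euclidean argument: dividing by an element \<open>m\<close> of least nonzero norm
  leaves a remainder in \<open>I\<close> of smaller norm. Closure under subtraction and under
  multiplication by \<open>\<omega>\<close> already gives closure under all of
  \<open>eis\<close>.\<close>

lemma eis_ideal_principal:
  assumes I: "I \<subseteq> eis" "\<And>x y. x \<in> I \<Longrightarrow> y \<in> I \<Longrightarrow> x - y \<in> I" "\<And>x. x \<in> I \<Longrightarrow> \<omega> * x \<in> I"
    and nz: "\<exists>x\<in>I. x \<noteq> 0"
  obtains m where "m \<in> eis" "m \<noteq> 0" "I = (*) m ` eis"
proof -
  have zero: "0 \<in> I" using nz I(2) by fastforce
  have neg: "- x \<in> I" if "x \<in> I" for x using I(2)[OF zero that] by simp
  have add: "x + y \<in> I" if "x \<in> I" "y \<in> I" for x y using I(2)[OF that(1) neg[OF that(2)]] by simp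
  have nat: "of_nat n * x \<in> I" if "x \<in> I" for n x
    by (induction n) (auto simp: algebra_simps zero that intro: add)
  have int: "of_int n * x \<in> I" if "x \<in> I" for n x
    using nat[OF that, of "nat n"] neg[OF nat[OF that, of "nat (- n)"]] by (cases "n \<ge> 0") auto
  have mult: "x * q \<in> I" if x: "x \<in> I" and q: "q \<in> eis" for x q
  proof -
    obtain a b where "q = of_int a + of_int b * \<omega>" using q by (elim eisE)
    then have "x * q = of_int a * x + of_int b * (\<omega> * x)" by (simp add: algebra_simps)
    then show ?thesis using add int I(3) x by simp
  qed
  \<comment> \<open>The squared norm as a natural number, so that a least value exists.\<close>
  define N where "N x = nat \<lfloor>(cmod x)\<^sup>2\<rfloor>" for x
  have N: "real (N x) = (cmod x)\<^sup>2" if "x \<in> eis" for x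
    using norm_square_in_Ints[OF that] by (auto simp: N_def elim: Ints_cases)
  obtain m where m: "m \<in> I" "m \<noteq> 0" and least: "\<And>x. x \<in> I \<Longrightarrow> x \<noteq> 0 \<Longrightarrow> N m \<le> N x"
    using ex_has_least_nat[of "\<lambda>x. x \<in> I \<and> x \<noteq> 0" _ N] nz by blast
  have me: "m \<in> eis" using m I by blast
  have "x \<in> (*) m ` eis" if x: "x \<in> I" for x
  proof -
    obtain q where q: "q \<in> eis" "cmod (x / m - q) < 1" using eis_approx by blast
    have r: "x - m * q \<in> I" using I(2) x mult[OF m(1) q(1)] by blast
    have "cmod (x - m * q) = cmod m * cmod (x / m - q)"
      using m(2) by (simp add: norm_mult[symmetric] algebra_simps)
    also have "\<dots> < cmod m" using q(2) m(2) by simp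
    finally have "real (N (x - m * q)) < real (N m)"
      using N r I(1) me by (simp add: subset_iff power_strict_mono)
    then have "x - m * q = 0" using least[OF r] by force
    then show ?thesis using q by auto
  qed
  then have "I = (*) m ` eis" using mult m by auto
  then show ?thesis using that me m by blast
qed

section \<open>The prime above 3 and the form i^2 + i j + j^2\<close>

abbreviation theta :: complex ("\<theta>") where "\<theta> \<equiv> 1 - \<omega>"

lemma eis_theta [simp]: "\<theta> \<in> eis"
  by (intro eis_diff) auto

lemma theta_mult_cnj: "\<theta> * (2 + \<omega>) = 3"
  by (simp add: algebra_simps omega_square)

lemma norm_theta_square: "(cmod \<theta>)\<^sup>2 = 3"
  using eis_norm_square[of 1 "-1"] by simp

text \<open>\<open>\<omega>\<close> is congruent to 1 modulo \<open>\<theta>\<close>, so the number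
  has residue a + b in the field with three elements.\<close>

lemma theta_dvd_iff:
  "(of_int a + of_int b * \<omega>) / \<theta> \<in> eis \<longleftrightarrow> 3 dvd a + b"
proof
  assume "(of_int a + of_int b * \<omega>) / \<theta> \<in> eis"
  then obtain p q where "(of_int a + of_int b * \<omega>) / \<theta> = of_int p + of_int q * \<omega>" by (elim eisE)
  then have "of_int a + of_int b * \<omega> = \<theta> * (of_int p + of_int q * \<omega>)" by (simp add: field_simps)
  also have "\<dots> = of_int p + (of_int q - of_int p) * \<omega> - of_int q * (\<omega> * \<omega>)" by (simp add: algebra_simps)
  also have "\<dots> = of_int (p + q) + of_int (2 * q - p) * \<omega>" by (simp add: omega_square algebra_simps)
  finally have "a = p + q" "b = 2 * q - p"
    using omega_coords_eq_iff[of "of_int a" "of_int b" "of_int (p + q)" "of_int (2 * q - p)"] by auto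
  then show "3 dvd a + b" by simp
next
  assume "3 dvd a + b"
  then obtain q where q: "a + b = 3 * q" by blast
  then have a: "a = 3 * q - b" by simp
  have "of_int a + of_int b * \<omega> = \<theta> * (of_int (2 * q - b) + of_int q * \<omega>)"
  proof -
    have "\<theta> * (of_int (2 * q - b) + of_int q * \<omega>) = 2 * of_int q - of_int b + (of_int q - 2 * of_int q + of_int b) * \<omega> - of_int q * (\<omega> * \<omega>)"
      by (simp add: algebra_simps)
    also have "\<dots> = of_int a + of_int b * \<omega>" by (simp add: omega_square a algebra_simps)
    finally show ?thesis by simp
  qed
  then have "(of_int a + of_int b * \<omega>) / \<theta> = of_int (2 * q - b) + of_int q * \<omega>" by simp
  then show "(of_int a + of_int b * \<omega>) / \<theta> \<in> eis" by (simp only: eisI)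
qed

lemma eis_mod_theta:
  assumes "x \<in> eis" shows "x / \<theta> \<in> eis \<or> (x - 1) / \<theta> \<in> eis \<or> (x + 1) / \<theta> \<in> eis"
proof -
  obtain a b where x: "x = of_int a + of_int b * \<omega>" using assms by (elim eisE)
  have "3 dvd a + b \<or> 3 dvd a - 1 + b \<or> 3 dvd a + 1 + b" by presburger
  then show ?thesis
    using theta_dvd_iff[of a b] theta_dvd_iff[of "a - 1" b] theta_dvd_iff[of "a + 1" b]
    by (auto simp: x algebra_simps)
qed

text \<open>The norm form a^2 - a b + b^2 gets its plus sign from absolute values when
  \<open>a\<close> and \<open>b\<close> have opposite signs, and otherwise from p^2 - p q + q^2 = (p
  - q)^2 + (p - q) q + q^2 with p \<ge> q.\<close>

lemma eis_norm_nat: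
  assumes "x \<in> eis" obtains i j :: nat where "(cmod x)\<^sup>2 = real (i\<^sup>2 + i * j + j\<^sup>2)"
proof -
  obtain a b where x: "x = of_int a + of_int b * \<omega>" using assms by (elim eisE)
  have "\<exists>i j :: nat. a\<^sup>2 - a * b + b\<^sup>2 = int (i\<^sup>2 + i * j + j\<^sup>2)"
  proof (cases "a * b \<le> 0")
    case True
    then have "a\<^sup>2 - a * b + b\<^sup>2 = int ((nat \<bar>a\<bar>)\<^sup>2 + nat \<bar>a\<bar> * nat \<bar>b\<bar> + (nat \<bar>b\<bar>)\<^sup>2)"
      by (simp add: abs_mult[symmetric])
    then show ?thesis by blast
  next
    case False
    then have ab: "a * b = \<bar>a\<bar> * \<bar>b\<bar>" by (simp add: abs_mult[symmetric])
    define p q where "p = max \<bar>a\<bar> \<bar>b\<bar>" and "q = min \<bar>a\<bar> \<bar>b\<bar>"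
    have pq: "p \<ge> q" "q \<ge> 0" by (auto simp: p_def q_def)
    have "a\<^sup>2 - a * b + b\<^sup>2 = \<bar>a\<bar>\<^sup>2 - \<bar>a\<bar> * \<bar>b\<bar> + \<bar>b\<bar>\<^sup>2" by (simp add: ab)
    also have "\<dots> = p\<^sup>2 - p * q + q\<^sup>2" by (auto simp: p_def q_def max_def min_def)
    also have "\<dots> = (p - q)\<^sup>2 + (p - q) * q + q\<^sup>2" by (simp add: power2_eq_square algebra_simps)
    also have "\<dots> = int ((nat (p - q))\<^sup>2 + nat (p - q) * nat q + (nat q)\<^sup>2)" using pq by simp
    finally show ?thesis by blast
  qed
  then obtain i j :: nat where "a\<^sup>2 - a * b + b\<^sup>2 = int (i\<^sup>2 + i * j + j\<^sup>2)" by blast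
  then have "(cmod x)\<^sup>2 = real (i\<^sup>2 + i * j + j\<^sup>2)" by (simp only: x eis_norm_square of_int_of_nat_eq)
  then show ?thesis using that by blast
qed

lemma eis_with_norm:
  fixes i j :: nat
  shows "of_nat i - of_nat j * \<omega> \<in> eis" "(cmod (of_nat i - of_nat j * \<omega>))\<^sup>2 = real (i\<^sup>2 + i * j + j\<^sup>2)"
  using eisI[of "int i" "- int j"] eis_norm_square[of "int i" "- int j"] by simp_all

text \<open>The form is congruent to (i - j)^2 modulo 3.\<close>

lemma loeschian_mod_3:
  fixes i j :: nat
  shows "(i\<^sup>2 + i * j + j\<^sup>2) mod 3 = (if [i = j] (mod 3) then 0 else 1)"
proof -
  define p q r t where "p = i div 3" "q = i mod 3" "r = j div 3" "t = j mod 3"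
  then have ij: "i = 3 * p + q" "j = 3 * r + t" "q < 3" "t < 3" by auto
  have "i\<^sup>2 + i * j + j\<^sup>2 = 3 * (3 * p\<^sup>2 + 2 * p * q + 3 * p * r + p * t + q * r + 3 * r\<^sup>2 + 2 * r * t) + (q\<^sup>2 + q * t + t\<^sup>2)"
    unfolding ij by (simp add: power2_eq_square algebra_simps)
  then have "(i\<^sup>2 + i * j + j\<^sup>2) mod 3 = (q\<^sup>2 + q * t + t\<^sup>2) mod 3" by (metis mod_mult_self4)
  moreover have "q = 0 \<or> q = 1 \<or> q = 2" "t = 0 \<or> t = 1 \<or> t = 2" using ij by auto
  moreover have "[i = j] (mod 3) \<longleftrightarrow> q = t" by (simp add: Cong.cong_def \<open>q = i mod 3\<close> \<open>t = j mod 3\<close>)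
  ultimately show ?thesis by auto
qed

text \<open>By symmetry i = j + 3 m, and substitution gives the witnesses x = j and y = m.\<close>

lemma loeschian_div_3:
  fixes i j :: nat
  assumes "[i = j] (mod 3)"
  shows "\<exists>x y :: nat. i\<^sup>2 + i * j + j\<^sup>2 = 3 * (x\<^sup>2 + 3 * x * y + 3 * y\<^sup>2)"
proof -
  have *: "\<exists>x y :: nat. i\<^sup>2 + i * j + j\<^sup>2 = 3 * (x\<^sup>2 + 3 * x * y + 3 * y\<^sup>2)"
    if "[i = j] (mod 3)" "j \<le> i" for i j :: nat
  proof -
    have "3 dvd i - j" using that by (metis cong_altdef_nat)
    then obtain m where "i - j = 3 * m" by (elim dvdE)
    then have "i = j + 3 * m" using that by simp
    then have "i\<^sup>2 + i * j + j\<^sup>2 = 3 * (j\<^sup>2 + 3 * j * m + 3 * m\<^sup>2)"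
      by (simp add: power2_eq_square algebra_simps)
    then show ?thesis by blast
  qed
  show ?thesis
  proof (cases "j \<le> i")
    case False
    then show ?thesis using *[of j i] assms by (simp add: cong_sym algebra_simps)
  qed (use * assms in blast)
qed

section \<open>The sphere as a quotient of the plane\<close>

text \<open>The Vandermonde product, invariant under cyclic shifts and negated by transpositions.
  Its square is the discriminant; the product itself also remembers the cyclic order of the
  triple.\<close>

definition vdm :: "complex \<Rightarrow> complex \<Rightarrow> complex \<Rightarrow> complex" where
  "vdm a b c = (a - b) * (b - c) * (c - a)"

lemma unit_triple_cnj:
  assumes "cmod a = 1" "cmod b = 1" "cmod c = 1" "a * b * c = 1"
  shows "cnj a = b * c" "cnj b = a * c" "cnj c = a * b"
proof -
  have 1: "a * cnj a = 1" "b * cnj b = 1" "c * cnj c = 1"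
    using assms by (simp_all add: complex_norm_square[symmetric])
  show "cnj a = b * c" using 1(1) assms(4) by (metis mult.assoc mult_cancel_left mult_zero_left zero_neq_one)
  show "cnj b = a * c" using 1(2) assms(4) by (metis mult.assoc mult.commute mult_cancel_left mult_zero_left zero_neq_one)
  show "cnj c = a * b" using 1(3) assms(4) by (metis mult.commute mult_cancel_left mult_zero_left zero_neq_one)
qed

text \<open>The discriminant of a cubic expressed by the elementary symmetric functions of its
  roots.\<close>

lemma vdm_square:
  "(vdm a b c)\<^sup>2 = (a + b + c)\<^sup>2 * (a * b + b * c + c * a)\<^sup>2 - 4 * (a * b + b * c + c * a) ^ 3
     - 4 * (a + b + c) ^ 3 * (a * b * c) + 18 * (a + b + c) * (a * b + b * c + c * a) * (a * b * c)
     - 27 * (a * b * c)\<^sup>2"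
  unfolding vdm_def by (simp add: eval_nat_numeral algebra_simps)

text \<open>Minus the discriminant of w^3 - x w^2 + cnj x w - 1. It is nonnegative exactly at the
  sums of three unit numbers with product 1, and the surface j^2 = pillow x consists of two copies
  of that region glued along the boundary, which is a sphere.\<close>

definition pillow :: "complex \<Rightarrow> real" where
  "pillow x = 27 - 18 * (cmod x)\<^sup>2 + 8 * Re (x ^ 3) - (cmod x) ^ 4"

lemma pillow_complex:
  "of_real (pillow x) = 27 - 18 * (x * cnj x) + 4 * (x ^ 3 + cnj x ^ 3) - (x * cnj x)\<^sup>2"
proof -
  have "x ^ 3 + cnj x ^ 3 = of_real (2 * Re (x ^ 3))"
    using complex_add_cnj[of "x ^ 3"] by simp
  moreover have "x * cnj x = of_real ((cmod x)\<^sup>2)" by (simp only: complex_norm_square)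
  moreover have "(cmod x) ^ 4 = ((cmod x)\<^sup>2)\<^sup>2" by simp
  ultimately show ?thesis by (simp only: pillow_def of_real_diff of_real_add of_real_mult of_real_power) simp
qed

text \<open>Conjugation sends each entry to the product of the other two and so turns
  \<open>vdm\<close> into its negative. Hence \<open>vdm\<close> is purely imaginary, and a single
  real number records it.\<close>

lemma unit_triple_pillow:
  assumes "cmod a = 1" "cmod b = 1" "cmod c = 1" "a * b * c = 1"
  shows "vdm a b c = \<i> * of_real (Im (vdm a b c))" "(Im (vdm a b c))\<^sup>2 = pillow (a + b + c)"
proof -
  note cnj = unit_triple_cnj[OF assms]
  have "cnj (vdm a b c) = (b * c - a * c) * (a * c - a * b) * (a * b - b * c)"
    by (simp add: vdm_def cnj)
  also have "\<dots> = - (a * b * c) * vdm a b c" unfolding vdm_def by (simp add: algebra_simps)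
  finally have "cnj (vdm a b c) = - vdm a b c" using assms by simp
  then have "Re (vdm a b c) = 0" by (simp add: complex_eq_iff)
  then show V: "vdm a b c = \<i> * of_real (Im (vdm a b c))" by (simp add: complex_eq_iff)
  have cx: "cnj (a + b + c) = a * b + b * c + c * a" by (simp add: cnj algebra_simps)
  define x where "x = a + b + c"
  have "of_real ((Im (vdm a b c))\<^sup>2) = - ((vdm a b c)\<^sup>2)"
    by (subst V) (simp add: power_mult_distrib)
  also have "(vdm a b c)\<^sup>2 = x\<^sup>2 * (cnj x)\<^sup>2 - 4 * (cnj x) ^ 3 - 4 * x ^ 3 + 18 * x * cnj x - 27"
    unfolding vdm_square cx[symmetric] assms(4) x_def[symmetric] by simp
  also have "- \<dots> = of_real (pillow x)"
    unfolding pillow_complex by (simp add: power_mult_distrib algebra_simps)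
  finally have "of_real ((Im (vdm a b c))\<^sup>2) = (of_real (pillow (a + b + c)) :: complex)" unfolding x_def .
  then show "(Im (vdm a b c))\<^sup>2 = pillow (a + b + c)" by (simp only: of_real_eq_iff)
qed

text \<open>Equal symmetric functions make the triples permutations of each other, and the sign of
  \<open>vdm\<close> leaves only the cyclic ones. Where \<open>vdm\<close> vanishes two entries
  coincide, and an odd permutation is then a cyclic shift as well.\<close>

lemma triple_same_coeffs:
  fixes a b c a' b' c' :: complex
  assumes "a + b + c = a' + b' + c'" "a * b + b * c + c * a = a' * b' + b' * c' + c' * a'"
    "a * b * c = 1" "a' * b' * c' = 1" "vdm a b c = vdm a' b' c'"
  shows "(a', b', c') = (a, b, c) \<or> (a', b', c') = (b, c, a) \<or> (a', b', c') = (c, a, b)"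
proof -
  \<comment> \<open>The case of equal first entries; cyclic shifts reduce the other cases to
    it.\<close>
  have base: "(a', b', c') = (a, b, c) \<or> (a', b', c') = (b, c, a) \<or> (a', b', c') = (c, a, b)"
    if "a' = a" "a + b + c = a' + b' + c'" "a * b * c = 1" "a' * b' * c' = 1" "vdm a b c = vdm a' b' c'" 
    for a b c :: complex
  proof -
    have "a \<noteq> 0" using that by auto
    then have s: "b' + c' = b + c" using that by auto
    have "a * (b' * c') = a * (b * c)" using that by (simp add: mult.assoc)
    then have q: "b' * c' = b * c" using \<open>a \<noteq> 0\<close> by simp
    have "(b' - b) * (b' - c) = b' * b' - b' * (b + c) + b * c" by (simp add: algebra_simps)
    also have "\<dots> = 0" unfolding s[symmetric] q[symmetric] by (simp add: algebra_simps)
    finally have "b' = b \<or> b' = c" by simp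
    then show ?thesis
    proof
      assume "b' = c"
      then have c': "c' = b" using s by simp
      have "vdm a c b = - vdm a b c" by (simp add: vdm_def algebra_simps)
      then have "vdm a b c = 0" using that(1,5) \<open>b' = c\<close> c' by simp
      then have "a = b \<or> b = c \<or> c = a" by (auto simp: vdm_def)
      then show ?thesis using that(1) \<open>b' = c\<close> c' by auto
    qed (use s that in auto)
  qed
  have "(a' - a) * (a' - b) * (a' - c) = a' ^ 3 - (a + b + c) * a'\<^sup>2 + (a * b + b * c + c * a) * a' - a * b * c"
    by (simp add: power3_eq_cube power2_eq_square algebra_simps)
  also have "\<dots> = 0"
    unfolding assms(1-3) assms(4)[symmetric] by (simp add: power3_eq_cube power2_eq_square algebra_simps)
  finally consider "a' = a" | "a' = b" | "a' = c" by auto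
  then show ?thesis
  proof cases
    case 1 show ?thesis using base[of a b c] 1 assms by auto
  next
    case 2 
    have "vdm b c a = vdm a b c" by (simp add: vdm_def algebra_simps)
    then show ?thesis using base[of b c a] 2 assms by (auto simp: algebra_simps)
  next
    case 3
    have "vdm c a b = vdm a b c" by (simp add: vdm_def algebra_simps)
    then show ?thesis using base[of c a b] 3 assms by (auto simp: algebra_simps)
  qed
qed

lemma Re_le_cube: "\<bar>Re (x ^ 3)\<bar> \<le> cmod x ^ 3"
  using abs_Re_le_cmod[of "x ^ 3"] by (simp add: norm_power)

text \<open>The surface \<open>j\<^sup>2 = pillow x\<close> meets every ray from the origin at most once: dividing the
  difference of the two equations by \<open>1 - t\<close> and minimising over the modulus leaves
  \<open>(1 + t)\<^sup>4 > 16 t\<^sup>2\<close>.\<close>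

lemma pillow_star_shaped:
  assumes j: "j\<^sup>2 = pillow x" and tj: "(t * j)\<^sup>2 = pillow (of_real t * x)" and t: "t > 0"
  shows "t = 1"
proof (rule ccontr)
  assume "t \<noteq> 1"
  define r C where "r = cmod x" and "C = Re (x ^ 3)"
  have r: "r \<ge> 0" and C: "C \<le> r ^ 3" using Re_le_cube[of x] by (auto simp: r_def C_def)
  have e1: "j\<^sup>2 = 27 - 18 * r\<^sup>2 + 8 * C - r ^ 4" using j by (simp add: pillow_def r_def C_def)
  have "Re ((of_real t * x) ^ 3) = t ^ 3 * C"
    unfolding power_mult_distrib C_def of_real_power[symmetric] by simp
  then have e2: "t\<^sup>2 * j\<^sup>2 = 27 - 18 * (t\<^sup>2 * r\<^sup>2) + 8 * (t ^ 3 * C) - t ^ 4 * r ^ 4"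
    using tj t by (simp add: pillow_def r_def norm_mult power_mult_distrib)
  have "(1 - t) * (27 * (1 + t) - 8 * C * t\<^sup>2 + r ^ 4 * t\<^sup>2 * (1 + t)) = 0"
  proof -
    have "(1 - t) * (27 * (1 + t) - 8 * C * t\<^sup>2 + r ^ 4 * t\<^sup>2 * (1 + t)) =
      (27 - 18 * (t\<^sup>2 * r\<^sup>2) + 8 * (t ^ 3 * C) - t ^ 4 * r ^ 4) - t\<^sup>2 * (27 - 18 * r\<^sup>2 + 8 * C - r ^ 4)"
      by (simp add: algebra_simps eval_nat_numeral)
    then show ?thesis using e1 e2 by simp
  qed
  then have "27 * (1 + t) - 8 * C * t\<^sup>2 + r ^ 4 * t\<^sup>2 * (1 + t) = 0" using \<open>t \<noteq> 1\<close> by simp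
  moreover have "8 * C * t\<^sup>2 \<le> 8 * r ^ 3 * t\<^sup>2" using C by (simp add: mult_right_mono)
  ultimately have le: "27 * (1 + t) + r ^ 4 * t\<^sup>2 * (1 + t) \<le> 8 * r ^ 3 * t\<^sup>2" by linarith
  define q s where "q = 1 + t" and "s = r * (1 + t)"
  have q: "q > 0" and s: "s \<ge> 0" using t r by (auto simp: q_def s_def)
  \<comment> \<open>The maximum of 8 s^3 - s^4 is taken at s = 6 and equals 432 = 27 * 16.\<close>
  have "0 \<le> (s - 6)\<^sup>2 * (s\<^sup>2 + 4 * s + 12)" using s by simp
  also have "\<dots> = s ^ 4 - 8 * s ^ 3 + 432" by (simp add: algebra_simps eval_nat_numeral)
  finally have s4: "8 * s ^ 3 - s ^ 4 \<le> 432" by simp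
  have "q ^ 3 * (27 * q + r ^ 4 * t\<^sup>2 * q) \<le> q ^ 3 * (8 * r ^ 3 * t\<^sup>2)"
    using le q by (simp add: q_def)
  then have "27 * q ^ 4 + s ^ 4 * t\<^sup>2 \<le> 8 * s ^ 3 * t\<^sup>2"
    by (simp add: q_def[symmetric] s_def power_mult_distrib algebra_simps eval_nat_numeral)
  then have "27 * q ^ 4 \<le> (8 * s ^ 3 - s ^ 4) * t\<^sup>2" by (simp add: algebra_simps)
  also have "\<dots> \<le> 432 * t\<^sup>2" using s4 by (simp add: mult_right_mono)
  finally have "(q\<^sup>2)\<^sup>2 \<le> (4 * t)\<^sup>2" by (simp add: power_mult_distrib)
  then have "q\<^sup>2 \<le> 4 * t" using t by (metis power2_le_imp_le mult_nonneg_nonneg less_imp_le zero_le_numeral)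
  then have "(1 - t)\<^sup>2 \<le> 0" by (simp add: q_def power2_eq_square algebra_simps)
  then show False using \<open>t \<noteq> 1\<close> by simp
qed

text \<open>Along the ray the difference of the two sides is 27 at t = 0 and negative far out, so it
  vanishes in between. The constants 6 and 9 make it negative: 27 - 36 on the axis, and at most 27 -
  18 * 81 + 8 * 729 - 6561 elsewhere.\<close>

lemma pillow_ray_exists:
  assumes "x \<noteq> 0 \<or> j \<noteq> 0"
  shows "\<exists>t>0. (t * j)\<^sup>2 = pillow (of_real t * x)"
proof -
  define g where "g t = 27 - 18 * (t\<^sup>2 * (cmod x)\<^sup>2) + 8 * (t ^ 3 * Re (x ^ 3)) - t ^ 4 * cmod x ^ 4 - t\<^sup>2 * j\<^sup>2" for t
  have g: "pillow (of_real t * x) - (t * j)\<^sup>2 = g t" for t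
  proof -
    have "Re ((of_real t * x) ^ 3) = t ^ 3 * Re (x ^ 3)"
      unfolding power_mult_distrib of_real_power[symmetric] by simp
    then show ?thesis by (simp add: pillow_def g_def norm_mult power_mult_distrib)
  qed
  have "\<exists>T>0. g T \<le> 0"
  proof (cases "x = 0")
    case True
    have "g (6 / \<bar>j\<bar>) \<le> 0" using assms True by (simp add: g_def power_divide)
    then show ?thesis using True assms by (intro exI[of _ "6 / \<bar>j\<bar>"]) auto
  next
    case False
    define r where "r = cmod x"
    have r: "r > 0" using False by (simp add: r_def)
    define T where "T = 9 / r"
    have "T ^ 3 * Re (x ^ 3) \<le> T ^ 3 * r ^ 3"
      using Re_le_cube[of x] r by (intro mult_left_mono) (auto simp: T_def r_def)
    moreover have "T ^ 3 * r ^ 3 = 729" "T ^ 4 * r ^ 4 = 6561" "T\<^sup>2 * r\<^sup>2 = 81" "T\<^sup>2 * j\<^sup>2 \<ge> 0"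
      using r by (auto simp: T_def power_divide)
    ultimately have "g T \<le> 0" unfolding g_def r_def[symmetric] by linarith
    then show ?thesis using r by (intro exI[of _ T]) (auto simp: T_def)
  qed
  then obtain T where T: "T > 0" "g T \<le> 0" by blast
  have "\<exists>t\<ge>0. t \<le> T \<and> g t = 0"
    by (rule IVT2) (use T in \<open>auto simp: g_def intro!: continuous_intros\<close>)
  then obtain t where t: "t \<ge> 0" "g t = 0" by blast
  have "t \<noteq> 0" using t by (auto simp: g_def)
  then show ?thesis using t g[of t] by (intro exI[of _ t]) auto
qed

text \<open>The cubic with coefficients \<open>x\<close> and \<open>cnj x\<close> is stable under w
  \<mapsto> 1 / cnj w. A root off the unit circle is therefore accompanied by its reflection, and
  then \<open>vdm\<close> is real and nonzero, so its square cannot be minus the square of a real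
  number.\<close>

lemma self_inversive_root_unit:
  fixes a b c x :: complex
  assumes "a + b + c = x" "a * b + b * c + c * a = cnj x" "a * b * c = 1" "(vdm a b c)\<^sup>2 = - of_real (j\<^sup>2)"
  shows "cmod a = 1"
proof (rule ccontr)
  assume na: "cmod a \<noteq> 1"
  have nz: "a \<noteq> 0" using assms by auto
  have contra: False if "a + b + c = x" "a * b + b * c + c * a = cnj x" "a * b * c = 1" "(vdm a b c)\<^sup>2 = - of_real (j\<^sup>2)"
    "b = 1 / cnj a" for b c
  proof -
    \<comment> \<open>In polar form a = r u and b = u / r, and the product 1 forces c = (cnj
      u)^2.\<close>
    define r u where "r = cmod a" and "u = a / of_real r"
    have r: "r > 0" "r \<noteq> 1" using nz na by (auto simp: r_def)
    have u: "cmod u = 1" "u \<noteq> 0" using r nz by (auto simp: u_def r_def norm_divide)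
    have au: "a = of_real r * u" using r by (simp add: u_def)
    have uu: "u * cnj u = 1" using u by (simp add: complex_norm_square[symmetric])
    have cu': "cnj u = 1 / u" using uu u by (simp add: field_simps)
    have bu: "b = u / of_real r" using that(5) u by (simp add: au cu')
    have cu: "c * u\<^sup>2 = 1" using that(3) au bu r by (simp add: power2_eq_square field_simps)
    have c: "c = (cnj u)\<^sup>2"
    proof -
      have "u\<^sup>2 * (cnj u)\<^sup>2 = 1" using uu by (simp add: power_mult_distrib[symmetric])
      then show ?thesis using cu u by (metis mult.commute mult_cancel_left power_not_zero)
    qed
    \<comment> \<open>With these, \<open>vdm a b c\<close> is the real number d (s - 2 Re (u^3)); it
      is nonzero because d \<noteq> 0 and s > 2.\<close>
    define d s where "d = r - 1 / r" and "s = r + 1 / r"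
    have "a - b = u * of_real d" using r by (simp add: au bu d_def field_simps)
    moreover have "(b - c) * (c - a) = c * (u * of_real s) - c\<^sup>2 - u\<^sup>2"
    proof -
      have "a + b = u * of_real s" "a * b = u\<^sup>2" using r by (simp_all add: au bu s_def field_simps power2_eq_square)
      moreover have "(b - c) * (c - a) = c * (a + b) - c\<^sup>2 - a * b" by (simp add: power2_eq_square algebra_simps)
      ultimately show ?thesis by simp
    qed
    ultimately have "vdm a b c = u * of_real d * (c * (u * of_real s) - c\<^sup>2 - u\<^sup>2)"
      by (simp add: vdm_def mult.assoc)
    also have "\<dots> = of_real d * (of_real s * (c * u\<^sup>2) - c\<^sup>2 * u - u ^ 3)"
      by (simp add: algebra_simps power2_eq_square power3_eq_cube)
    also have "c\<^sup>2 * u = (cnj u) ^ 3"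
    proof -
      have "c\<^sup>2 * u = (cnj u) ^ 3 * (u * cnj u)" by (simp add: c eval_nat_numeral)
      then show ?thesis by (simp add: uu)
    qed
    also have "of_real d * (of_real s * (c * u\<^sup>2) - cnj u ^ 3 - u ^ 3) = of_real (d * (s - 2 * Re (u ^ 3)))"
      using complex_add_cnj[of "u ^ 3"] by (simp add: cu algebra_simps)
    finally have V: "vdm a b c = of_real (d * (s - 2 * Re (u ^ 3)))" .
    have "d \<noteq> 0" using r by (auto simp: d_def field_simps power2_eq_square[symmetric] power2_eq_1_iff)
    moreover have "s > 2"
    proof -
      have "0 < (r - 1)\<^sup>2 / r" using r by simp
      also have "\<dots> = s - 2" using r by (simp add: s_def field_simps power2_eq_square)
      finally show ?thesis by simp
    qed
    moreover have "Re (u ^ 3) \<le> 1" using complex_Re_le_cmod[of "u ^ 3"] u by (simp add: norm_power)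
    ultimately have "(d * (s - 2 * Re (u ^ 3)))\<^sup>2 > 0" by auto
    moreover have "(d * (s - 2 * Re (u ^ 3)))\<^sup>2 = - (j\<^sup>2)"
      using that(4) unfolding V by (metis of_real_eq_iff of_real_minus of_real_power)
    ultimately show False by (metis neg_0_less_iff_less not_less zero_le_power2)
  qed
  have fact: "(w - a) * (w - b) * (w - c) = w ^ 3 - x * w\<^sup>2 + cnj x * w - 1" for w
  proof -
    have "(w - a) * (w - b) * (w - c) = w ^ 3 - (a + b + c) * w\<^sup>2 + (a * b + b * c + c * a) * w - a * b * c"
      by (simp add: eval_nat_numeral algebra_simps)
    then show ?thesis using assms by simp
  qed
  have root: "a ^ 3 - x * a\<^sup>2 + cnj x * a - 1 = 0" using fact[of a] by simp
  \<comment> \<open>The conjugated equation for \<open>a\<close>, multiplied by w^3, is up to sign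
    the original equation for \<open>w\<close>.\<close>
  define w where "w = 1 / cnj a"
  have "cnj (a ^ 3 - x * a\<^sup>2 + cnj x * a - 1) = 0" unfolding root by simp
  then have "cnj a ^ 3 - cnj x * (cnj a)\<^sup>2 + x * cnj a - 1 = 0" by simp
  then have "(cnj a ^ 3 - cnj x * (cnj a)\<^sup>2 + x * cnj a - 1) * w ^ 3 = 0" by simp
  moreover have wa: "w * cnj a = 1" using nz by (simp add: w_def)
  moreover have "(cnj a ^ 3 - cnj x * (cnj a)\<^sup>2 + x * cnj a - 1) * w ^ 3 =
    (w * cnj a) ^ 3 - cnj x * (w * cnj a)\<^sup>2 * w + x * (w * cnj a) * w\<^sup>2 - w ^ 3"
    by (simp add: eval_nat_numeral algebra_simps)
  ultimately have "w ^ 3 - x * w\<^sup>2 + cnj x * w - 1 = 0" by (simp add: algebra_simps)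
  then have "(w - a) * (w - b) * (w - c) = 0" unfolding fact .
  then have "w = a \<or> w = b \<or> w = c" by simp
  moreover have "w \<noteq> a"
  proof
    assume "w = a"
    then have "(cmod a)\<^sup>2 = 1" using wa complex_norm_square[of a] by (metis of_real_eq_1_iff)
    then show False using na norm_ge_zero[of a] by (auto simp: power2_eq_1_iff)
  qed
  ultimately consider "b = 1 / cnj a" | "c = 1 / cnj a" by (auto simp: w_def)
  then show False
  proof cases
    case 1 then show ?thesis using contra[of b c] assms by blast
  next
    case 2
    have "(vdm a c b)\<^sup>2 = (vdm a b c)\<^sup>2" by (simp add: vdm_def algebra_simps power2_eq_square)
    then show ?thesis using contra[of c b] assms 2 by (simp add: algebra_simps)
  qed
qed

text \<open>One root of the cubic, completed by the quadratic formula, gives a triple with the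
  required symmetric functions, and \<open>self_inversive_root_unit\<close> puts it on the unit
  circle. The imaginary part of its \<open>vdm\<close> is \<open>j\<close> up to sign, and
  exchanging \<open>b\<close> and \<open>c\<close> corrects the sign.\<close>

lemma pillow_point_triple:
  assumes "j\<^sup>2 = pillow x"
  shows "\<exists>a b c. cmod a = 1 \<and> cmod b = 1 \<and> cmod c = 1 \<and> a * b * c = 1 \<and> a + b + c = x \<and> Im (vdm a b c) = j"
proof -
  have "\<not> constant (poly [:- 1, cnj x, - x, 1:])"
    by (simp add: constant_degree)
  then obtain a where "poly [:- 1, cnj x, - x, 1:] a = 0" using fundamental_theorem_of_algebra by blast
  then have root: "a ^ 3 - x * a\<^sup>2 + cnj x * a - 1 = 0" by (simp add: eval_nat_numeral algebra_simps)
  then have nz: "a \<noteq> 0" by auto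
  define s q where "s = x - a" and "q = 1 / a"
  define b c where "b = (s + csqrt (s\<^sup>2 - 4 * q)) / 2" and "c = (s - csqrt (s\<^sup>2 - 4 * q)) / 2"
  have bc: "b + c = s" "b * c = q"
  proof -
    show "b + c = s" by (simp add: b_def c_def field_simps)
    have "(s + t) / 2 * ((s - t) / 2) = (s\<^sup>2 - t\<^sup>2) / 4" for t :: complex
      by (simp add: power2_eq_square field_simps)
    then show "b * c = q" unfolding b_def c_def by simp
  qed
  have e1: "a + b + c = x" using bc by (simp add: s_def add.assoc)
  have e3: "a * b * c = 1" using bc nz by (simp add: q_def mult.assoc)
  have "a * (a * b + b * c + c * a) = a * (a * (b + c)) + a * b * c" by (simp add: algebra_simps)
  also have "\<dots> = a * cnj x" unfolding bc(1) e3 s_def using root by (simp add: eval_nat_numeral algebra_simps)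
  finally have e2: "a * b + b * c + c * a = cnj x" using nz by simp
  have "(vdm a b c)\<^sup>2 = - of_real (pillow x)"
    unfolding vdm_square pillow_complex e1 e2 e3 by (simp add: power_mult_distrib algebra_simps)
  then have V2: "(vdm a b c)\<^sup>2 = - of_real (j\<^sup>2)" using assms by simp
  have V': "vdm b c a = vdm a b c" "vdm c a b = vdm a b c" by (simp_all add: vdm_def algebra_simps)
  have u: "cmod a = 1" "cmod b = 1" "cmod c = 1"
    using self_inversive_root_unit[OF e1 e2 e3 V2] self_inversive_root_unit[of b c a x j]
      self_inversive_root_unit[of c a b x j] e1 e2 e3 V2 V' by (simp_all add: algebra_simps)
  have "(Im (vdm a b c))\<^sup>2 = j\<^sup>2" using unit_triple_pillow(2)[OF u e3] e1 assms by simp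
  then consider "Im (vdm a b c) = j" | "Im (vdm a b c) = - j" by (auto simp: power2_eq_iff)
  then show ?thesis
  proof cases
    case 1 then show ?thesis using u e1 e3 by blast
  next
    case 2
    have "vdm a c b = - vdm a b c" by (simp add: vdm_def algebra_simps)
    then have "Im (vdm a c b) = j" using 2 by simp
    moreover have "a * c * b = 1" "a + c + b = x" using e1 e3 by (simp_all add: algebra_simps)
    ultimately show ?thesis using u by blast
  qed
qed

section \<open>Lattice coordinates, weights and the quotients by rotations of orders 3 and 6\<close>

definition cx :: "complex \<Rightarrow> real" where "cx z = Re z + Im z / sqrt 3"
definition cy :: "complex \<Rightarrow> real" where "cy z = 2 * Im z / sqrt 3"

lemma cx_cy: "z = of_real (cx z) + of_real (cy z) * \<omega>"
  by (simp add: cx_def cy_def omega_def complex_eq_iff)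

lemma cx_cy_unique: "cx (of_real x + of_real y * \<omega>) = x" "cy (of_real x + of_real y * \<omega>) = y"
  using cx_cy[of "of_real x + of_real y * \<omega>"] omega_coords_eq_iff by metis+

lemma eis_iff_coords: "z \<in> eis \<longleftrightarrow> cx z \<in> \<int> \<and> cy z \<in> \<int>"
proof
  assume "z \<in> eis"
  then obtain a b where "z = of_int a + of_int b * \<omega>" by (elim eisE)
  then have "cx z = of_int a" "cy z = of_int b"
    using cx_cy_unique[of "of_int a" "of_int b"] by simp_all
  then show "cx z \<in> \<int> \<and> cy z \<in> \<int>" by simp
next
  assume "cx z \<in> \<int> \<and> cy z \<in> \<int>"
  then obtain a b where "cx z = of_int a" "cy z = of_int b" by (meson Ints_cases)
  then have "z = of_int a + of_int b * \<omega>" using cx_cy[of z] by simp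
  then show "z \<in> eis" using eisI by simp
qed

lemma cx_minus: "cx (- z) = - cx z" and cy_minus: "cy (- z) = - cy z"
  by (simp_all add: cx_def cy_def field_simps)

lemma cx_diff: "cx (z - w) = cx z - cx w" and cy_diff: "cy (z - w) = cy z - cy w"
  by (simp_all add: cx_def cy_def field_simps)

lemma cx_omega: "cx (\<omega> * z) = - cy z" and cy_omega: "cy (\<omega> * z) = cx z - cy z"
proof -
  have "\<omega> * z = of_real (cx z) * \<omega> + of_real (cy z) * (\<omega> * \<omega>)"
    by (subst (1) cx_cy[of z]) (simp add: algebra_simps)
  also have "\<dots> = of_real (- cy z) + of_real (cx z - cy z) * \<omega>"
    by (simp add: omega_square algebra_simps)
  finally show "cx (\<omega> * z) = - cy z" "cy (\<omega> * z) = cx z - cy z" using cx_cy_unique by metis+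
qed

text \<open>The exponentials of the three weights of the root system \<open>A\<^sub>2\<close>, whose lattice of common
  periods is \<^const>\<open>eis\<close>.\<close>

definition ex0 :: "complex \<Rightarrow> complex" where "ex0 z = cis (2 * pi * cx z)"
definition ex1 :: "complex \<Rightarrow> complex" where "ex1 z = cis (- (2 * pi * cy z))"
definition ex2 :: "complex \<Rightarrow> complex" where "ex2 z = cis (2 * pi * (cy z - cx z))"

lemma ex_norm [simp]: "cmod (ex0 z) = 1" "cmod (ex1 z) = 1" "cmod (ex2 z) = 1"
  by (simp_all add: ex0_def ex1_def ex2_def)

lemma ex_prod: "ex0 z * ex1 z * ex2 z = 1"
  by (simp add: ex0_def ex1_def ex2_def cis_mult algebra_simps)

text \<open>Rotation by \<open>\<omega>\<close> permutes the three weights cyclically, which makes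
  both the symmetric functions and \<open>vdm\<close> invariant under it.\<close>

lemma ex_omega: "ex0 (\<omega> * z) = ex1 z" "ex1 (\<omega> * z) = ex2 z" "ex2 (\<omega> * z) = ex0 z"
  by (simp_all add: ex0_def ex1_def ex2_def cx_omega cy_omega algebra_simps)

lemma ex_minus: "ex0 (- z) = cnj (ex0 z)" "ex1 (- z) = cnj (ex1 z)" "ex2 (- z) = cnj (ex2 z)"
  by (simp_all add: ex0_def ex1_def ex2_def cx_minus cy_minus cis_cnj algebra_simps)

lemma cis_2pi_eq_iff: "cis (2 * pi * x) = cis (2 * pi * y) \<longleftrightarrow> x - y \<in> \<int>"
proof -
  have "cis (2 * pi * x) = cis (2 * pi * y) \<longleftrightarrow> cis (2 * pi * x) / cis (2 * pi * y) = 1" by simp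
  also have "\<dots> \<longleftrightarrow> cis (2 * pi * (x - y)) = 1" by (simp add: cis_divide algebra_simps)
  also have "\<dots> \<longleftrightarrow> (\<exists>n::int. 2 * pi * (x - y) = of_int n * (2 * pi))"
    unfolding cis_conv_exp exp_eq_1 by (auto simp: mult_ac)
  also have "\<dots> \<longleftrightarrow> (\<exists>n::int. x - y = of_int n)"
  proof -
    have "2 * pi * (x - y) = of_int n * (2 * pi) \<longleftrightarrow> x - y = of_int n" for n :: int
      using pi_gt_zero by (metis mult.commute mult_cancel_left pi_neq_zero mult_eq_0_iff zero_neq_numeral)
    then show ?thesis by simp
  qed
  finally show ?thesis by (auto elim: Ints_cases)
qed

lemma ex_eq_iff: "(ex0 z, ex1 z, ex2 z) = (ex0 w, ex1 w, ex2 w) \<longleftrightarrow> z - w \<in> eis"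
proof -
  have "ex0 z = ex0 w \<longleftrightarrow> cx z - cx w \<in> \<int>" by (simp add: ex0_def cis_2pi_eq_iff)
  moreover have "ex1 z = ex1 w \<longleftrightarrow> cy z - cy w \<in> \<int>"
  proof -
    have "ex1 z = ex1 w \<longleftrightarrow> - (cy z - cy w) \<in> \<int>"
      using cis_2pi_eq_iff[of "- cy z" "- cy w"] by (simp add: ex1_def)
    then show ?thesis by (simp only: minus_in_Ints_iff)
  qed
  moreover have "ex2 z = ex2 w \<longleftrightarrow> (cy z - cy w) - (cx z - cx w) \<in> \<int>"
    using cis_2pi_eq_iff[of "cy z - cx z" "cy w - cx w"] by (simp add: ex2_def algebra_simps)
  ultimately show ?thesis unfolding eis_iff_coords cx_diff cy_diff by auto
qed

abbreviation sph :: "(complex \<times> real) set" where "sph \<equiv> sphere 0 1"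

text \<open>The character of the standard representation of SU(3) on the diagonal torus. Its
  companion \<open>jay\<close> is the Weyl denominator up to a constant factor: it changes sign
  under the reflections of the Weyl group, so the pair separates the orbits of the rotation subgroup
  together with the translations.\<close>

definition chi :: "complex \<Rightarrow> complex" where "chi z = ex0 z + ex1 z + ex2 z"
definition jay :: "complex \<Rightarrow> real" where "jay z = Im (vdm (ex0 z) (ex1 z) (ex2 z))"

lemma jay_square: "(jay z)\<^sup>2 = pillow (chi z)"
  unfolding jay_def chi_def by (rule unit_triple_pillow) (auto simp: ex_prod)

lemma chi_jay_nonzero: "(chi z, jay z) \<noteq> 0"
  using jay_square[of z] by (auto simp: zero_prod_def pillow_def)

text \<open>\<open>chi\<close> and its conjugate are the first two symmetric functions of the three
  exponentials, whose product is 1, and \<open>jay\<close> fixes their cyclic order. Cyclic shifts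
  of the exponentials are rotations by powers of \<open>\<omega>\<close>.\<close>

lemma chi_jay_eq_iff:
  "chi z = chi w \<and> jay z = jay w \<longleftrightarrow> (\<exists>u b. u ^ 3 = 1 \<and> b \<in> eis \<and> w = u * z + b)"
proof
  assume *: "chi z = chi w \<and> jay z = jay w"
  note u = ex_norm(1)[of z] ex_norm(2)[of z] ex_norm(3)[of z] ex_prod[of z]
  note v = ex_norm(1)[of w] ex_norm(2)[of w] ex_norm(3)[of w] ex_prod[of w]
  have V: "vdm (ex0 z) (ex1 z) (ex2 z) = vdm (ex0 w) (ex1 w) (ex2 w)"
    using unit_triple_pillow(1)[OF u] unit_triple_pillow(1)[OF v] * unfolding jay_def by simp
  have "cnj (chi z) = cnj (chi w)" using * by simp
  then have "ex0 z * ex1 z + ex1 z * ex2 z + ex2 z * ex0 z = ex0 w * ex1 w + ex1 w * ex2 w + ex2 w * ex0 w"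
    unfolding chi_def using unit_triple_cnj[OF u] unit_triple_cnj[OF v] by (simp add: algebra_simps)
  note triple_same_coeffs[OF _ this u(4) v(4) V]
  then have "(ex0 w, ex1 w, ex2 w) = (ex0 z, ex1 z, ex2 z) \<or> (ex0 w, ex1 w, ex2 w) = (ex1 z, ex2 z, ex0 z)
     \<or> (ex0 w, ex1 w, ex2 w) = (ex2 z, ex0 z, ex1 z)" using * by (simp add: chi_def)
  then have "\<exists>u. u ^ 3 = 1 \<and> (ex0 w, ex1 w, ex2 w) = (ex0 (u * z), ex1 (u * z), ex2 (u * z))"
  proof (elim disjE)
    assume "(ex0 w, ex1 w, ex2 w) = (ex1 z, ex2 z, ex0 z)"
    then show ?thesis by (intro exI[of _ \<omega>]) (auto simp: ex_omega omega_cube)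
  next
    assume "(ex0 w, ex1 w, ex2 w) = (ex2 z, ex0 z, ex1 z)"
    moreover have "(\<omega> * \<omega>) ^ 3 = 1" by (simp add: power_mult_distrib omega_cube)
    ultimately show ?thesis by (intro exI[of _ "\<omega> * \<omega>"]) (auto simp: ex_omega mult.assoc)
  qed (auto intro!: exI[of _ 1])
  then show "\<exists>u b. u ^ 3 = 1 \<and> b \<in> eis \<and> w = u * z + b"
    unfolding ex_eq_iff by (metis add.commute diff_add_cancel)
next
  assume "\<exists>u b. u ^ 3 = 1 \<and> b \<in> eis \<and> w = u * z + b"
  then obtain u b where u: "u ^ 3 = 1" and b: "b \<in> eis" and w: "w = u * z + b" by blast
  have "(u - 1) * ((u - \<omega>) * (u - \<omega> * \<omega>)) = u ^ 3 - 1"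
  proof -
    have "(u - \<omega>) * (u - \<omega> * \<omega>) = u\<^sup>2 - u * (\<omega> + \<omega> * \<omega>) + \<omega> ^ 3" by (simp add: eval_nat_numeral algebra_simps)
    also have "\<dots> = u\<^sup>2 + u + 1" by (simp add: omega_square omega_cube)
    finally show ?thesis by (simp add: eval_nat_numeral algebra_simps)
  qed
  then consider "u = 1" | "u = \<omega>" | "u = \<omega> * \<omega>" using u by auto
  then have "(ex0 (u * z), ex1 (u * z), ex2 (u * z)) \<in> {(ex0 z, ex1 z, ex2 z), (ex1 z, ex2 z, ex0 z), (ex2 z, ex0 z, ex1 z)}"
    by cases (auto simp: ex_omega mult.assoc)
  moreover have "(ex0 w, ex1 w, ex2 w) = (ex0 (u * z), ex1 (u * z), ex2 (u * z))"
    unfolding ex_eq_iff using w b by simp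
  ultimately show "chi z = chi w \<and> jay z = jay w"
    by (auto simp: chi_def jay_def vdm_def algebra_simps)
qed

text \<open>Radial projection to the unit sphere of the surface j^2 = pillow x, which each ray from
  the origin meets exactly once.\<close>

definition p3 :: "complex \<Rightarrow> complex \<times> real" where "p3 z = sgn (chi z, jay z)"

lemma p3_eq_iff: "p3 z = p3 w \<longleftrightarrow> (\<exists>u b. u ^ 3 = 1 \<and> b \<in> eis \<and> w = u * z + b)"
proof -
  have "chi z = chi w \<and> jay z = jay w" if eq: "p3 z = p3 w"
  proof -
    define t where "t = norm (chi w, jay w) / norm (chi z, jay z)"
    have t: "t > 0" using chi_jay_nonzero[of z] chi_jay_nonzero[of w] unfolding t_def by (metis divide_pos_pos zero_less_norm_iff)
    have sgn: "norm v *\<^sub>R sgn v = v" for v :: "complex \<times> real"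
      by (cases "v = 0") (simp_all add: sgn_div_norm)
    have "(chi w, jay w) = norm (chi w, jay w) *\<^sub>R p3 z" unfolding eq unfolding p3_def sgn ..
    also have "\<dots> = t *\<^sub>R (norm (chi z, jay z) *\<^sub>R p3 z)"
      unfolding scaleR_scaleR t_def using chi_jay_nonzero[of z] by (metis nonzero_eq_divide_eq norm_eq_zero)
    also have "norm (chi z, jay z) *\<^sub>R p3 z = (chi z, jay z)" unfolding p3_def sgn ..
    finally have tw: "chi w = of_real t * chi z" "jay w = t * jay z" by (auto simp: scaleR_conv_of_real)
    have "t = 1" using pillow_star_shaped[OF jay_square[of z] _ t] jay_square[of w] tw by simp
    then show ?thesis using tw by simp
  qed
  then show ?thesis using chi_jay_eq_iff by (metis p3_def)
qed

lemma continuous_p3: "continuous_on UNIV p3"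
proof -
  have c: "continuous_on UNIV cx" "continuous_on UNIV cy"
    unfolding cx_def cy_def by (intro continuous_intros; simp)+
  have e: "continuous_on UNIV ex0" "continuous_on UNIV ex1" "continuous_on UNIV ex2"
    unfolding ex0_def ex1_def ex2_def cis_conv_exp by (intro continuous_intros c)+
  show ?thesis unfolding p3_def sgn_div_norm
    by (intro continuous_intros) (use chi_jay_nonzero in \<open>auto simp: chi_def jay_def vdm_def intro!: continuous_intros e\<close>)
qed

lemma range_p3: "range p3 = sph"
proof
  show "range p3 \<subseteq> sph" using chi_jay_nonzero by (auto simp: p3_def norm_sgn)
  show "sph \<subseteq> range p3"
  proof
    fix P assume P: "P \<in> sph"
    obtain x j where P': "P = (x, j)" by fastforce
    have nP: "norm P = 1" using P by simp
    then have "x \<noteq> 0 \<or> j \<noteq> 0" using P' by auto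
    then obtain t where t: "t > 0" "(t * j)\<^sup>2 = pillow (of_real t * x)" using pillow_ray_exists by blast
    obtain a b c where abc: "cmod a = 1" "cmod b = 1" "cmod c = 1" "a * b * c = 1" "a + b + c = of_real t * x" "Im (vdm a b c) = t * j"
      using pillow_point_triple[OF t(2)] by blast
    \<comment> \<open>Chosen so that \<open>ex0 z = a\<close> and \<open>ex1 z = b\<close>; the
      product 1 then gives \<open>ex2 z = c\<close>.\<close>
    define z where "z = of_real (Arg a / (2 * pi)) + of_real (- Arg b / (2 * pi)) * \<omega>"
    have Arg: "cis (Arg v) = v" if "cmod v = 1" for v
    proof -
      have "v \<noteq> 0" using that by auto
      then show ?thesis using that cis_Arg[of v] by (simp add: sgn_eq)
    qed
    have "2 * pi * cx z = Arg a" "- (2 * pi * cy z) = Arg b" unfolding z_def cx_cy_unique by simp_all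
    then have "ex0 z = a" "ex1 z = b" using abc by (simp_all add: ex0_def ex1_def Arg)
    moreover from this have "ex2 z = c" using ex_prod[of z] abc
      by (metis mult_cancel_left mult_eq_0_iff zero_neq_one)
    ultimately have "(chi z, jay z) = t *\<^sub>R P" using abc by (simp add: chi_def jay_def P' scaleR_conv_of_real)
    then have "p3 z = P" using t nP by (simp add: p3_def sgn_scaleR sgn_div_norm)
    then show "P \<in> range p3" by blast
  qed
qed

text \<open>The quotient of the sphere by the rotation \<open>(x, j) \<mapsto> (cnj x, - j)\<close>.\<close>

definition fold_half :: "complex \<times> real \<Rightarrow> complex \<times> real" where
  "fold_half P = (let w = Complex (Im (fst P)) (snd P); v = w * sgn w in (Complex (Re (fst P)) (Re v), Im v))"

text \<open>\<open>w * sgn w\<close> doubles the argument and keeps the modulus. It replaces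
  squaring so that \<open>fold_half\<close> maps the sphere to itself.\<close>

lemma mult_sgn_eq_iff: "w * sgn w = v * sgn v \<longleftrightarrow> w = v \<or> w = - v" for w v :: complex
proof
  assume eq: "w * sgn w = v * sgn v"
  have "cmod (w * sgn w) = cmod w" for w by (simp add: norm_mult norm_sgn)
  then have n: "cmod w = cmod v" using eq by metis
  have "w * sgn w * of_real (cmod w) = w\<^sup>2" for w
    by (simp add: sgn_eq power2_eq_square)
  then have "w\<^sup>2 = v\<^sup>2" using eq n by metis
  then show "w = v \<or> w = - v" by (simp add: power2_eq_iff)
qed (auto simp: sgn_minus)

lemma fold_half_eq_iff: "fold_half (x, j) = fold_half (y, k) \<longleftrightarrow> (y, k) = (x, j) \<or> (y, k) = (cnj x, - j)"
proof -
  have "fold_half (x, j) = fold_half (y, k) \<longleftrightarrow> Re x = Re y \<and>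
    Complex (Im x) j * sgn (Complex (Im x) j) = Complex (Im y) k * sgn (Complex (Im y) k)"
    by (auto simp: fold_half_def Let_def complex_eq_iff)
  also have "\<dots> \<longleftrightarrow> (y, k) = (x, j) \<or> (y, k) = (cnj x, - j)"
    unfolding mult_sgn_eq_iff by (auto simp: complex_eq_iff)
  finally show ?thesis .
qed

lemma norm_fold_half: "norm (fold_half P) = norm P"
proof -
  define w where "w = Complex (Im (fst P)) (snd P)"
  have "(norm (Complex x (Re v), Im v))\<^sup>2 = x\<^sup>2 + (cmod v)\<^sup>2" for x v
    by (simp add: norm_prod_def cmod_power2)
  then have "(norm (fold_half P))\<^sup>2 = (Re (fst P))\<^sup>2 + (cmod (w * sgn w))\<^sup>2"
    unfolding fold_half_def Let_def w_def[symmetric] .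
  also have "cmod (w * sgn w) = cmod w" by (simp add: norm_mult norm_sgn)
  also have "(Re (fst P))\<^sup>2 + (cmod w)\<^sup>2 = (norm P)\<^sup>2"
    by (simp add: w_def norm_prod_def cmod_power2)
  finally show ?thesis by (simp add: power2_eq_iff_nonneg)
qed

lemma continuous_mult_sgn: "continuous_on UNIV (\<lambda>w::complex. w * sgn w)"
proof -
  have "isCont (\<lambda>w::complex. w * sgn w) w" for w
  proof (cases "w = 0")
    case True
    have "((\<lambda>w::complex. w * sgn w) \<longlongrightarrow> 0) (at 0)"
      by (rule tendsto_norm_zero_cancel, rule tendsto_eq_rhs[OF tendsto_cong[THEN iffD1, OF _ tendsto_norm_zero[OF tendsto_ident_at]]])
         (auto simp: norm_mult norm_sgn)
    then show ?thesis using True by (simp add: isCont_def)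
  next
    case False
    then show ?thesis unfolding sgn_eq by (intro continuous_intros) auto
  qed
  then show ?thesis by (simp add: continuous_at_imp_continuous_on)
qed

lemma continuous_fold_half: "continuous_on UNIV fold_half"
proof -
  have 1: "continuous_on UNIV (\<lambda>P::complex \<times> real. Complex (Im (fst P)) (snd P))"
    unfolding complex_eq by (intro continuous_intros)
  have 2: "continuous_on UNIV (\<lambda>P::complex \<times> real. Complex (Im (fst P)) (snd P) * sgn (Complex (Im (fst P)) (snd P)))"
    using continuous_on_compose2[OF continuous_mult_sgn 1] by simp
  show ?thesis unfolding fold_half_def Let_def Complex_eq
    by (intro continuous_intros 2[unfolded Complex_eq])
qed

lemma fold_half_surj: "fold_half ` sph = sph"
proof
  show "fold_half ` sph \<subseteq> sph" using norm_fold_half by auto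
  show "sph \<subseteq> fold_half ` sph"
  proof
    fix P assume P: "P \<in> sph"
    define v where "v = Complex (Im (fst P)) (snd P)"
    define w where "w = csqrt (v * of_real (cmod v))"
    have w2: "w\<^sup>2 = v * of_real (cmod v)" by (simp add: w_def)
    have "(cmod w)\<^sup>2 = (cmod v)\<^sup>2" using arg_cong[OF w2, of cmod] by (simp add: norm_mult norm_power power2_eq_square)
    then have nw: "cmod w = cmod v" by (simp add: power2_eq_iff_nonneg)
    have wv: "w * sgn w = v"
      using w2 nw by (cases "v = 0") (auto simp: sgn_eq power2_eq_square)
    define Q where "Q = (Complex (Re (fst P)) (Re w), Im w)"
    have "fold_half Q = P"
    proof -
      have "Complex (Im (fst Q)) (snd Q) = w" by (simp add: Q_def complex_eq_iff)
      then have "fold_half Q = (Complex (Re (fst P)) (Re v), Im v)"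
        unfolding fold_half_def Let_def by (simp only: wv) (simp add: Q_def)
      then show ?thesis by (simp add: v_def prod_eq_iff complex_eq_iff)
    qed
    moreover from this have "Q \<in> sph" using norm_fold_half[of Q] P by simp
    ultimately show "P \<in> fold_half ` sph" by blast
  qed
qed

definition p6 :: "complex \<Rightarrow> complex \<times> real" where "p6 z = fold_half (p3 z)"

text \<open>Negation conjugates the three exponentials, hence also \<open>chi\<close>, and changes
  the sign of \<open>jay\<close>. On the sphere this is the rotation that \<open>fold_half\<close>
  divides out.\<close>

lemma p3_minus: "p3 (- z) = (cnj (fst (p3 z)), - snd (p3 z))"
proof -
  have "vdm (cnj a) (cnj b) (cnj c) = cnj (vdm a b c)" for a b c by (simp add: vdm_def)
  then have c: "chi (- z) = cnj (chi z)" "jay (- z) = - jay z"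
    by (simp_all add: chi_def jay_def ex_minus)
  then have "norm (chi (- z), jay (- z)) = norm (chi z, jay z)" by (simp add: norm_prod_def)
  then show ?thesis by (simp only: p3_def sgn_div_norm c) (simp add: scaleR_conv_of_real)
qed

text \<open>A sixth root of unity is a cube root of unity up to sign, so an orbit for the larger
  group is the union of the orbits of z and of - z for the smaller one.\<close>

lemma p6_eq_iff: "p6 z = p6 w \<longleftrightarrow> (\<exists>u b. u ^ 6 = 1 \<and> b \<in> eis \<and> w = u * z + b)"
proof -
  have "p6 z = p6 w \<longleftrightarrow> p3 w = p3 z \<or> p3 w = p3 (- z)"
    unfolding p6_def p3_minus using fold_half_eq_iff[of "fst (p3 z)" "snd (p3 z)" "fst (p3 w)" "snd (p3 w)"]
    by (auto simp: prod_eq_iff)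
  also have "\<dots> \<longleftrightarrow> (\<exists>u b. u ^ 3 = 1 \<and> b \<in> eis \<and> w = u * z + b) \<or> (\<exists>u b. u ^ 3 = 1 \<and> b \<in> eis \<and> w = u * (- z) + b)"
    using p3_eq_iff by metis
  also have "\<dots> \<longleftrightarrow> (\<exists>u b. u ^ 6 = 1 \<and> b \<in> eis \<and> w = u * z + b)"
  proof -
    have u6: "u ^ 6 = 1 \<longleftrightarrow> u ^ 3 = 1 \<or> (- u) ^ 3 = 1" for u :: complex
    proof -
      have "u ^ 6 = (u ^ 3)\<^sup>2" by simp
      then have "u ^ 6 = 1 \<longleftrightarrow> u ^ 3 = 1 \<or> u ^ 3 = - 1" by (metis power2_eq_1_iff)
      moreover have "(- u) ^ 3 = - (u ^ 3)" by (simp add: power3_eq_cube)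
      ultimately show ?thesis by (metis minus_minus)
    qed
    have minus: "u * (- z) = (- u) * z" for u by simp
    show ?thesis unfolding minus
    proof (intro iffI; (elim disjE exE conjE)?)
      fix u b assume "u ^ 3 = 1" "b \<in> eis" "w = u * z + b"
      then show "\<exists>u b. u ^ 6 = 1 \<and> b \<in> eis \<and> w = u * z + b" using u6 by blast
    next
      fix u b assume "u ^ 3 = 1" "b \<in> eis" "w = - u * z + b"
      moreover from this have "(- u) ^ 6 = 1" using u6[of "- u"] by simp
      ultimately show "\<exists>u b. u ^ 6 = 1 \<and> b \<in> eis \<and> w = u * z + b" by blast
    next
      fix u b assume *: "u ^ 6 = 1" "b \<in> eis" "w = u * z + b"
      then consider "u ^ 3 = 1" | "(- u) ^ 3 = 1" using u6 by blast
      then show "(\<exists>u b. u ^ 3 = 1 \<and> b \<in> eis \<and> w = u * z + b) \<or> (\<exists>u b. u ^ 3 = 1 \<and> b \<in> eis \<and> w = - u * z + b)"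
      proof cases
        case 2
        have "w = - (- u) * z + b" using * by simp
        then show ?thesis using 2 * by blast
      qed (use * in blast)
    qed
  qed
  finally show ?thesis .
qed

lemma continuous_p6: "continuous_on UNIV p6"
  unfolding p6_def using continuous_on_compose2[OF continuous_fold_half continuous_p3] by simp

lemma range_p6: "range p6 = sph"
  unfolding p6_def using range_p3 fold_half_surj by (metis image_image)

section \<open>Local form of the quotient maps\<close>

text \<open>Two continuous maps that are open onto their images and have the same fibres are
  quotient maps of \<open>D\<close> by one relation, so their images are canonically homeomorphic.
  With a power map as \<open>g\<close> this produces charts.\<close>

lemma common_quotient_homeomorphism:
  fixes p :: "'a::topological_space \<Rightarrow> 'b::topological_space" and g :: "'a \<Rightarrow> 'c::topological_space"
  assumes D: "open D" and p: "continuous_on D p" and g: "continuous_on D g"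
    and op: "\<And>O'. open O' \<Longrightarrow> O' \<subseteq> D \<Longrightarrow> openin (top_of_set S) (p ` O')"
    and og: "\<And>O'. open O' \<Longrightarrow> O' \<subseteq> D \<Longrightarrow> open (g ` O')"
    and eq: "\<And>z w. z \<in> D \<Longrightarrow> w \<in> D \<Longrightarrow> p z = p w \<longleftrightarrow> g z = g w"
  shows "\<exists>\<phi>. homeomorphic_map (subtopology (top_of_set S) (p ` D)) (top_of_set (g ` D)) \<phi> \<and> (\<forall>z\<in>D. \<phi> (p z) = g z)"
proof -
  define \<phi> where "\<phi> y = g (SOME z. z \<in> D \<and> p z = y)" for y
  define \<psi> where "\<psi> x = p (SOME z. z \<in> D \<and> g z = x)" for x
  have \<phi>: "\<phi> (p z) = g z" if "z \<in> D" for z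
  proof -
    have "(SOME w. w \<in> D \<and> p w = p z) \<in> D \<and> p (SOME w. w \<in> D \<and> p w = p z) = p z"
      by (rule someI) (use that in auto)
    then show ?thesis unfolding \<phi>_def using eq that by blast
  qed
  have \<psi>: "\<psi> (g z) = p z" if "z \<in> D" for z
  proof -
    have "(SOME w. w \<in> D \<and> g w = g z) \<in> D \<and> g (SOME w. w \<in> D \<and> g w = g z) = g z"
      by (rule someI) (use that in auto)
    then show ?thesis unfolding \<psi>_def using eq that by blast
  qed
  have pDS: "p ` D \<subseteq> S" using op[OF D order_refl] openin_imp_subset by blast
  have "homeomorphic_maps (subtopology (top_of_set S) (p ` D)) (top_of_set (g ` D)) \<phi> \<psi>"
    unfolding homeomorphic_maps_def
  proof (intro conjI)
    have top: "subtopology (top_of_set S) (p ` D) = top_of_set (p ` D)"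
      using pDS by (simp add: subtopology_subtopology Int_absorb1)
    show "continuous_map (subtopology (top_of_set S) (p ` D)) (top_of_set (g ` D)) \<phi>"
    proof (rule continuous_map_into_subtopology, subst continuous_map_def, intro conjI allI impI)
      fix V :: "'c set" assume "openin euclidean V"
      then have V: "open V" by (simp only: open_openin)
      have eq': "{y \<in> topspace (subtopology (top_of_set S) (p ` D)). \<phi> y \<in> V} = p ` (D \<inter> g -` V)"
        using pDS \<phi> by (auto simp: top)
      have "open (D \<inter> g -` V)" using continuous_open_preimage[OF g D V] .
      then have "openin (top_of_set S) (p ` (D \<inter> g -` V))" using op by blast
      then show "openin (subtopology (top_of_set S) (p ` D)) {y \<in> topspace (subtopology (top_of_set S) (p ` D)). \<phi> y \<in> V}"
        unfolding eq' openin_subtopology[of "top_of_set S"] by (intro exI[of _ "p ` (D \<inter> g -` V)"]) auto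
    qed (use \<phi> in auto)
    show "continuous_map (top_of_set (g ` D)) (subtopology (top_of_set S) (p ` D)) \<psi>"
      unfolding top
    proof (rule continuous_map_into_subtopology, subst continuous_map_def, intro conjI allI impI)
      fix V :: "'b set" assume "openin euclidean V"
      then have V: "open V" by (simp only: open_openin)
      have eq': "{x \<in> topspace (top_of_set (g ` D)). \<psi> x \<in> V} = g ` (D \<inter> p -` V)"
        using \<psi> by auto
      have "open (D \<inter> p -` V)" using continuous_open_preimage[OF p D V] .
      then have "open (g ` (D \<inter> p -` V))" using og by blast
      then show "openin (top_of_set (g ` D)) {x \<in> topspace (top_of_set (g ` D)). \<psi> x \<in> V}"
        unfolding eq' by (simp add: open_subset image_mono)
    qed (use \<psi> in auto)
  qed (use \<phi> \<psi> in auto)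
  then show ?thesis using \<phi> homeomorphic_maps_map by blast
qed

lemma root_unity_6: "u ^ 6 = 1 \<longleftrightarrow> u \<in> {1, - 1, \<omega>, - 1 - \<omega>, - \<omega>, 1 + \<omega>}" for u :: complex
proof -
  have 1: "(u - \<omega>) * (u + 1 + \<omega>) = u\<^sup>2 + u + 1"
  proof -
    have "(u - \<omega>) * (u + 1 + \<omega>) = u\<^sup>2 + u - \<omega> - \<omega> * \<omega>" by (simp add: eval_nat_numeral algebra_simps)
    then show ?thesis by (simp add: omega_square)
  qed
  have 2: "(u + \<omega>) * (u - 1 - \<omega>) = u\<^sup>2 - u + 1"
  proof -
    have "(u + \<omega>) * (u - 1 - \<omega>) = u\<^sup>2 - u - \<omega> - \<omega> * \<omega>" by (simp add: eval_nat_numeral algebra_simps)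
    then show ?thesis by (simp add: omega_square)
  qed
  have "(u - 1) * (u + 1) * ((u - \<omega>) * (u + 1 + \<omega>)) * ((u + \<omega>) * (u - 1 - \<omega>)) = u ^ 6 - 1"
    unfolding 1 2 by (simp add: eval_nat_numeral algebra_simps)
  then have "u ^ 6 = 1 \<longleftrightarrow> (u - 1) * (u + 1) * ((u - \<omega>) * (u + 1 + \<omega>)) * ((u + \<omega>) * (u - 1 - \<omega>)) = 0" by simp
  moreover have "u - 1 = 0 \<longleftrightarrow> u = 1" "u + 1 = 0 \<longleftrightarrow> u = - 1" "u - \<omega> = 0 \<longleftrightarrow> u = \<omega>" "u + 1 + \<omega> = 0 \<longleftrightarrow> u = - 1 - \<omega>"
    "u + \<omega> = 0 \<longleftrightarrow> u = - \<omega>" "u - 1 - \<omega> = 0 \<longleftrightarrow> u = 1 + \<omega>"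
    by (auto simp: complex_eq_iff)
  ultimately show ?thesis by (simp only: mult_eq_0_iff insert_iff empty_iff) blast
qed

lemma root_unity_6_eis: "u ^ 6 = 1 \<Longrightarrow> u \<in> eis"
  unfolding root_unity_6 by (auto intro!: eis_diff eis_add)

lemma unit_mult_eis_iff:
  assumes "v ^ 6 = 1" shows "v * z \<in> eis \<longleftrightarrow> z \<in> eis"
proof
  assume "v * z \<in> eis"
  then have "v ^ 5 * (v * z) \<in> eis" using root_unity_6_eis[OF assms] by blast
  also have "v ^ 5 * (v * z) = v ^ 6 * z" by (simp add: eval_nat_numeral)
  finally show "z \<in> eis" using assms by simp
qed (use root_unity_6_eis[OF assms] in blast)

text \<open>At most one lattice point lies within 1/2 of \<open>x\<close>, up to ties that do not
  matter: if it differs from \<open>x\<close>, its distance from \<open>x\<close> serves as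
  \<delta>.\<close>

lemma eis_separated: "\<exists>\<delta>>0. \<forall>b\<in>eis. cmod (b - x) < \<delta> \<longrightarrow> b = x"
proof (cases "\<exists>b\<in>eis. b \<noteq> x \<and> cmod (b - x) < 1/2")
  case True
  then obtain b where b: "b \<in> eis" "b \<noteq> x" "cmod (b - x) < 1/2" by blast
  have "b' = x" if "b' \<in> eis" "cmod (b' - x) < cmod (b - x)" for b'
  proof -
    have "cmod (b' - b) < 1" using norm_triangle_ineq4[of "b' - x" "b - x"] that b by simp
    then have "b' - b = 0" using eis_discrete that b by blast
    then show ?thesis using that by simp
  qed
  then show ?thesis using b by (intro exI[of _ "cmod (b - x)"]) auto
qed (auto intro!: exI[of _ "1/2"])

lemma open_power_shift:
  assumes "m > 0" "open O'" shows "open ((\<lambda>z::complex. (z - z0) ^ m) ` O')"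
proof (rule open_mapping_thm[of _ UNIV])
  show "(\<lambda>z. (z - z0) ^ m) holomorphic_on UNIV" by (intro holomorphic_intros)
  show "\<not> (\<lambda>z. (z - z0) ^ m) constant_on UNIV"
  proof
    assume "(\<lambda>z. (z - z0) ^ m) constant_on UNIV"
    then obtain c where c: "\<And>z. (z - z0) ^ m = c" by (auto simp: constant_on_def)
    show False using c[of z0] c[of "z0 + 1"] assms(1) by (simp add: power_0_left)
  qed
qed (use assms in auto)

text \<open>What \<open>p3\<close> and \<open>p6\<close> have in common: a map of the plane onto the
  sphere whose fibres are the orbits of the maps z \<mapsto> u z + b with u^n = 1.
  \<open>ord z\<close> is the order of the stabiliser of z; since u z + b = z means b = (1 - u) z,
  the assumption \<open>stab\<close> says which u occur.\<close>

locale eis_cover =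
  fixes n :: nat and p :: "complex \<Rightarrow> complex \<times> real" and ord :: "complex \<Rightarrow> nat"
  assumes n: "n > 0" "n dvd 6"
    and cont: "continuous_on UNIV p" and range: "range p = sph"
    and p_eq_iff: "\<And>z w. p z = p w \<longleftrightarrow> (\<exists>u b. u ^ n = 1 \<and> b \<in> eis \<and> w = u * z + b)"
    and ord_pos: "\<And>z. ord z > 0" and ord_dvd: "\<And>z. ord z dvd n"
    and stab: "\<And>u z. u ^ n = 1 \<Longrightarrow> (1 - u) * z \<in> eis \<longleftrightarrow> u ^ ord z = 1"
begin

lemma unit6: "u ^ n = 1 \<Longrightarrow> u ^ 6 = 1" for u :: complex
  proof -
  assume u: "u ^ n = 1"
  obtain k where "6 = n * k" using n(2) by (elim dvdE)
  then have "u ^ 6 = (u ^ n) ^ k" by (simp only: power_mult)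
  then show "u ^ 6 = 1" using u by simp
qed

lemma unit_norm: "u ^ n = 1 \<Longrightarrow> cmod u = 1"
  by (metis n(1) norm_one norm_power power_eq_1_iff not_gr_zero norm_ge_zero)

lemma unit_ord: "u ^ ord z = 1 \<Longrightarrow> u ^ n = 1" for u :: complex
  proof -
  assume u: "u ^ ord z = 1"
  obtain k where "n = ord z * k" using ord_dvd[of z] by (elim dvdE)
  then have "u ^ n = (u ^ ord z) ^ k" by (simp only: power_mult)
  then show "u ^ n = 1" using u by simp
qed

lemma p_in_sph: "p z \<in> sph" using range by auto

text \<open>The union \<open>V\<close> of the orbits that meet \<open>O'\<close> is open, and the
  closed unit disc meets every orbit. Hence the complement of the image is the image of a compact
  set, and so closed.\<close>

lemma open_map: assumes "open O'" shows "openin (top_of_set sph) (p ` O')"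
proof -
  define V where "V = (\<Union>u\<in>{u. u ^ n = 1}. \<Union>b\<in>eis. (\<lambda>w. (w - b) / u) -` O')"
  have V: "w \<in> V \<longleftrightarrow> p w \<in> p ` O'" for w
  proof -
    have u0: "u \<noteq> 0" if "u ^ n = 1" for u :: complex using that n(1) by (metis power_0_left not_gr_zero zero_neq_one)
    have "w \<in> V \<longleftrightarrow> (\<exists>u b. u ^ n = 1 \<and> b \<in> eis \<and> (w - b) / u \<in> O')" by (auto simp: V_def)
    also have "\<dots> \<longleftrightarrow> (\<exists>z\<in>O'. \<exists>u b. u ^ n = 1 \<and> b \<in> eis \<and> w = u * z + b)"
    proof (safe)
      fix u b assume "u ^ n = 1" "b \<in> eis" "(w - b) / u \<in> O'"
      then show "\<exists>z\<in>O'. \<exists>u b. u ^ n = 1 \<and> b \<in> eis \<and> w = u * z + b" using u0[of u]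
        by (intro bexI[of _ "(w - b) / u"] exI[of _ u] exI[of _ b]) auto
    next
      fix z u b assume "z \<in> O'" "u ^ n = 1" "b \<in> eis" "w = u * z + b"
      then show "\<exists>u' b'. u' ^ n = 1 \<and> b' \<in> eis \<and> (u * z + b - b') / u' \<in> O'" using u0[of u]
        by (intro exI[of _ u] exI[of _ b]) auto
    qed
    also have "\<dots> \<longleftrightarrow> p w \<in> p ` O'" proof -
      have "p w \<in> p ` O' \<longleftrightarrow> (\<exists>z\<in>O'. p z = p w)" by (metis imageE imageI)
      then show ?thesis by (simp only: p_eq_iff)
    qed
    finally show ?thesis .
  qed
  have "open ((\<lambda>w. (w - b) / u) -` O')" if "u ^ n = 1" for u b
  proof -
    have "u \<noteq> 0" using that n(1) by (auto simp: power_0_left)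
    then show ?thesis by (intro open_vimage assms continuous_intros) auto
  qed
  then have "open V" unfolding V_def by blast
  then have "compact (p ` (cball 0 1 - V))"
    by (intro compact_continuous_image continuous_on_subset[OF cont] compact_diff) auto
  moreover have "sph - p ` O' = p ` (cball 0 1 - V)"
  proof
    show "p ` (cball 0 1 - V) \<subseteq> sph - p ` O'"
    proof
      fix y assume "y \<in> p ` (cball 0 1 - V)"
      then obtain z where "y = p z" "z \<notin> V" by blast
      then show "y \<in> sph - p ` O'" using V[of z] p_in_sph[of z] by simp
    qed
    show "sph - p ` O' \<subseteq> p ` (cball 0 1 - V)"
    proof
      fix y assume y: "y \<in> sph - p ` O'"
      then obtain z where z: "y = p z" using range by blast
      obtain q where q: "q \<in> eis" "cmod (z - q) < 1" using eis_approx by blast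
      have "p (z - q) = p z" unfolding p_eq_iff by (rule exI[of _ 1], rule exI[of _ q]) (use q in simp)
      then show "y \<in> p ` (cball 0 1 - V)" using q z y V[of "z - q"] by (intro image_eqI[of _ _ "z - q"]) auto
    qed
  qed
  ultimately have "closedin (top_of_set sph) (sph - p ` O')" by (auto intro!: closed_subset compact_imp_closed)
  then have "openin (top_of_set sph) (sph - (sph - p ` O'))" by (intro openin_diff) auto
  moreover have "sph - (sph - p ` O') = p ` O'" using p_in_sph by auto
  ultimately show ?thesis by metis
qed

lemma local_form:
  obtains r where "r > 0" "\<And>z w. z \<in> ball z0 r \<Longrightarrow> w \<in> ball z0 r \<Longrightarrow>
    p z = p w \<longleftrightarrow> (z - z0) ^ ord z0 = (w - z0) ^ ord z0"
proof -
  define R where "R = {u::complex. u ^ n = 1}"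
  have fin: "finite R" unfolding R_def using finite_roots_unity n(1) by (metis One_nat_def Suc_leI)
  \<comment> \<open>Only finitely many \<open>u\<close> occur. For each, \<open>\<delta> u\<close>
    keeps all other lattice points away from (1 - u) z0, so that points of one orbit close to
    \<open>z0\<close> are related by a map that fixes \<open>z0\<close>.\<close>
  have "\<forall>u\<in>R. \<exists>\<delta>>0. \<forall>b\<in>eis. cmod (b - (1 - u) * z0) < \<delta> \<longrightarrow> b = (1 - u) * z0"
    using eis_separated by blast
  then obtain \<delta> where \<delta>: "\<And>u. u \<in> R \<Longrightarrow> \<delta> u > 0"
    "\<And>u b. u \<in> R \<Longrightarrow> b \<in> eis \<Longrightarrow> cmod (b - (1 - u) * z0) < \<delta> u \<Longrightarrow> b = (1 - u) * z0"
    by metis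
  define d where "d = Min (\<delta> ` R)"
  have "1 \<in> R" by (simp add: R_def)
  then have "\<delta> ` R \<noteq> {}" by blast
  then have d: "d > 0" "\<And>u. u \<in> R \<Longrightarrow> d \<le> \<delta> u" using fin \<delta>(1) unfolding d_def by (simp_all add: Min_gr_iff)
  show thesis
  proof (rule that[of "d / 2"])
    show "d / 2 > 0" using d by simp
    fix z w assume z: "z \<in> ball z0 (d / 2)" and w: "w \<in> ball z0 (d / 2)"
    show "p z = p w \<longleftrightarrow> (z - z0) ^ ord z0 = (w - z0) ^ ord z0"
    proof
      assume "p z = p w"
      then obtain u b where u: "u ^ n = 1" and b: "b \<in> eis" and wz: "w = u * z + b" using p_eq_iff by blast
      have "b - (1 - u) * z0 = (w - z0) - u * (z - z0)" by (simp add: wz algebra_simps)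
      moreover have "cmod ((w - z0) - u * (z - z0)) < d"
        using norm_triangle_ineq4[of "w - z0" "u * (z - z0)"] z w unit_norm[OF u]
        by (simp add: norm_mult dist_norm norm_minus_commute)
      ultimately have "cmod (b - (1 - u) * z0) < \<delta> u" using d(2)[of u] u by (simp add: R_def)
      then have beq: "b = (1 - u) * z0" using \<delta>(2) u b by (simp add: R_def)
      then have "u ^ ord z0 = 1" using stab[OF u] b by simp
      moreover have "w - z0 = u * (z - z0)" by (simp add: wz beq algebra_simps)
      ultimately show "(z - z0) ^ ord z0 = (w - z0) ^ ord z0" by (simp add: power_mult_distrib)
    next
      assume eq: "(z - z0) ^ ord z0 = (w - z0) ^ ord z0"
      show "p z = p w"
      proof (cases "z = z0")
        case True
        then show ?thesis using eq ord_pos[of z0] by (simp add: power_0_left split: if_splits)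
      next
        case False
        define u where "u = (w - z0) / (z - z0)"
        have u1: "u ^ ord z0 = 1" using eq[symmetric] False by (simp add: u_def power_divide)
        then have u: "u ^ n = 1" by (rule unit_ord)
        have "(1 - u) * z0 \<in> eis" using stab[OF u] u1 by simp
        moreover have "w = u * z + (1 - u) * z0"
        proof -
          have "u * (z - z0) = w - z0" using False by (simp add: u_def)
          then show ?thesis by (simp add: algebra_simps)
        qed
        ultimately show ?thesis using u p_eq_iff by blast
      qed
    qed
  qed
qed

lemma chart:
  obtains r where "r > 0" "\<And>\<rho>. 0 < \<rho> \<Longrightarrow> \<rho> \<le> r \<Longrightarrow>
    \<exists>\<phi>. homeomorphic_map (subtopology (top_of_set sph) (p ` ball z0 \<rho>))
      (top_of_set ((\<lambda>z. (z - z0) ^ ord z0) ` ball z0 \<rho>)) \<phi> \<and> (\<forall>z\<in>ball z0 \<rho>. \<phi> (p z) = (z - z0) ^ ord z0)"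
proof -
  obtain r where r: "r > 0" "\<And>z w. z \<in> ball z0 r \<Longrightarrow> w \<in> ball z0 r \<Longrightarrow>
    p z = p w \<longleftrightarrow> (z - z0) ^ ord z0 = (w - z0) ^ ord z0" using local_form by blast
  show thesis
  proof (rule that[OF r(1)])
    fix \<rho> assume "0 < \<rho>" "\<rho> \<le> r"
    then show "\<exists>\<phi>. homeomorphic_map (subtopology (top_of_set sph) (p ` ball z0 \<rho>))
      (top_of_set ((\<lambda>z. (z - z0) ^ ord z0) ` ball z0 \<rho>)) \<phi> \<and> (\<forall>z\<in>ball z0 \<rho>. \<phi> (p z) = (z - z0) ^ ord z0)"
      by (intro common_quotient_homeomorphism open_ball continuous_on_subset[OF cont] continuous_intros open_map open_power_shift ord_pos r(2)) auto
  qed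
qed

end

section \<open>Stabilisers in the two groups\<close>

definition ord3 :: "complex \<Rightarrow> nat" where "ord3 z = (if \<theta> * z \<in> eis then 3 else 1)"

text \<open>The conditions come from 1 - u for a primitive root of unity u: a unit for order 6,
  \<open>\<theta>\<close> up to a unit for order 3, and 2 for order 2. The largest order is tested
  first.\<close>

definition ord6 :: "complex \<Rightarrow> nat" where
  "ord6 z = (if z \<in> eis then 6 else if \<theta> * z \<in> eis then 3 else if 2 * z \<in> eis then 2 else 1)"

lemma omega_unit: "\<omega> ^ 6 = 1" "(1 + \<omega>) ^ 6 = 1" "(- 1 - \<omega>) ^ 6 = 1"
  unfolding root_unity_6 by auto

lemma theta_eis: "z \<in> eis \<Longrightarrow> \<theta> * z \<in> eis" by auto

text \<open>\<open>\<theta>\<close> and 2 are coprime, as (2 + \<omega>) \<theta> - 2 = 1. So a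
  point fixed by rotations of orders 2 and 3 is fixed by one of order 6.\<close>

lemma theta_two_eis: "\<theta> * z \<in> eis \<Longrightarrow> 2 * z \<in> eis \<Longrightarrow> z \<in> eis"
proof -
  assume *: "\<theta> * z \<in> eis" "2 * z \<in> eis"
  have "2 + \<omega> \<in> eis" by (intro eis_add) auto
  from eis_diff[OF eis_mult[OF this *(1)] *(2)] have "(2 + \<omega>) * (\<theta> * z) - 2 * z \<in> eis" .
  moreover have "(2 + \<omega>) * (\<theta> * z) - 2 * z = (\<theta> * (2 + \<omega>) - 2) * z" by (simp add: algebra_simps)
  ultimately show "z \<in> eis" unfolding theta_mult_cnj by simp
qed

lemma stab_cases:
  shows "(1 - - 1) * z \<in> eis \<longleftrightarrow> 2 * z \<in> eis" "(1 - (- 1 - \<omega>)) * z \<in> eis \<longleftrightarrow> \<theta> * z \<in> eis"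
    "(1 - - \<omega>) * z \<in> eis \<longleftrightarrow> z \<in> eis" "(1 - (1 + \<omega>)) * z \<in> eis \<longleftrightarrow> z \<in> eis"
proof -
  have "(1 - (- 1 - \<omega>)) * z = (1 + \<omega>) * (\<theta> * z)"
    by (simp add: algebra_simps omega_square mult.assoc[symmetric])
  then show "(1 - (- 1 - \<omega>)) * z \<in> eis \<longleftrightarrow> \<theta> * z \<in> eis" using unit_mult_eis_iff[OF omega_unit(2)] by metis
  show "(1 - - \<omega>) * z \<in> eis \<longleftrightarrow> z \<in> eis" "(1 - (1 + \<omega>)) * z \<in> eis \<longleftrightarrow> z \<in> eis"
    using unit_mult_eis_iff[OF omega_unit(2)] unit_mult_eis_iff[OF omega_unit(1)] by simp_all
qed simp

lemma unit_powers:
  "\<omega> ^ 2 \<noteq> 1" "\<omega> ^ 3 = 1" "(- \<omega>) ^ 2 \<noteq> 1" "(- \<omega>) ^ 3 = - 1" "(1 + \<omega>) ^ 2 \<noteq> 1" "(1 + \<omega>) ^ 3 = - 1" "(- 1 - \<omega>) ^ 2 \<noteq> 1" "(- 1 - \<omega>) ^ 3 = 1"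
  "- 1 - \<omega> \<noteq> 1" "- \<omega> \<noteq> 1" "1 + \<omega> \<noteq> 1" "\<omega> ^ 6 = 1" "(- \<omega>) ^ 6 = 1" "(1 + \<omega>) ^ 6 = 1" "(- 1 - \<omega>) ^ 6 = 1"
proof -
  have s: "(1 + \<omega>) ^ 2 = \<omega>" "(- 1 - \<omega>) ^ 2 = \<omega>" by (simp_all add: power2_eq_square algebra_simps omega_square)
  show "(1 + \<omega>) ^ 2 \<noteq> 1" "(- 1 - \<omega>) ^ 2 \<noteq> 1" unfolding s by auto
  have "(1 + \<omega>) ^ 3 = (1 + \<omega>) ^ 2 * (1 + \<omega>)" "(- 1 - \<omega>) ^ 3 = (- 1 - \<omega>) ^ 2 * (- 1 - \<omega>)" by (simp_all add: power3_eq_cube power2_eq_square)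
  then show "(1 + \<omega>) ^ 3 = - 1" "(- 1 - \<omega>) ^ 3 = 1" unfolding s by (simp_all add: algebra_simps omega_square)
  show "(- \<omega>) ^ 3 = - 1" using omega_cube by simp
  show "\<omega> ^ 2 \<noteq> 1" "(- \<omega>) ^ 2 \<noteq> 1" by (auto simp: omega_power2) (auto simp: complex_eq_iff omega_def)
  show "- 1 - \<omega> \<noteq> 1" "- \<omega> \<noteq> 1" "1 + \<omega> \<noteq> 1" by (auto simp: complex_eq_iff omega_def)
  show "\<omega> ^ 6 = 1" "(1 + \<omega>) ^ 6 = 1" "(- 1 - \<omega>) ^ 6 = 1" by (rule omega_unit)+
  then show "(- \<omega>) ^ 6 = 1" by simp
qed (rule omega_cube)

lemma ord6_stab: "u ^ 6 = 1 \<Longrightarrow> (1 - u) * z \<in> eis \<longleftrightarrow> u ^ ord6 z = 1"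
  unfolding root_unity_6 insert_iff empty_iff
  using theta_eis[of z] theta_two_eis[of z] eis_mult[of 2 z]
  by (elim disjE) (simp_all only: stab_cases, auto simp: ord6_def unit_powers simp del: minus_diff_eq)

lemma ord3_stab: "u ^ 3 = 1 \<Longrightarrow> (1 - u) * z \<in> eis \<longleftrightarrow> u ^ ord3 z = 1"
proof -
  assume u3: "u ^ 3 = 1"
  then have "u ^ 6 = 1" by (metis power_mult power_one mult_2_right numeral_Bit0 numeral_times_numeral semiring_norm(13) mult.commute power2_eq_square power_even_eq)
  then have "u = 1 \<or> u = \<omega> \<or> u = - 1 - \<omega>" using u3 unfolding root_unity_6 insert_iff empty_iff by (elim disjE) (auto simp: unit_powers)
  then show ?thesis by (elim disjE) (simp_all only: stab_cases, auto simp: ord3_def unit_powers)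
qed

interpretation c3: eis_cover 3 p3 ord3
  by unfold_locales (use continuous_p3 range_p3 p3_eq_iff ord3_stab in \<open>auto simp: ord3_def\<close>)

interpretation c6: eis_cover 6 p6 ord6
  by unfold_locales (use continuous_p6 range_p6 p6_eq_iff ord6_stab in \<open>auto simp: ord6_def\<close>)

section \<open>Local degrees\<close>

lemma openin_homeomorphic_image:
  assumes "homeomorphic_map (subtopology X U) (top_of_set A) \<phi>" "open (A :: complex set)" "openin X U" "openin X W" "W \<subseteq> U"
  shows "open (\<phi> ` W)"
proof -
  have "openin (subtopology X U) W" using assms by (metis openin_subset_topspace_eq openin_open_subtopology)
  then have "openin (top_of_set A) (\<phi> ` W)" using assms(1) homeomorphic_imp_open_map open_map_def by blast
  then show ?thesis using assms(2) openin_open_eq by blast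
qed

text \<open>In the charts \<open>f\<close> is a k-th power, and a small nonzero number has exactly k
  roots, all of them small. The set \<open>W\<close> serves to compare two charts at the same
  point.\<close>

lemma local_chart_fibres:
  assumes U: "openin X U" "x \<in> U" and V: "openin Y V" and UV: "f ` U \<subseteq> V" and A: "open (A :: complex set)" and B: "open (B :: complex set)"
    and \<phi>: "homeomorphic_map (subtopology X U) (top_of_set A) \<phi>" "\<phi> x = 0"
    and \<psi>: "homeomorphic_map (subtopology Y V) (top_of_set B) \<psi>" "\<psi> (f x) = 0"
    and fk: "\<forall>u\<in>U. \<psi> (f u) = \<phi> u ^ k" and k: "k \<ge> 1"
    and W: "openin X W" "x \<in> W"
  obtains V' where "openin Y V'" "f x \<in> V'" "V' \<subseteq> V"
    "\<And>y. y \<in> V' \<Longrightarrow> y \<noteq> f x \<Longrightarrow> card {u\<in>U. f u = y} = k \<and> {u\<in>U. f u = y} \<subseteq> W"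
proof -
  have topU: "topspace (subtopology X U) = U" "topspace (subtopology Y V) = V"
    using openin_subset[OF U(1)] openin_subset[OF V] by auto
  have \<phi>i: "inj_on \<phi> U" "\<phi> ` U = A" and \<psi>i: "inj_on \<psi> V" "\<psi> ` V = B"
    using homeomorphic_imp_injective_map[OF \<phi>(1)] homeomorphic_imp_surjective_map[OF \<phi>(1)]
      homeomorphic_imp_injective_map[OF \<psi>(1)] homeomorphic_imp_surjective_map[OF \<psi>(1)] topU by auto
  have "open (\<phi> ` (U \<inter> W))" by (rule openin_homeomorphic_image[OF \<phi>(1) A U(1)]) (use U W in auto)
  moreover have "0 \<in> \<phi> ` (U \<inter> W)" using U W \<phi> by force
  ultimately obtain e where e: "e > 0" "ball 0 e \<subseteq> \<phi> ` (U \<inter> W)" using openE by blast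
  define V' where "V' = {y \<in> V. \<psi> y \<in> ball 0 (e ^ k)}"
  have "continuous_map (subtopology Y V) euclidean \<psi>"
    using \<psi>(1) homeomorphic_imp_continuous_map continuous_map_in_subtopology by blast
  then have "openin (subtopology Y V) {y \<in> topspace (subtopology Y V). \<psi> y \<in> ball 0 (e ^ k)}"
    by (rule openin_continuous_map_preimage) simp
  then have V'o: "openin Y V'" unfolding topU V'_def[symmetric] using V openin_trans_full by blast
  show thesis
  proof (rule that[OF V'o])
    show "f x \<in> V'" using UV U \<psi>(2) e by (auto simp: V'_def)
    show "V' \<subseteq> V" by (auto simp: V'_def)
    fix y assume y: "y \<in> V'" "y \<noteq> f x"
    have yV: "y \<in> V" and small: "cmod (\<psi> y) < e ^ k" using y by (auto simp: V'_def)
    have ny: "\<psi> y \<noteq> 0" using \<psi>i(1) \<psi>(2) yV y(2) UV U(2) by (metis imageI inj_onD subset_iff)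
    have roots: "{a. a ^ k = \<psi> y} \<subseteq> \<phi> ` (U \<inter> W)"
    proof
      fix a assume "a \<in> {a. a ^ k = \<psi> y}"
      then have "cmod a ^ k < e ^ k" using small by (simp add: norm_power[symmetric])
      then have "cmod a < e" using e by (meson less_imp_le power_less_imp_less_base)
      then show "a \<in> \<phi> ` (U \<inter> W)" using e by auto
    qed
    have eq: "f u = y \<longleftrightarrow> \<phi> u ^ k = \<psi> y" if "u \<in> U" for u
      using fk that \<psi>i(1) yV UV by (metis image_subset_iff inj_onD)
    have img: "\<phi> ` {u\<in>U. f u = y} = {a. a ^ k = \<psi> y}" using roots eq by (auto simp: image_iff)
    have "card {u\<in>U. f u = y} = card (\<phi> ` {u\<in>U. f u = y})"
      using \<phi>i by (intro card_image[symmetric]) (auto simp: inj_on_def)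
    also have "\<dots> = k" unfolding img using ny k by (intro card_nth_roots) auto
    moreover have "{u\<in>U. f u = y} \<subseteq> W"
    proof
      fix u assume u: "u \<in> {u\<in>U. f u = y}"
      then have "\<phi> u \<in> \<phi> ` (U \<inter> W)" using eq roots by auto
      then show "u \<in> W" using \<phi>i(1) u by (auto simp: inj_on_def)
    qed
    ultimately show "card {u\<in>U. f u = y} = k \<and> {u\<in>U. f u = y} \<subseteq> W" by blast
  qed
qed

text \<open>The exponent counts the preimages near \<open>x\<close> of a point near
  \<open>f x\<close>, and close enough to \<open>f x\<close> both charts see the same preimages.
  Since \<open>local_degree\<close> is a definite description, its value is known only through
  this.\<close>

lemma has_local_degree_unique:
  assumes 1: "has_local_degree X Y f x k" and 2: "has_local_degree X Y f x l"
  shows "k = l"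
proof -
  obtain U V A B \<phi> \<psi> where c: "openin X U" "x \<in> U" "openin Y V" "f ` U \<subseteq> V" "open (A::complex set)" "open (B::complex set)"
    "homeomorphic_map (subtopology X U) (top_of_set A) \<phi>" "\<phi> x = 0"
    "homeomorphic_map (subtopology Y V) (top_of_set B) \<psi>" "\<psi> (f x) = 0" "\<forall>u\<in>U. \<psi> (f u) = \<phi> u ^ k" "k \<ge> 1"
    using 1 unfolding has_local_degree_def by auto
  obtain U' V' A' B' \<phi>' \<psi>' where c': "openin X U'" "x \<in> U'" "openin Y V'" "f ` U' \<subseteq> V'" "open (A'::complex set)" "open (B'::complex set)"
    "homeomorphic_map (subtopology X U') (top_of_set A') \<phi>'" "\<phi>' x = 0"
    "homeomorphic_map (subtopology Y V') (top_of_set B') \<psi>'" "\<psi>' (f x) = 0" "\<forall>u\<in>U'. \<psi>' (f u) = \<phi>' u ^ l" "l \<ge> 1"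
    using 2 unfolding has_local_degree_def by auto
  obtain T where T: "openin Y T" "f x \<in> T" "T \<subseteq> V" "\<And>y. y \<in> T \<Longrightarrow> y \<noteq> f x \<Longrightarrow> card {u\<in>U. f u = y} = k \<and> {u\<in>U. f u = y} \<subseteq> U'"
  proof (rule local_chart_fibres[OF c c'(1,2)], goal_cases)
    case (1 T)
    show ?case by (rule 1(1)[OF 1(2-5)])
  qed
  obtain T' where T': "openin Y T'" "f x \<in> T'" "T' \<subseteq> V'" "\<And>y. y \<in> T' \<Longrightarrow> y \<noteq> f x \<Longrightarrow> card {u\<in>U'. f u = y} = l \<and> {u\<in>U'. f u = y} \<subseteq> U"
  proof (rule local_chart_fibres[OF c' c(1,2)], goal_cases)
    case (1 T)
    show ?case by (rule 1(1)[OF 1(2-5)])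
  qed
  have "open (\<psi> ` (T \<inter> T'))" by (rule openin_homeomorphic_image[OF c(9) c(6) c(3)]) (use T T' in auto)
  moreover have "0 \<in> \<psi> ` (T \<inter> T')" using T T' c(10) by force
  ultimately obtain e where e: "e > 0" "ball 0 e \<subseteq> \<psi> ` (T \<inter> T')" using openE by blast
  have "of_real (e / 2) \<in> ball (0::complex) e" using e(1) by simp
  from subsetD[OF e(2) this] obtain y where "of_real (e / 2) = \<psi> y" "y \<in> T \<inter> T'" by (elim imageE)
  then have y: "y \<in> T" "y \<in> T'" "\<psi> y = of_real (e / 2)" by auto
  then have "y \<noteq> f x" using c(10) e(1) by auto
  then have "card {u\<in>U. f u = y} = k" "{u\<in>U. f u = y} \<subseteq> U'" "card {u\<in>U'. f u = y} = l" "{u\<in>U'. f u = y} \<subseteq> U"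
    using T(4)[OF y(1)] T'(4)[OF y(2)] by (iprover elim: conjE)+
  moreover from this have "{u\<in>U. f u = y} = {u\<in>U'. f u = y}" by auto
  ultimately show ?thesis by simp
qed

lemma local_degree_eq: "has_local_degree X Y f x k \<Longrightarrow> local_degree X Y f x = k"
  unfolding local_degree_def by (rule the_equality) (auto intro: has_local_degree_unique)

lemma branched_cover_local_degree:
  "branched_cover X Y f \<Longrightarrow> x \<in> topspace X \<Longrightarrow> has_local_degree X Y f x (local_degree X Y f x)"
proof -
  assume "branched_cover X Y f" "x \<in> topspace X"
  then obtain k where "has_local_degree X Y f x k" unfolding branched_cover_def by blast
  then show ?thesis using local_degree_eq by metis
qed

lemma homeomorphic_map_restrict:
  assumes "homeomorphic_map X X' g" "openin X' U"
  shows "homeomorphic_map (subtopology X {x \<in> topspace X. g x \<in> U}) (subtopology X' U) g" "openin X {x \<in> topspace X. g x \<in> U}"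
proof -
  show "openin X {x \<in> topspace X. g x \<in> U}"
    using assms homeomorphic_imp_continuous_map openin_continuous_map_preimage by blast
  have "g ` {x \<in> topspace X. g x \<in> U} = topspace X' \<inter> U"
    using homeomorphic_imp_surjective_map[OF assms(1)] by auto
  then show "homeomorphic_map (subtopology X {x \<in> topspace X. g x \<in> U}) (subtopology X' U) g"
    using homeomorphic_map_subtopologies_alt[OF assms(1)] openin_subset[OF assms(2)]
    by (intro homeomorphic_map_subtopologies[OF assms(1)]) auto
qed

lemma has_local_degree_transfer:
  assumes deg: "has_local_degree X Y f (g x) k" and g: "homeomorphic_map X' X g" and h: "homeomorphic_maps Y Y' h h'"
    and x: "x \<in> topspace X'" and f: "f ` topspace X \<subseteq> topspace Y"
  shows "has_local_degree X' Y' (h \<circ> f \<circ> g) x k"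
proof -
  obtain U V A B \<phi> \<psi> where c: "openin X U" "g x \<in> U" "openin Y V" "f ` U \<subseteq> V" "open (A::complex set)" "open (B::complex set)"
    "homeomorphic_map (subtopology X U) (top_of_set A) \<phi>" "\<phi> (g x) = 0"
    "homeomorphic_map (subtopology Y V) (top_of_set B) \<psi>" "\<psi> (f (g x)) = 0" "\<forall>u\<in>U. \<psi> (f u) = \<phi> u ^ k" "k \<ge> 1"
    using deg unfolding has_local_degree_def by auto
  have h': "homeomorphic_map Y' Y h'" "\<And>y. y \<in> topspace Y \<Longrightarrow> h' (h y) = y" "\<And>y. y \<in> topspace Y \<Longrightarrow> h y \<in> topspace Y'"
    using h homeomorphic_maps_map homeomorphic_maps_sym by (blast, auto simp: homeomorphic_maps_def continuous_map_def)
  define U' where "U' = {x \<in> topspace X'. g x \<in> U}"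
  define V' where "V' = {y \<in> topspace Y'. h' y \<in> V}"
  note U' = homeomorphic_map_restrict[OF g c(1), folded U'_def]
  note V' = homeomorphic_map_restrict[OF h'(1) c(3), folded V'_def]
  have UX: "U \<subseteq> topspace X" using c(1) openin_subset by blast
  have *: "h' (h (f u)) = f u" "h (f u) \<in> topspace Y'" if "u \<in> U" for u
    using h' f UX that by blast+
  show ?thesis unfolding has_local_degree_def
  proof (rule conjI[OF c(12)], rule exI[of _ U'], rule exI[of _ V'], rule exI[of _ A], rule exI[of _ B],
      rule exI[of _ "\<phi> \<circ> g"], rule exI[of _ "\<psi> \<circ> h'"], intro conjI)
    show "homeomorphic_map (subtopology X' U') (top_of_set A) (\<phi> \<circ> g)"
      using U'(1) c(7) homeomorphic_map_compose by blast
    show "homeomorphic_map (subtopology Y' V') (top_of_set B) (\<psi> \<circ> h')"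
      using V'(1) c(9) homeomorphic_map_compose by blast
    show "(h \<circ> f \<circ> g) ` U' \<subseteq> V'" using * c(4) by (auto simp: U'_def V'_def image_subset_iff)
  qed (use c U'(2) V'(2) x * in \<open>auto simp: U'_def\<close>)
qed

text \<open>Composition with homeomorphisms on both sides preserves charts, fibres and local
  degrees; it lets the concrete sphere \<open>sph\<close> stand for every topological
  sphere.\<close>

lemma realizable_transfer:
  assumes XX: "X homeomorphic_space X'" and YY: "Y homeomorphic_space Y'" and r: "realizable X Y d Ps"
  shows "realizable X' Y' d Ps"
proof -
  obtain f where bc: "branched_cover X Y f" and deg: "has_degree X Y f d" and fin: "finite (branching_points X Y f)"
    "card (branching_points X Y f) = size Ps" and Ps: "image_mset (local_degrees_over X Y f) (mset_set (branching_points X Y f)) = Ps"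
    using r unfolding realizable_def by blast
  obtain g g' where g: "homeomorphic_maps X' X g g'" using XX homeomorphic_space_sym unfolding homeomorphic_space_def by blast
  obtain h h' where h: "homeomorphic_maps Y Y' h h'" using YY unfolding homeomorphic_space_def by blast
  have gm: "homeomorphic_map X' X g" and hm: "homeomorphic_map Y Y' h" using g h homeomorphic_maps_map by blast+
  have cf: "continuous_map X Y f" using bc by (simp add: branched_cover_def)
  have fY: "f ` topspace X \<subseteq> topspace Y" using cf continuous_map_image_subset_topspace by blast
  define F where "F = h \<circ> f \<circ> g"
  have gb: "bij_betw g (topspace X') (topspace X)" using gm homeomorphic_imp_injective_map homeomorphic_imp_surjective_map
    unfolding bij_betw_def by blast
  have hb: "inj_on h (topspace Y)" "h ` topspace Y = topspace Y'" using hm homeomorphic_imp_injective_map homeomorphic_imp_surjective_map by blast+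
  have hld: "has_local_degree X' Y' F x (local_degree X Y f (g x))" if "x \<in> topspace X'" for x
    unfolding F_def using that gb
    by (intro has_local_degree_transfer[OF branched_cover_local_degree[OF bc] gm h _ fY]) (auto simp: bij_betw_def)
  have bcF: "branched_cover X' Y' F"
    unfolding branched_cover_def
    using hld cf homeomorphic_imp_continuous_map[OF gm] homeomorphic_imp_continuous_map[OF hm]
    by (auto simp: F_def intro!: continuous_map_compose)
  have ld: "local_degree X' Y' F x = local_degree X Y f (g x)" if "x \<in> topspace X'" for x
    using hld[OF that] by (rule local_degree_eq)
  have fib: "bij_betw g (fibre X' F (h y)) (fibre X f y)" if "y \<in> topspace Y" for y
  proof (rule bij_betw_subset[OF gb])
    show "fibre X' F (h y) \<subseteq> topspace X'" by (auto simp: fibre_def)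
    have "F x = h y \<longleftrightarrow> f (g x) = y" if "x \<in> topspace X'" for x
    proof -
      have "f (g x) \<in> topspace Y" using that gb fY by (auto simp: bij_betw_def)
      then show ?thesis using hb(1) \<open>y \<in> topspace Y\<close> by (auto simp: F_def inj_on_def)
    qed
    then have "fibre X' F (h y) = {x \<in> topspace X'. f (g x) = y}" by (auto simp: fibre_def)
    moreover have "topspace X = g ` topspace X'" using gb by (simp add: bij_betw_def)
    ultimately show "g ` fibre X' F (h y) = fibre X f y" unfolding fibre_def by auto
  qed
  have br: "branching_points X' Y' F = h ` branching_points X Y f"
  proof -
    have "h y \<in> branching_points X' Y' F \<longleftrightarrow> y \<in> branching_points X Y f" if "y \<in> topspace Y" for y
    proof -
      have "fibre X f y = g ` fibre X' F (h y)" using fib[OF that] by (simp add: bij_betw_def)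
      then have "(\<exists>x \<in> fibre X' F (h y). local_degree X' Y' F x > 1) \<longleftrightarrow> (\<exists>x \<in> fibre X f y. local_degree X Y f x > 1)"
        using ld by (auto simp: fibre_def)
      then show ?thesis using that hb(2) unfolding branching_points_def by blast
    qed
    moreover have "branching_points X' Y' F \<subseteq> h ` topspace Y" "branching_points X Y f \<subseteq> topspace Y"
      unfolding hb(2) by (auto simp: branching_points_def)
    ultimately show ?thesis by blast
  qed
  have brY: "branching_points X Y f \<subseteq> topspace Y" by (auto simp: branching_points_def)
  then have inj: "inj_on h (branching_points X Y f)" using hb(1) inj_on_subset by blast
  have ldo: "local_degrees_over X' Y' F (h y) = local_degrees_over X Y f y" if "y \<in> topspace Y" for y
  proof -
    have "mset_set (fibre X f y) = image_mset g (mset_set (fibre X' F (h y)))"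
      using fib[OF that] image_mset_mset_set[of g "fibre X' F (h y)"] by (simp add: bij_betw_def)
    then have "local_degrees_over X Y f y = image_mset (local_degree X Y f \<circ> g) (mset_set (fibre X' F (h y)))"
      by (simp add: local_degrees_over_def multiset.map_comp)
    also have "\<dots> = local_degrees_over X' Y' F (h y)" unfolding local_degrees_over_def
    proof (rule image_mset_cong)
      fix x assume "x \<in># mset_set (fibre X' F (h y))"
      then have "x \<in> fibre X' F (h y)" by (metis count_mset_set(2,3) not_in_iff)
      then show "(local_degree X Y f \<circ> g) x = local_degree X' Y' F x" using ld by (simp add: fibre_def)
    qed
    finally show ?thesis by simp
  qed
  have "has_degree X' Y' F d" unfolding has_degree_def
  proof
    fix y' assume y': "y' \<in> topspace Y' - branching_points X' Y' F"
    then obtain y where y: "y \<in> topspace Y" "y' = h y" using hb(2) by blast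
    then have "y \<notin> branching_points X Y f" using y' br by blast
    then have "finite (fibre X f y) \<and> card (fibre X f y) = d" using deg y unfolding has_degree_def by blast
    then show "finite (fibre X' F y') \<and> card (fibre X' F y') = d"
      using fib[OF y(1)] bij_betw_finite bij_betw_same_card y(2) by metis
  qed
  moreover have "image_mset (local_degrees_over X' Y' F) (mset_set (branching_points X' Y' F)) = Ps"
  proof -
    have "mset_set (branching_points X' Y' F) = image_mset h (mset_set (branching_points X Y f))"
      unfolding br using image_mset_mset_set[OF inj] by simp
    then have "image_mset (local_degrees_over X' Y' F) (mset_set (branching_points X' Y' F))
       = image_mset (local_degrees_over X' Y' F \<circ> h) (mset_set (branching_points X Y f))" by (simp add: multiset.map_comp)
    also have "\<dots> = image_mset (local_degrees_over X Y f) (mset_set (branching_points X Y f))"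
      using ldo brY fin(1) by (intro image_mset_cong) auto
    finally show ?thesis using Ps by simp
  qed
  ultimately show ?thesis unfolding realizable_def
    using bcF fin card_image[OF inj] br by (intro exI[of _ F]) auto
qed

section \<open>Covers induced by affine maps\<close>

abbreviation "sphtop \<equiv> top_of_set sph"

lemma ord6_orbit:
  assumes "p6 z = p6 w" shows "ord6 z = ord6 w"
proof -
  obtain u b where u: "u ^ 6 = 1" and b: "b \<in> eis" and w: "w = u * z + b" using assms p6_eq_iff by blast
  have "c * w \<in> eis \<longleftrightarrow> c * z \<in> eis" if "c \<in> eis" for c
  proof -
    have "c * w = u * (c * z) + c * b" by (simp add: w algebra_simps)
    moreover have "c * b \<in> eis" using that b by blast
    ultimately have "c * w \<in> eis \<longleftrightarrow> u * (c * z) \<in> eis" using eis_add eis_diff by (metis add_diff_cancel_right')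
    then show ?thesis using unit_mult_eis_iff[OF u] by simp
  qed
  from this[of 1] this[of \<theta>] this[of 2] show ?thesis by (simp add: ord6_def)
qed

lemma card_stab6: "card {u. u ^ 6 = 1 \<and> (1 - u) * w \<in> eis} = ord6 w"
proof -
  have "{u. u ^ 6 = 1 \<and> (1 - u) * w \<in> eis} = {u. u ^ ord6 w = 1}"
    using ord6_stab c6.unit_ord by blast
  then show ?thesis using card_roots_unity_eq[of "ord6 w"] c6.ord_pos[of w] by simp
qed

lemma card_stab3: "card {u. u ^ 3 = 1 \<and> (1 - u) * w \<in> eis} = ord3 w"
proof -
  have "{u. u ^ 3 = 1 \<and> (1 - u) * w \<in> eis} = {u. u ^ ord3 w = 1}"
    using ord3_stab c3.unit_ord by blast
  then show ?thesis using card_roots_unity_eq[of "ord3 w"] c3.ord_pos[of w] by simp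
qed

text \<open>The condition on \<open>c\<close> makes (1 - v) c a lattice point for every cube root of
  unity v. This is what z \<mapsto> m z + c needs in order to send orbits of the group of
  \<open>p3\<close> into orbits of the group of \<open>p6\<close>.\<close>

locale affine_cover =
  fixes m c :: complex
  assumes m: "m \<in> eis" "m \<noteq> 0" and c: "\<theta> * c \<in> eis"
begin

lemma unit3_c: assumes "v ^ 3 = 1" shows "(1 - v) * c \<in> eis"
proof -
  have "ord3 c = 3" using c by (simp add: ord3_def)
  then show ?thesis using ord3_stab[OF assms, of c] assms by simp
qed

definition F :: "complex \<times> real \<Rightarrow> complex \<times> real" where
  "F y = p6 (m * (SOME z. p3 z = y) + c)"

lemma F_p3: "F (p3 z) = p6 (m * z + c)"
proof -
  define w where "w = (SOME w. p3 w = p3 z)"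
  have "p3 w = p3 z" unfolding w_def by (rule someI) (rule refl)
  then obtain u b where u: "u ^ 3 = 1" and b: "b \<in> eis" and z: "z = u * w + b" using p3_eq_iff by blast
  have "m * z + c = u * (m * w + c) + (m * b + (1 - u) * c)" by (simp add: z algebra_simps)
  moreover have "m * b + (1 - u) * c \<in> eis" using m b unit3_c[OF u] by blast
  moreover have "u ^ 6 = 1" using c3.unit6[OF u] .
  ultimately have "p6 (m * w + c) = p6 (m * z + c)" unfolding p6_eq_iff by blast
  then show ?thesis by (simp add: F_def w_def)
qed

text \<open>The local degree of the induced map: a quotient of the orders of the stabilisers at
  target and source.\<close>

definition e :: "complex \<Rightarrow> nat" where "e z = ord6 (m * z + c) div ord3 z"

lemma ord3_dvd: "ord3 z dvd ord6 (m * z + c)"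
proof (cases "\<theta> * z \<in> eis")
  case True
  have "\<theta> * (m * z + c) = m * (\<theta> * z) + \<theta> * c" by (simp add: algebra_simps)
  then have "\<theta> * (m * z + c) \<in> eis" using True m c by auto
  then have "ord6 (m * z + c) \<in> {6, 3}" by (simp add: ord6_def)
  then show ?thesis by (auto simp: ord3_def)
qed (simp add: ord3_def)

lemma e_mult: "e z * ord3 z = ord6 (m * z + c)"
  unfolding e_def using ord3_dvd by simp

lemma e_pos: "e z \<ge> 1"
  using e_mult[of z] c6.ord_pos[of "m * z + c"] by (cases "e z") auto

text \<open>Both quotient maps are power maps in their charts and the affine map multiplies z - z0
  by \<open>m\<close>, so \<open>F\<close> is a power map up to a constant factor.\<close>

lemma F_local_degree: "has_local_degree sphtop sphtop F (p3 z0) (e z0)"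
proof -
  define w0 where "w0 = m * z0 + c"
  obtain r1 where r1: "r1 > 0" "\<And>\<rho>. 0 < \<rho> \<Longrightarrow> \<rho> \<le> r1 \<Longrightarrow>
    \<exists>\<phi>. homeomorphic_map (subtopology sphtop (p3 ` ball z0 \<rho>))
      (top_of_set ((\<lambda>z. (z - z0) ^ ord3 z0) ` ball z0 \<rho>)) \<phi> \<and> (\<forall>z\<in>ball z0 \<rho>. \<phi> (p3 z) = (z - z0) ^ ord3 z0)"
    using c3.chart by blast
  obtain r2 where r2: "r2 > 0" "\<And>\<rho>. 0 < \<rho> \<Longrightarrow> \<rho> \<le> r2 \<Longrightarrow>
    \<exists>\<phi>. homeomorphic_map (subtopology sphtop (p6 ` ball w0 \<rho>))
      (top_of_set ((\<lambda>z. (z - w0) ^ ord6 w0) ` ball w0 \<rho>)) \<phi> \<and> (\<forall>z\<in>ball w0 \<rho>. \<phi> (p6 z) = (z - w0) ^ ord6 w0)"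
    using c6.chart by blast
  define \<rho> where "\<rho> = min r1 (r2 / cmod m)"
  have \<rho>: "0 < \<rho>" "\<rho> \<le> r1" "cmod m * \<rho> \<le> r2"
    using r1 r2 m by (auto simp: \<rho>_def min_def field_simps)
  define A where "A = (\<lambda>z. (z - z0) ^ ord3 z0) ` ball z0 \<rho>"
  define B where "B = (\<lambda>z. (z - w0) ^ ord6 w0) ` ball w0 r2"
  obtain \<phi> where \<phi>: "homeomorphic_map (subtopology sphtop (p3 ` ball z0 \<rho>)) (top_of_set A) \<phi>"
    "\<And>z. z \<in> ball z0 \<rho> \<Longrightarrow> \<phi> (p3 z) = (z - z0) ^ ord3 z0" using r1(2)[OF \<rho>(1,2)] unfolding A_def by blast
  obtain \<psi> where \<psi>: "homeomorphic_map (subtopology sphtop (p6 ` ball w0 r2)) (top_of_set B) \<psi>"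
    "\<And>z. z \<in> ball w0 r2 \<Longrightarrow> \<psi> (p6 z) = (z - w0) ^ ord6 w0" using r2(2)[OF r2(1)] unfolding B_def by blast
  have into: "m * z + c \<in> ball w0 r2" if "z \<in> ball z0 \<rho>" for z
  proof -
    have "dist w0 (m * z + c) = cmod m * dist z0 z"
      by (simp add: dist_norm w0_def norm_mult[symmetric] algebra_simps)
    also have "\<dots> < cmod m * \<rho>" using that m by simp
    finally show ?thesis using \<rho>(3) by simp
  qed
  \<comment> \<open>Rescaling the source chart by \<open>s\<close> absorbs the constant
    factor.\<close>
  define s where "s = m ^ ord3 z0"
  have s: "s \<noteq> 0" using m by (simp add: s_def)
  have hs: "homeomorphic_map (top_of_set A) (top_of_set ((*) s ` A)) ((*) s)"
  proof -
    have "homeomorphic_maps (top_of_set A) (top_of_set ((*) s ` A)) ((*) s) (\<lambda>z. z / s)"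
      unfolding homeomorphic_maps_def using s by (auto intro!: continuous_intros)
    then show ?thesis using homeomorphic_maps_map by blast
  qed
  have oA: "open ((*) s ` A)"
  proof -
    have "open A" unfolding A_def by (intro open_power_shift c3.ord_pos open_ball)
    moreover have "(*) s ` A = (\<lambda>z. z / s) -` A" using s by (auto simp: image_iff intro!: bexI[of _ "_ / s"])
    ultimately show ?thesis using s by (auto intro!: open_vimage continuous_intros)
  qed
  show ?thesis unfolding has_local_degree_def
  proof (rule conjI[OF e_pos], rule exI[of _ "p3 ` ball z0 \<rho>"], rule exI[of _ "p6 ` ball w0 r2"], rule exI[of _ "(*) s ` A"],
     rule exI[of _ B], rule exI[of _ "(*) s \<circ> \<phi>"], rule exI[of _ \<psi>], intro conjI)
    show "openin sphtop (p3 ` ball z0 \<rho>)" "openin sphtop (p6 ` ball w0 r2)"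
      using c3.open_map c6.open_map by auto
    show "p3 z0 \<in> p3 ` ball z0 \<rho>" using \<rho> by simp
    show "F ` p3 ` ball z0 \<rho> \<subseteq> p6 ` ball w0 r2" using into by (auto simp: F_p3)
    show "open ((*) s ` A)" by (rule oA)
    show "open B" unfolding B_def by (intro open_power_shift c6.ord_pos open_ball)
    show "homeomorphic_map (subtopology sphtop (p3 ` ball z0 \<rho>)) (top_of_set ((*) s ` A)) ((*) s \<circ> \<phi>)"
      using homeomorphic_map_compose[OF \<phi>(1) hs] .
    show "((*) s \<circ> \<phi>) (p3 z0) = 0" using \<phi>(2)[of z0] \<rho> c3.ord_pos[of z0] by (simp add: power_0_left)
    show "homeomorphic_map (subtopology sphtop (p6 ` ball w0 r2)) (top_of_set B) \<psi>" by (rule \<psi>(1))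
    show "\<psi> (F (p3 z0)) = 0" using \<psi>(2)[of w0] r2 c6.ord_pos[of w0] by (simp add: F_p3 w0_def[symmetric] power_0_left)
    show "\<forall>u\<in>p3 ` ball z0 \<rho>. \<psi> (F u) = ((*) s \<circ> \<phi>) u ^ e z0"
    proof
      fix u assume "u \<in> p3 ` ball z0 \<rho>"
      then obtain z where z: "z \<in> ball z0 \<rho>" "u = p3 z" by blast
      have "\<psi> (F u) = (m * z + c - w0) ^ ord6 w0" using \<psi>(2)[OF into[OF z(1)]] by (simp add: z F_p3)
      also have "\<dots> = (m * (z - z0)) ^ (ord3 z0 * e z0)"
        using e_mult[of z0] by (simp add: w0_def algebra_simps)
      also have "\<dots> = (s * (z - z0) ^ ord3 z0) ^ e z0" by (simp add: s_def power_mult power_mult_distrib)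
      finally show "\<psi> (F u) = ((*) s \<circ> \<phi>) u ^ e z0" using \<phi>(2)[OF z(1)] z by simp
    qed
  qed
qed

lemma F_continuous: "continuous_map sphtop sphtop F"
proof (rule continuous_map_into_subtopology, subst continuous_map_def, intro conjI allI impI)
  fix V :: "(complex \<times> real) set" assume "openin euclidean V"
  then have V: "open V" by (simp only: open_openin)
  have "continuous_on UNIV (\<lambda>z. p6 (m * z + c))"
    by (rule continuous_on_compose2[OF continuous_p6]) (auto intro!: continuous_intros)
  then have "open ((\<lambda>z. p6 (m * z + c)) -` V)" using V by (simp add: open_vimage)
  then have "openin sphtop (p3 ` ((\<lambda>z. p6 (m * z + c)) -` V))" by (rule c3.open_map)
  moreover have "{x \<in> topspace sphtop. F x \<in> V} = p3 ` ((\<lambda>z. p6 (m * z + c)) -` V)"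
  proof (rule subset_antisym; rule subsetI)
    fix x assume "x \<in> {x \<in> topspace sphtop. F x \<in> V}"
    then have "x \<in> range p3" "F x \<in> V" using range_p3 by auto
    then obtain z where "x = p3 z" "F (p3 z) \<in> V" by blast
    then show "x \<in> p3 ` ((\<lambda>z. p6 (m * z + c)) -` V)" by (simp add: F_p3)
  next
    fix x assume "x \<in> p3 ` ((\<lambda>z. p6 (m * z + c)) -` V)"
    then obtain z where "x = p3 z" "p6 (m * z + c) \<in> V" by blast
    then show "x \<in> {x \<in> topspace sphtop. F x \<in> V}" using c3.p_in_sph[of z] by (simp add: F_p3)
  qed
  ultimately show "openin sphtop {x \<in> topspace sphtop. F x \<in> V}" by simp
next
  show "F \<in> topspace sphtop \<rightarrow> sph" using c6.p_in_sph by (auto simp: F_def)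
qed auto

lemma F_branched_cover: "branched_cover sphtop sphtop F"
  unfolding branched_cover_def
proof (intro conjI F_continuous ballI)
  fix x assume "x \<in> topspace sphtop"
  then have "x \<in> range p3" using range_p3 by simp
  then show "\<exists>k. has_local_degree sphtop sphtop F x k" using F_local_degree by blast
qed

lemma fibre_F_E:
  assumes "x \<in> fibre sphtop F y" obtains z where "x = p3 z" "p6 (m * z + c) = y"
proof -
  have "x \<in> range p3" "F x = y" using assms range_p3 by (auto simp: fibre_def)
  then obtain z where z: "x = p3 z" "F x = y" by blast
  have "p6 (m * z + c) = y" using z F_p3[of z] by simp
  with z(1) show ?thesis by (rule that)
qed

lemma local_degree_F: "local_degree sphtop sphtop F (p3 z) = e z"
  by (rule local_degree_eq[OF F_local_degree])

text \<open>Double counting of the triples \<open>(u, r, v)\<close> with \<open>u w + r \<equiv> v w\<^sub>0 + (1 - v) c\<close> modulo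
  \<open>m\<close>, where \<open>u\<^sup>6 = v\<^sup>3 = 1\<close> and \<open>r\<close> runs through the residues.\<close>

lemma F_fibre_sum:
  shows "finite (fibre sphtop F (p6 w))"
    and "real (\<Sum>x\<in>fibre sphtop F (p6 w). local_degree sphtop sphtop F x) = 2 * (cmod m)\<^sup>2"
proof -
  obtain R where R: "eis_reps m R" using eis_reps_exist[OF m] by blast
  note Rc = eis_reps_card[OF m R]
  define U6 U3 where "U6 = {u::complex. u ^ 6 = 1}" and "U3 = {u::complex. u ^ 3 = 1}"
  have U: "finite U6" "card U6 = 6" "finite U3" "card U3 = 3"
    using card_roots_unity_eq[of 6] card_roots_unity_eq[of 3] by (auto simp: U6_def U3_def intro: finite_roots_unity)
  define G where "G = U6 \<times> R"
  \<comment> \<open>\<open>g (u, r)\<close> solves m z + c = u w + r. These points fill the fibre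
    with repetitions, which the count below measures.\<close>
  define g where "g a = (fst a * w + snd a - c) / m" for a
  have finG: "finite G" using U Rc by (simp add: G_def)
  have mg: "m * g a + c = fst a * w + snd a" for a using m by (simp add: g_def)
  have fib: "fibre sphtop F (p6 w) = (\<lambda>a. p3 (g a)) ` G"
  proof
    show "(\<lambda>a. p3 (g a)) ` G \<subseteq> fibre sphtop F (p6 w)"
    proof
      fix x assume "x \<in> (\<lambda>a. p3 (g a)) ` G"
      then obtain u r where a: "u ^ 6 = 1" "r \<in> R" "x = p3 (g (u, r))" by (auto simp: G_def U6_def)
      then have "r \<in> eis" using eis_reps_subset[OF R] by blast
      then have "p6 w = p6 (m * g (u, r) + c)" unfolding p6_eq_iff mg using a by auto
      then show "x \<in> fibre sphtop F (p6 w)" using c3.p_in_sph by (simp add: fibre_def a F_p3)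
    qed
    show "fibre sphtop F (p6 w) \<subseteq> (\<lambda>a. p3 (g a)) ` G"
    proof
      fix x assume x: "x \<in> fibre sphtop F (p6 w)"
      then obtain z where z: "x = p3 z" and "p6 w = p6 (m * z + c)" by (metis fibre_F_E)
      then obtain u b where u: "u ^ 6 = 1" and b: "b \<in> eis" and eq: "m * z + c = u * w + b" using p6_eq_iff by blast
      obtain r q where r: "r \<in> R" "q \<in> eis" "b - r = m * q" using eis_reps_ex[OF R b] by (auto simp: eis_mod_def)
      have "m * z = u * w + b - c" using eq by (simp add: algebra_simps)
      also have "\<dots> = (m * g (u, r) + c) + (b - r) - c" unfolding mg by (simp add: algebra_simps)
      also have "\<dots> = m * (g (u, r) + q)" unfolding r(3) by (simp add: algebra_simps)
      finally have "m * z = m * (g (u, r) + q)" .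
      then have "z = 1 * g (u, r) + q" using m by simp
      then have "p3 (g (u, r)) = x" unfolding z p3_eq_iff using r(2) by (intro exI[of _ 1] exI[of _ q]) simp
      then show "x \<in> (\<lambda>a. p3 (g a)) ` G" using u r(1) by (intro image_eqI[of _ _ "(u, r)"]) (auto simp: G_def U6_def)
    qed
  qed
  then show fin: "finite (fibre sphtop F (p6 w))" using finG by simp
  have count: "card {a \<in> G. p3 (g a) = x} = 3 * local_degree sphtop sphtop F x" if x: "x \<in> fibre sphtop F (p6 w)" for x
  proof -
    obtain z where z: "x = p3 z" and "p6 w = p6 (m * z + c)" using x by (metis fibre_F_E)
    then obtain u0 b0 where u0: "u0 ^ 6 = 1" and b0: "b0 \<in> eis" and eq0: "m * z + c = u0 * w + b0" using p6_eq_iff by blast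
    have o6: "ord6 (m * z + c) = ord6 w" using ord6_orbit \<open>p6 w = p6 (m * z + c)\<close> by metis
    have u00: "u0 \<noteq> 0" using u0 by auto
    \<comment> \<open>For fixed \<open>v\<close> there are \<open>ord6 w\<close> suitable
      \<open>a\<close>; for fixed \<open>a\<close> there are \<open>ord3 z\<close> suitable
      \<open>v\<close> if \<open>a\<close> yields \<open>x\<close>, and none otherwise.\<close>
    have "(\<Sum>a\<in>G. card {v \<in> U3. g a - v * z \<in> eis}) = (\<Sum>v\<in>U3. ord6 w)"
    proof (rule sum_multicount_gen[OF finG U(3)], rule ballI)
      fix v assume "v \<in> U3"
      then have v: "v ^ 3 = 1" "v ^ 6 = 1" "v \<noteq> 0" "v \<in> eis"
        using c3.unit6[of v] root_unity_6_eis by (auto simp: U3_def)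
      define b1 where "b1 = v * b0 + (1 - v) * c"
      have b1: "b1 \<in> eis" unfolding b1_def using v b0 unit3_c by blast
      have iff: "g (u, r) - v * z \<in> eis \<longleftrightarrow> (\<exists>q\<in>eis. (u - v * u0) * w + r - b1 = m * q)" for u r
      proof -
        have "m * (g (u, r) - v * z) = (u - v * u0) * w + r - b1"
        proof -
          have "m * (g (u, r) - v * z) = (m * g (u, r) + c) - v * (m * z + c) - (1 - v) * c" by (simp add: algebra_simps)
          also have "\<dots> = (u - v * u0) * w + r - b1" unfolding mg eq0 by (simp add: b1_def algebra_simps)
          finally show ?thesis .
        qed
        then show ?thesis using m by (metis mult_cancel_left)
      qed
      define S where "S = {u. u ^ 6 = 1 \<and> (1 - u) * w \<in> eis}"
      have unit: "(v * u0) ^ 6 = 1" using v u0 by (simp add: power_mult_distrib)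
      \<comment> \<open>The quotient of u by v u0 runs through the stabiliser of \<open>w\<close>,
        and u determines the residue.\<close>
      have "bij_betw (\<lambda>a. fst a / (v * u0)) {a \<in> G. g a - v * z \<in> eis} S"
      proof (rule bij_betw_imageI)
        show "inj_on (\<lambda>a. fst a / (v * u0)) {a \<in> G. g a - v * z \<in> eis}"
        proof (rule inj_onI)
          fix a a' assume a: "a \<in> {a \<in> G. g a - v * z \<in> eis}" "a' \<in> {a \<in> G. g a - v * z \<in> eis}" and "fst a / (v * u0) = fst a' / (v * u0)"
          then have fst: "fst a = fst a'" using v u00 by simp
          have "g a - g a' \<in> eis" using eis_diff[of "g a - v * z" "g a' - v * z"] a by simp
          moreover have "snd a - snd a' = m * (g a - g a')" using m fst by (simp add: g_def diff_divide_distrib[symmetric])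
          ultimately have "eis_mod m (snd a) (snd a')" unfolding eis_mod_def by blast
          then have "snd a = snd a'" using eis_reps_unique[OF R] a by (auto simp: G_def)
          then show "a = a'" using fst by (simp add: prod_eq_iff)
        qed
        show "(\<lambda>a. fst a / (v * u0)) ` {a \<in> G. g a - v * z \<in> eis} = S"
        proof
          show "(\<lambda>a. fst a / (v * u0)) ` {a \<in> G. g a - v * z \<in> eis} \<subseteq> S"
          proof
            fix t assume "t \<in> (\<lambda>a. fst a / (v * u0)) ` {a \<in> G. g a - v * z \<in> eis}"
            then obtain u r where ur: "u ^ 6 = 1" "r \<in> R" "g (u, r) - v * z \<in> eis" "t = u / (v * u0)" by (auto simp: G_def U6_def)
            then obtain q where "q \<in> eis" "(u - v * u0) * w + r - b1 = m * q" using iff by blast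
            then have "(u - v * u0) * w = m * q - r + b1" by (simp add: algebra_simps)
            moreover have "m * q - r + b1 \<in> eis" using m \<open>q \<in> eis\<close> ur b1 eis_reps_subset[OF R] by blast
            moreover have "(u - v * u0) * w = (v * u0) * (- ((1 - t) * w))" using v u00 by (simp add: ur(4) field_simps)
            ultimately have "(1 - t) * w \<in> eis" using unit_mult_eis_iff[OF unit] eis_minus_iff by metis
            then show "t \<in> S" using unit ur by (simp add: S_def power_divide)
          qed
          show "S \<subseteq> (\<lambda>a. fst a / (v * u0)) ` {a \<in> G. g a - v * z \<in> eis}"
          proof
            fix t assume t: "t \<in> S"
            define u where "u = t * (v * u0)"
            have u6: "u ^ 6 = 1" using t unit unfolding u_def S_def power_mult_distrib[of t] by simp
            have "(u - v * u0) * w = (v * u0) * (- ((1 - t) * w))" by (simp add: u_def algebra_simps)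
            then have "(u - v * u0) * w \<in> eis" using t unit_mult_eis_iff[OF unit] eis_minus_iff unfolding S_def by (metis (mono_tags, lifting) mem_Collect_eq)
            then have "b1 - (u - v * u0) * w \<in> eis" using b1 by blast
            from eis_reps_ex[OF R this] obtain r q where r: "r \<in> R" "q \<in> eis" "b1 - (u - v * u0) * w - r = m * q" by (auto simp: eis_mod_def)
            have "(u - v * u0) * w + r - b1 = m * (- q)" using r(3) by (simp add: algebra_simps)
            then have "g (u, r) - v * z \<in> eis" using iff r(2) eis_minus by blast
            moreover have "t = u / (v * u0)" using v u00 by (simp add: u_def)
            ultimately show "t \<in> (\<lambda>a. fst a / (v * u0)) ` {a \<in> G. g a - v * z \<in> eis}"
              using u6 r(1) by (intro image_eqI[of _ _ "(u, r)"]) (auto simp: G_def U6_def)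
          qed
        qed
      qed
      then have "card {a \<in> G. g a - v * z \<in> eis} = card S" by (rule bij_betw_same_card)
      then show "card {a \<in> G. g a - v * z \<in> eis} = ord6 w" unfolding S_def card_stab6 .
    qed
    moreover have "card {v \<in> U3. g a - v * z \<in> eis} = (if p3 (g a) = x then ord3 z else 0)" for a
    proof (cases "p3 (g a) = x")
      case True
      then have "p3 z = p3 (g a)" using z by simp
      then obtain v0 b where v0: "v0 ^ 3 = 1" and b: "b \<in> eis" and ga: "g a = v0 * z + b" using p3_eq_iff by blast
      have v00: "v0 \<noteq> 0" "v0 ^ 6 = 1" using v0 c3.unit6[OF v0] by auto
      have iff: "g a - v * z \<in> eis \<longleftrightarrow> (1 - v / v0) * z \<in> eis" for v
      proof -
        have "g a - v * z = v0 * ((1 - v / v0) * z) + b" using v00 by (simp add: ga field_simps)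
        then have "g a - v * z \<in> eis \<longleftrightarrow> v0 * ((1 - v / v0) * z) \<in> eis" using b eis_add eis_diff by (metis add_diff_cancel_right')
        then show ?thesis using unit_mult_eis_iff[OF v00(2)] by simp
      qed
      have "bij_betw (\<lambda>v. v / v0) {v \<in> U3. g a - v * z \<in> eis} {u. u ^ 3 = 1 \<and> (1 - u) * z \<in> eis}"
      proof (rule bij_betw_imageI)
        show "inj_on (\<lambda>v. v / v0) {v \<in> U3. g a - v * z \<in> eis}" using v00 by (auto simp: inj_on_def)
        show "(\<lambda>v. v / v0) ` {v \<in> U3. g a - v * z \<in> eis} = {u. u ^ 3 = 1 \<and> (1 - u) * z \<in> eis}"
        proof (rule subset_antisym; rule subsetI)
          fix t assume "t \<in> (\<lambda>v. v / v0) ` {v \<in> U3. g a - v * z \<in> eis}"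
          then show "t \<in> {u. u ^ 3 = 1 \<and> (1 - u) * z \<in> eis}" using iff v0 by (auto simp: U3_def power_divide)
        next
          fix t assume t: "t \<in> {u. u ^ 3 = 1 \<and> (1 - u) * z \<in> eis}"
          have "t = t * v0 / v0" using v00 by simp
          moreover from this have "g a - t * v0 * z \<in> eis" using iff[of "t * v0"] t by simp
          moreover have "t * v0 \<in> U3" using t v0 by (simp add: U3_def power_mult_distrib)
          ultimately show "t \<in> (\<lambda>v. v / v0) ` {v \<in> U3. g a - v * z \<in> eis}" by blast
        qed
      qed
      from bij_betw_same_card[OF this] show ?thesis using card_stab3[of z] True by simp
    next
      case False
      have "\<not> g a - v * z \<in> eis" if "v ^ 3 = 1" for v
      proof
        assume "g a - v * z \<in> eis"
        then have "p3 z = p3 (g a)" unfolding p3_eq_iff using that by (intro exI[of _ v] exI[of _ "g a - v * z"]) simp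
        then show False using False z by simp
      qed
      then have "{v \<in> U3. g a - v * z \<in> eis} = {}" by (auto simp: U3_def)
      then have "card {v \<in> U3. g a - v * z \<in> eis} = 0" by (simp only: card.empty)
      then show ?thesis using False by simp
    qed
    ultimately have "(\<Sum>a\<in>G. if p3 (g a) = x then ord3 z else 0) = 3 * ord6 w" using U by simp
    then have "card {a \<in> G. p3 (g a) = x} * ord3 z = 3 * ord6 w"
      using finG by (simp add: sum.If_cases Int_def)
    also have "\<dots> = 3 * local_degree sphtop sphtop F x * ord3 z"
      using e_mult[of z] o6 by (simp add: z local_degree_F)
    finally show ?thesis using c3.ord_pos[of z] by simp
  qed
  have "card G = (\<Sum>x\<in>fibre sphtop F (p6 w). card {a \<in> G. p3 (g a) = x})"
    using sum.group[OF finG fin, of "\<lambda>a. p3 (g a)" "\<lambda>_. 1::nat"] fib by simp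
  then have "3 * (\<Sum>x\<in>fibre sphtop F (p6 w). local_degree sphtop sphtop F x) = 6 * card R"
    using count U Rc by (simp add: G_def card_cartesian_product sum_distrib_left)
  then show "real (\<Sum>x\<in>fibre sphtop F (p6 w). local_degree sphtop sphtop F x) = 2 * (cmod m)\<^sup>2"
    using Rc(2) by (simp flip: of_nat_sum)
qed

end

section \<open>Cone points and ramification of the affine covers\<close>

lemma inverse_theta_notin: "1 / \<theta> \<notin> eis" "2 / \<theta> \<notin> eis"
  using theta_dvd_iff[of 1 0] theta_dvd_iff[of 2 0] by simp_all

text \<open>Standard representatives of the cone points; the orbit lemmas that follow show that each
  of the orders 6, 3 and 2 belongs to a single orbit.\<close>

lemma ord6_special: "ord6 0 = 6" "ord6 (1 / \<theta>) = 3" "ord6 (1 / 2) = 2"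
proof -
  have "(1 / 2 :: complex) \<notin> eis" using eis_discrete[of "1 / 2"] by auto
  moreover have "\<theta> / 2 \<notin> eis"
  proof
    assume "\<theta> / 2 \<in> eis"
    moreover have "(cmod (\<theta> / 2))\<^sup>2 < 1" using norm_theta_square by (simp add: norm_divide power_divide)
    then have "cmod (\<theta> / 2) < 1" by (metis abs_norm_cancel abs_square_less_1)
    ultimately have "\<theta> / 2 = 0" by (rule eis_discrete)
    then show False by simp
  qed
  ultimately show "ord6 (1 / 2) = 2" by (simp add: ord6_def)
qed (use inverse_theta_notin in \<open>simp_all add: ord6_def\<close>)

lemma ord6_6: "ord6 w = 6 \<Longrightarrow> p6 w = p6 0"
proof -
  assume "ord6 w = 6"
  then have "w \<in> eis" by (simp add: ord6_def split: if_splits)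
  then show ?thesis unfolding p6_eq_iff by (intro exI[of _ 1] exI[of _ "- w"]) auto
qed

lemma theta_eis_cases:
  assumes "\<theta> * z \<in> eis" shows "z \<in> eis \<or> z - 1 / \<theta> \<in> eis \<or> z + 1 / \<theta> \<in> eis"
  using eis_mod_theta[OF assms] by (simp add: diff_divide_distrib add_divide_distrib)

lemma ord6_3: "ord6 w = 3 \<Longrightarrow> p6 w = p6 (1 / \<theta>)"
proof -
  assume "ord6 w = 3"
  then have "w \<notin> eis" "\<theta> * w \<in> eis" by (auto simp: ord6_def split: if_splits)
  then consider "w - 1 / \<theta> \<in> eis" | "w + 1 / \<theta> \<in> eis" using theta_eis_cases by blast
  then show ?thesis
  proof cases
    case 1
    then have "- (w - 1 / \<theta>) \<in> eis" by blast
    then show ?thesis unfolding p6_eq_iff by (intro exI[of _ 1] exI[of _ "- (w - 1 / \<theta>)"]) simp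
  next
    case 2
    then show ?thesis unfolding p6_eq_iff by (intro exI[of _ "- 1"] exI[of _ "w + 1 / \<theta>"]) simp
  qed
qed

text \<open>Modulo \<open>eis\<close> there are three nonzero half periods, and rotations by units
  carry 1/2 to the other two.\<close>

lemma ord6_2: "ord6 w = 2 \<Longrightarrow> p6 w = p6 (1 / 2)"
proof -
  assume "ord6 w = 2"
  then have w: "w \<notin> eis" "2 * w \<in> eis" by (auto simp: ord6_def split: if_splits)
  obtain a b where ab: "2 * w = of_int a + of_int b * \<omega>" using w(2) by (elim eisE)
  define q where "q = of_int (a div 2) + of_int (b div 2) * \<omega>"
  have q: "q \<in> eis" unfolding q_def by (rule eisI)
  have "2 * (w - q) = (of_int a + of_int b * \<omega>) - 2 * q" unfolding ab[symmetric] by (simp add: algebra_simps)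
  also have "\<dots> = of_int (a - 2 * (a div 2)) + of_int (b - 2 * (b div 2)) * \<omega>"
    by (simp add: q_def algebra_simps)
  also have "\<dots> = of_int (a mod 2) + of_int (b mod 2) * \<omega>" by (simp only: minus_mult_div_eq_mod)
  finally have wq: "w - q = (of_int (a mod 2) + of_int (b mod 2) * \<omega>) / 2"
    by (metis nonzero_mult_div_cancel_left zero_neq_numeral)
  have ab2: "a mod 2 = 0 \<or> a mod 2 = 1" "b mod 2 = 0 \<or> b mod 2 = 1" by presburger+
  have "w - q \<noteq> 0" using w(1) q by auto
  then have "w - q = 1 / 2 \<or> w - q = \<omega> * (1 / 2) \<or> w - q = (1 + \<omega>) * (1 / 2)" using ab2 wq by auto
  then obtain u where "u ^ 6 = 1" "w - q = u * (1 / 2)" using omega_unit by (metis mult_1 power_one)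
  then have "w = u * (1 / 2) + q" by (metis diff_add_cancel)
  then show ?thesis using p6_eq_iff \<open>u ^ 6 = 1\<close> q by metis
qed

text \<open>The three cone points of the source, all of order 3.\<close>

definition K3 :: "(complex \<times> real) set" where "K3 = {p3 0, p3 (1 / \<theta>), p3 (- 1 / \<theta>)}"

lemma ord3_iff_K3: "ord3 z = 3 \<longleftrightarrow> p3 z \<in> K3"
proof
  assume "ord3 z = 3"
  then have "\<theta> * z \<in> eis" by (simp add: ord3_def split: if_splits)
  then consider "z \<in> eis" | "z - 1 / \<theta> \<in> eis" | "z + 1 / \<theta> \<in> eis" using theta_eis_cases by blast
  then show "p3 z \<in> K3"
  proof cases
    case 1
    then have "p3 0 = p3 z" unfolding p3_eq_iff by (intro exI[of _ 1] exI[of _ z]) simp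
    then show ?thesis by (simp add: K3_def)
  next
    case 2
    then have "p3 (1 / \<theta>) = p3 z" unfolding p3_eq_iff by (intro exI[of _ 1] exI[of _ "z - 1 / \<theta>"]) simp
    then show ?thesis by (simp add: K3_def)
  next
    case 3
    then have "p3 (- 1 / \<theta>) = p3 z" unfolding p3_eq_iff by (intro exI[of _ 1] exI[of _ "z + 1 / \<theta>"]) simp
    then show ?thesis by (simp add: K3_def)
  qed
next
  assume "p3 z \<in> K3"
  then obtain w where w: "p3 w = p3 z" "\<theta> * w \<in> eis" by (auto simp: K3_def)
  then obtain u b where "u ^ 3 = 1" "b \<in> eis" "z = u * w + b" using p3_eq_iff by blast
  moreover from this have "\<theta> * z = u * (\<theta> * w) + \<theta> * b" by (simp add: algebra_simps)
  moreover have "u \<in> eis" using root_unity_6_eis c3.unit6 \<open>u ^ 3 = 1\<close> by blast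
  ultimately have "\<theta> * z \<in> eis" using eis_add[OF eis_mult[of u "\<theta> * w"] eis_mult[of \<theta> b]] w by simp
  then show "ord3 z = 3" by (simp add: ord3_def)
qed

lemma p3_eq_eis: "z \<in> eis \<Longrightarrow> p3 w = p3 z \<Longrightarrow> w \<in> eis"
proof -
  assume "z \<in> eis" "p3 w = p3 z"
  then obtain u b where u: "u ^ 3 = 1" and b: "b \<in> eis" and w: "w = u * z + b" using p3_eq_iff[of z w] by auto
  show ?thesis using u b w \<open>z \<in> eis\<close> root_unity_6_eis[OF c3.unit6[OF u]] by blast
qed

text \<open>Identifying 1 / \<theta> with its negative would make \<open>\<theta>\<close> divide 1 +
  u for a cube root of unity u; but u is congruent to 1, so 1 + u is congruent to 2.\<close>

lemma K3_distinct: "p3 0 \<noteq> p3 (1 / \<theta>)" "p3 0 \<noteq> p3 (- 1 / \<theta>)" "p3 (1 / \<theta>) \<noteq> p3 (- 1 / \<theta>)"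
proof -
  show "p3 0 \<noteq> p3 (1 / \<theta>)" "p3 0 \<noteq> p3 (- 1 / \<theta>)"
    using p3_eq_eis[of 0 "1 / \<theta>"] p3_eq_eis[of 0 "- 1 / \<theta>"] inverse_theta_notin by auto
  show "p3 (1 / \<theta>) \<noteq> p3 (- 1 / \<theta>)"
  proof
    assume "p3 (1 / \<theta>) = p3 (- 1 / \<theta>)"
    then obtain u b where u: "u ^ 3 = 1" and b: "b \<in> eis" and eq: "- 1 / \<theta> = u * (1 / \<theta>) + b" unfolding p3_eq_iff by blast
    have "- b = (1 + u) / \<theta>" using eq by (simp add: field_simps eq_neg_iff_add_eq_0)
    then have "(1 + u) / \<theta> \<in> eis" using b by (metis eis_minus)
    moreover have "u = 1 \<or> u = \<omega> \<or> u = - 1 - \<omega>"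
      using c3.unit6[OF u] u unfolding root_unity_6 insert_iff empty_iff by (elim disjE) (auto simp: unit_powers)
    ultimately show False
      using theta_dvd_iff[of 2 0] theta_dvd_iff[of 1 1] theta_dvd_iff[of 0 "-1"] by (elim disjE) simp_all
  qed
qed

context affine_cover
begin

text \<open>The local degree over \<open>p6 w\<close> is \<open>ord6 w\<close>, divided by 3 at the
  points of \<open>K3\<close>. If 3 does not divide \<open>ord6 w\<close>, then \<open>div\<close>
  truncates, but by \<open>ord3_dvd\<close> no point of \<open>K3\<close> lies over
  \<open>p6 w\<close>.\<close>

lemma local_degrees_over_F:
  assumes d: "real d = 2 * (cmod m)\<^sup>2"
  shows "\<exists>q. local_degrees_over sphtop sphtop F (p6 w) = replicate_mset q (ord6 w)
      + replicate_mset (card {x\<in>K3. F x = p6 w}) (ord6 w div 3)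
    \<and> q * ord6 w + card {x\<in>K3. F x = p6 w} * (ord6 w div 3) = d"
proof -
  let ?ld = "local_degree sphtop sphtop F"
  define B where "B = fibre sphtop F (p6 w)"
  have fin: "finite B" unfolding B_def by (rule F_fibre_sum)
  have K: "K3 \<subseteq> sph" using c3.p_in_sph by (auto simp: K3_def)
  then have BK: "B \<inter> K3 = {x\<in>K3. F x = p6 w}" by (auto simp: B_def fibre_def)
  have ld: "?ld x = (if x \<in> K3 then ord6 w div 3 else ord6 w)" if "x \<in> B" for x
  proof -
    from that[unfolded B_def] obtain z where z: "x = p3 z" "p6 (m * z + c) = p6 w" by (rule fibre_F_E)
    have "?ld x = ord6 w div ord3 z" unfolding z(1) local_degree_F e_def using ord6_orbit[OF z(2)] by simp
    moreover have "ord3 z = 1 \<or> ord3 z = 3" by (simp add: ord3_def)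
    ultimately show ?thesis using ord3_iff_K3[of z] z(1) by auto
  qed
  have split: "B = (B - K3) \<union> (B \<inter> K3)" "(B - K3) \<inter> (B \<inter> K3) = {}" by auto
  have 1: "image_mset ?ld (mset_set (B - K3)) = replicate_mset (card (B - K3)) (ord6 w)"
  proof -
    have "image_mset ?ld (mset_set (B - K3)) = image_mset (\<lambda>_. ord6 w) (mset_set (B - K3))"
      using ld fin by (intro image_mset_cong) auto
    then show ?thesis by (simp add: image_mset_const_eq)
  qed
  have 2: "image_mset ?ld (mset_set (B \<inter> K3)) = replicate_mset (card (B \<inter> K3)) (ord6 w div 3)"
  proof -
    have "image_mset ?ld (mset_set (B \<inter> K3)) = image_mset (\<lambda>_. ord6 w div 3) (mset_set (B \<inter> K3))"
      using ld fin by (intro image_mset_cong) auto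
    then show ?thesis by (simp add: image_mset_const_eq)
  qed
  have "mset_set B = mset_set (B - K3) + mset_set (B \<inter> K3)"
    using mset_set_Union[of "B - K3" "B \<inter> K3"] fin split by simp
  then have eq: "local_degrees_over sphtop sphtop F (p6 w) = replicate_mset (card (B - K3)) (ord6 w) + replicate_mset (card (B \<inter> K3)) (ord6 w div 3)"
    by (simp add: local_degrees_over_def B_def[symmetric] 1 2)
  have "real (\<Sum>x\<in>B. ?ld x) = real d" unfolding d B_def by (rule F_fibre_sum)
  then have "(\<Sum>x\<in>B. ?ld x) = d" by (simp only: of_nat_eq_iff)
  moreover have "(\<Sum>x\<in>B. ?ld x) = sum_mset (local_degrees_over sphtop sphtop F (p6 w))"
    by (simp add: local_degrees_over_def B_def[symmetric] sum_unfold_sum_mset)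
  ultimately have "card (B - K3) * ord6 w + card (B \<inter> K3) * (ord6 w div 3) = d"
    by (simp add: eq)
  then show ?thesis using eq BK by (intro exI[of _ "card (B - K3)"]) simp
qed

lemma F_has_degree:
  assumes d: "real d = 2 * (cmod m)\<^sup>2"
  shows "has_degree sphtop sphtop F d"
  unfolding has_degree_def
proof
  fix y assume y: "y \<in> topspace sphtop - branching_points sphtop sphtop F"
  then have "y \<in> range p6" using range_p6 by simp
  then obtain w where w: "y = p6 w" by blast
  have "local_degree sphtop sphtop F x = 1" if "x \<in> fibre sphtop F y" for x
  proof -
    from that obtain z where "x = p3 z" by (rule fibre_F_E)
    then have "local_degree sphtop sphtop F x \<ge> 1" using local_degree_F e_pos by simp
    moreover have "\<not> local_degree sphtop sphtop F x > 1" using y that unfolding branching_points_def by blast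
    ultimately show ?thesis by simp
  qed
  then have "(\<Sum>x\<in>fibre sphtop F y. local_degree sphtop sphtop F x) = card (fibre sphtop F y)" by simp
  then have "real (card (fibre sphtop F y)) = real d" using F_fibre_sum(2)[of w] d unfolding w by (metis of_nat_sum)
  then show "finite (fibre sphtop F y) \<and> card (fibre sphtop F y) = d" using F_fibre_sum(1)[of w] w by simp
qed

text \<open>No cone point of the source lies over the value of order 2, as 3 does not divide 2. So
  the three partitions depend only on how many lie over the other two values. Positive
  \<open>q2\<close>, \<open>q3\<close> and \<open>q6\<close> make all three values branching
  points.\<close>

lemma F_realizes:
  assumes d: "real d = 2 * (cmod m)\<^sup>2"
    and 2: "2 * q2 = d" "q2 > 0"
    and 3: "card {x\<in>K3. F x = p6 (1 / \<theta>)} = j3" "3 * q3 + j3 = d" "q3 > 0"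
    and 6: "card {x\<in>K3. F x = p6 0} = j6" "6 * q6 + 2 * j6 = d" "q6 > 0"
  shows "realizable sphtop sphtop d {# replicate_mset q2 2, replicate_mset q3 3 + replicate_mset j3 1, replicate_mset q6 6 + replicate_mset j6 2 #}"
proof -
  let ?b = "branching_points sphtop sphtop F" and ?l = "local_degrees_over sphtop sphtop F"
  have no2: "{x\<in>K3. F x = p6 (1 / 2)} = {}"
  proof -
    have "F x \<noteq> p6 (1 / 2)" if "x \<in> K3" for x
    proof
      assume "F x = p6 (1 / 2)"
      from that obtain z where z: "x = p3 z" by (auto simp: K3_def)
      then have "ord3 z = 3" using that ord3_iff_K3 by simp
      moreover have "ord6 (m * z + c) = 2" using \<open>F x = p6 (1 / 2)\<close> ord6_orbit[of "m * z + c" "1 / 2"] ord6_special by (simp add: z F_p3)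
      ultimately show False using ord3_dvd[of z] by simp
    qed
    then show ?thesis by blast
  qed
  obtain r where "?l (p6 (1 / 2)) = replicate_mset r 2" "r * 2 = d"
    using local_degrees_over_F[OF d, of "1 / 2"] unfolding ord6_special no2 by auto
  then have l2: "?l (p6 (1 / 2)) = replicate_mset q2 2" using 2 by (metis mult.commute mult_cancel1 zero_neq_numeral)
  obtain r where "?l (p6 (1 / \<theta>)) = replicate_mset r 3 + replicate_mset j3 1" "r * 3 + j3 = d"
    using local_degrees_over_F[OF d, of "1 / \<theta>"] unfolding ord6_special 3 by auto
  moreover from this have "r = q3" using 3 by simp
  ultimately have l3: "?l (p6 (1 / \<theta>)) = replicate_mset q3 3 + replicate_mset j3 1" by simp
  obtain r where "?l (p6 0) = replicate_mset r 6 + replicate_mset j6 2" "r * 6 + j6 * 2 = d"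
    using local_degrees_over_F[OF d, of 0] unfolding ord6_special 6 by auto
  moreover from this have "r = q6" using 6 by simp
  ultimately have l6: "?l (p6 0) = replicate_mset q6 6 + replicate_mset j6 2" by simp
  have branch: "p6 w \<in> ?b \<longleftrightarrow> (\<exists>x\<in>#?l (p6 w). x > 1)" for w
    using F_fibre_sum(1)[of w] c6.p_in_sph by (simp add: branching_points_def local_degrees_over_def)
  have distinct: "p6 (1 / 2) \<noteq> p6 (1 / \<theta>)" "p6 (1 / 2) \<noteq> p6 0" "p6 (1 / \<theta>) \<noteq> p6 0"
    using ord6_orbit ord6_special by (metis numeral_eq_iff semiring_norm)+
  have b: "?b = {p6 (1 / 2), p6 (1 / \<theta>), p6 0}"
  proof
    show "{p6 (1 / 2), p6 (1 / \<theta>), p6 0} \<subseteq> ?b"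
      using 2(2) 3(3) 6(3) by (simp add: branch l2 l3 l6)
    show "?b \<subseteq> {p6 (1 / 2), p6 (1 / \<theta>), p6 0}"
    proof
      fix y assume y: "y \<in> ?b"
      then have "y \<in> range p6" using range_p6 by (auto simp: branching_points_def)
      then obtain w where w: "y = p6 w" by blast
      obtain x where "x \<in># ?l (p6 w)" "x > 1" using y branch w by blast
      then have "ord6 w > 1" using local_degrees_over_F[OF d, of w] by (auto split: if_splits)
      then have "ord6 w = 6 \<or> ord6 w = 3 \<or> ord6 w = 2" by (auto simp: ord6_def split: if_splits)
      then show "y \<in> {p6 (1 / 2), p6 (1 / \<theta>), p6 0}" using ord6_6 ord6_3 ord6_2 w by blast
    qed
  qed
  have "image_mset ?l (mset_set ?b) = {# ?l (p6 (1 / 2)), ?l (p6 (1 / \<theta>)), ?l (p6 0) #}"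
    unfolding b using distinct by (simp add: add_mset_commute)
  then show ?thesis unfolding realizable_def
    using F_branched_cover F_has_degree[OF d] distinct b l2 l3 l6 by (intro exI[of _ F]) auto
qed

end

text \<open>\<open>\<theta> z\<close> is integral at the three cone points, so the linear part
  \<theta> l sends them to lattice points and \<open>c\<close> alone decides their common value: the
  one of order 3 for c = 1 / \<theta>, the one of order 6 for c = 0. The second conclusion is the
  last family with k lowered by one.\<close>

lemma realizable_case_1:
  assumes k: "k \<ge> 1" and xy: "6 * k = 6 * (x\<^sup>2 + 3 * x * y + 3 * y\<^sup>2)"
  shows "realizable sphtop sphtop (6 * k)
    {# replicate_mset (3 * k) 2, replicate_mset (2 * k - 1) 3 + {#1, 1, 1#}, replicate_mset k 6 #}"
    and "k \<ge> 2 \<Longrightarrow> realizable sphtop sphtop (6 * k)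
    {# replicate_mset (3 * k) 2, replicate_mset (2 * k) 3, replicate_mset (k - 1) 6 + {#2, 2, 2#} #}"
proof -
  \<comment> \<open>x^2 + 3 x y + 3 y^2 is the form i^2 + i j + j^2 at i = x + y and j = y.\<close>
  define l where "l = of_nat (x + y) - of_nat y * \<omega>"
  have l: "l \<in> eis" "(cmod l)\<^sup>2 = real k"
  proof -
    show "l \<in> eis" unfolding l_def by (rule eis_with_norm)
    have "k = (x + y)\<^sup>2 + (x + y) * y + y\<^sup>2" using xy by (simp add: power2_eq_square algebra_simps)
    then show "(cmod l)\<^sup>2 = real k" unfolding l_def using eis_with_norm(2)[of "x + y" y] by simp
  qed
  then have l0: "l \<noteq> 0" using k by auto
  have tl: "\<theta> * l \<in> eis" "\<theta> * l \<noteq> 0" "real (6 * k) = 2 * (cmod (\<theta> * l))\<^sup>2"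
    using l l0 norm_theta_square by (auto simp: norm_mult power_mult_distrib)
  have cK: "card K3 = 3" using K3_distinct by (simp add: K3_def)
  have tz: "\<theta> * z \<in> eis \<and> \<theta> * l * z \<in> eis" if "p3 z \<in> K3" for z
  proof -
    have "\<theta> * z \<in> eis" using that ord3_iff_K3[of z] by (simp add: ord3_def split: if_splits)
    moreover have "\<theta> * l * z = l * (\<theta> * z)" by simp
    ultimately show ?thesis using l(1) by (metis eis_mult)
  qed
  {
    interpret affine_cover "\<theta> * l" "1 / \<theta>"
      by unfold_locales (use tl in auto)
    have F: "F x = p6 (1 / \<theta>)" if "x \<in> K3" for x
    proof -
      from that obtain z where z: "x = p3 z" by (auto simp: K3_def)
      have "\<theta> * l * z \<in> eis" using tz that z by simp
      then have "p6 (1 / \<theta>) = p6 (\<theta> * l * z + 1 / \<theta>)" unfolding p6_eq_iff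
        by (intro exI[of _ 1] exI[of _ "\<theta> * l * z"]) simp
      then show ?thesis by (simp add: z F_p3)
    qed
    have "p6 (1 / \<theta>) \<noteq> p6 0" using ord6_orbit[of "1 / \<theta>" 0] ord6_special by auto
    then have "{x\<in>K3. F x = p6 (1 / \<theta>)} = K3" "{x\<in>K3. F x = p6 0} = {}" using F by auto
    then have j: "card {x\<in>K3. F x = p6 (1 / \<theta>)} = 3" "card {x\<in>K3. F x = p6 0} = 0" using cK by (simp_all only: card.empty)
    then have "realizable sphtop sphtop (6 * k) {# replicate_mset (3 * k) 2, replicate_mset (2 * k - 1) 3 + replicate_mset 3 1, replicate_mset k 6 + replicate_mset 0 2 #}"
      using k by (intro F_realizes tl(3) j) auto
    then show "realizable sphtop sphtop (6 * k)
      {# replicate_mset (3 * k) 2, replicate_mset (2 * k - 1) 3 + {#1, 1, 1#}, replicate_mset k 6 #}"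
      by (simp add: numeral_3_eq_3)
  }
  assume k2: "k \<ge> 2"
  {
    interpret affine_cover "\<theta> * l" 0
      by unfold_locales (use tl in auto)
    have F: "F x = p6 0" if "x \<in> K3" for x
    proof -
      from that obtain z where z: "x = p3 z" by (auto simp: K3_def)
      have "\<theta> * l * z \<in> eis" using tz that z by simp
      then have "p6 0 = p6 (\<theta> * l * z + 0)" unfolding p6_eq_iff
        by (intro exI[of _ 1] exI[of _ "\<theta> * l * z"]) simp
      then show ?thesis by (simp add: z F_p3)
    qed
    have "p6 (1 / \<theta>) \<noteq> p6 0" using ord6_orbit[of "1 / \<theta>" 0] ord6_special by auto
    then have "{x\<in>K3. F x = p6 0} = K3" "{x\<in>K3. F x = p6 (1 / \<theta>)} = {}" using F by auto
    then have j: "card {x\<in>K3. F x = p6 0} = 3" "card {x\<in>K3. F x = p6 (1 / \<theta>)} = 0" using cK by (simp_all only: card.empty)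
    then have "realizable sphtop sphtop (6 * k) {# replicate_mset (3 * k) 2, replicate_mset (2 * k) 3 + replicate_mset 0 1, replicate_mset (k - 1) 6 + replicate_mset 3 2 #}"
      using k2 by (intro F_realizes tl(3) j) auto
    then show "realizable sphtop sphtop (6 * k)
      {# replicate_mset (3 * k) 2, replicate_mset (2 * k) 3, replicate_mset (k - 1) 6 + {#2, 2, 2#} #}"
      by (simp add: numeral_3_eq_3)
  }
qed

text \<open>The norm 3 k + 1 is not divisible by 3, so \<open>\<theta>\<close> does not divide
  \<open>l\<close>. With c = 0 one cone point goes to the value of order 6 and the other two to the
  value of order 3.\<close>

lemma realizable_case_2:
  assumes k: "k \<ge> 1" and xy: "6 * k + 2 = 2 * (x\<^sup>2 + x * y + y\<^sup>2)"
  shows "realizable sphtop sphtop (6 * k + 2)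
    {# replicate_mset (3 * k + 1) 2, replicate_mset (2 * k) 3 + {#1, 1#}, replicate_mset k 6 + {#2#} #}"
proof -
  define l where "l = of_nat x - of_nat y * \<omega>"
  have l: "l \<in> eis" "(cmod l)\<^sup>2 = real (3 * k + 1)"
  proof -
    show "l \<in> eis" unfolding l_def by (rule eis_with_norm)
    have "3 * k + 1 = x\<^sup>2 + x * y + y\<^sup>2" using xy by simp
    then show "(cmod l)\<^sup>2 = real (3 * k + 1)" unfolding l_def using eis_with_norm(2)[of x y] by simp
  qed
  then have l0: "l \<noteq> 0" by auto
  have ndvd: "l / \<theta> \<notin> eis"
  proof
    assume "l / \<theta> \<in> eis"
    then obtain n where "(cmod (l / \<theta>))\<^sup>2 = of_int n" using norm_square_in_Ints by (meson Ints_cases)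
    then have "real (3 * k + 1) = 3 * of_int n" using l norm_theta_square by (simp add: norm_divide power_divide)
    then have "int (3 * k + 1) = 3 * n" by linarith
    then show False by presburger
  qed
  have d: "real (6 * k + 2) = 2 * (cmod l)\<^sup>2" using l by simp
  interpret affine_cover l 0
    by unfold_locales (use l l0 in auto)
  have F0: "F (p3 0) = p6 0" by (simp add: F_p3)
  have F1: "F (p3 (1 / \<theta>)) = p6 (1 / \<theta>)" "F (p3 (- 1 / \<theta>)) = p6 (1 / \<theta>)"
  proof -
    have "ord6 (l * (1 / \<theta>)) = 3" "ord6 (l * (- 1 / \<theta>)) = 3" using l ndvd by (simp_all add: ord6_def)
    then show "F (p3 (1 / \<theta>)) = p6 (1 / \<theta>)" "F (p3 (- 1 / \<theta>)) = p6 (1 / \<theta>)" using ord6_3 by (simp_all add: F_p3)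
  qed
  have "p6 (1 / \<theta>) \<noteq> p6 0" using ord6_orbit[of "1 / \<theta>" 0] ord6_special by auto
  then have "{x\<in>K3. F x = p6 0} = {p3 0}" "{x\<in>K3. F x = p6 (1 / \<theta>)} = {p3 (1 / \<theta>), p3 (- 1 / \<theta>)}"
    using F0 F1 K3_distinct by (auto simp: K3_def)
  then have "realizable sphtop sphtop (6 * k + 2) {# replicate_mset (3 * k + 1) 2, replicate_mset (2 * k) 3 + replicate_mset 2 1, replicate_mset k 6 + replicate_mset 1 2 #}"
    using k K3_distinct by (intro F_realizes d) auto
  then show ?thesis by (simp add: numeral_2_eq_2)
qed

section \<open>Lifting the quotient map through a branched cover\<close>

text \<open>Along z0 + exp t there is a logarithm \<open>L\<close> of \<open>h\<close> on a
  half-plane. By invariance a shift by 2 pi i / n changes \<open>L\<close> by a fixed multiple of 2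
  pi i, so a full turn adds a multiple of 2 pi i n, hence of 2 pi i k, and exp (L / k) descends to
  the punctured disc.\<close>

lemma continuous_root_of_invariant:
  fixes h :: "complex \<Rightarrow> complex" and n k :: nat
  assumes r: "r > 0" and h: "continuous_on (ball z0 r) h"
    and h0: "\<And>z. z \<in> ball z0 r \<Longrightarrow> h z = 0 \<longleftrightarrow> z = z0" and n: "n > 0" and k: "k dvd n"
    and inv: "\<And>z. z \<in> ball z0 r \<Longrightarrow> h (z0 + exp (2 * pi * \<i> / n) * (z - z0)) = h z"
  obtains \<eta> where "continuous_on (ball z0 r) \<eta>" "\<And>z. z \<in> ball z0 r \<Longrightarrow> \<eta> z ^ k = h z"
proof -
  have k0: "k > 0" using k n by (rule dvd_pos_nat[rotated])
  define H where "H = {t. Re t < ln r}"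
  have convH: "convex H" unfolding H_def by (rule convex_halfspace_Re_lt)
  have expH: "z0 + exp t \<in> ball z0 r" if "t \<in> H" for t
  proof -
    have "exp (Re t) < exp (ln r)" using that by (simp add: H_def)
    then show ?thesis using r by (simp add: dist_norm)
  qed
  have hexp: "continuous_on H (\<lambda>t. h (z0 + exp t))"
    by (rule continuous_on_compose2[OF h]) (use expH in \<open>auto intro!: continuous_intros\<close>)
  have hnz: "h (z0 + exp t) \<noteq> 0" if "t \<in> H" for t using h0[OF expH[OF that]] by simp
  obtain L where L: "continuous_on H L" "\<And>t. t \<in> H \<Longrightarrow> h (z0 + exp t) = exp (L t)"
  proof (rule continuous_logarithm_on_contractible[OF hexp convex_imp_contractible[OF convH] hnz], goal_cases)
    case (2 L)
    show ?case by (rule 2(1)[OF 2(2,3)])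
  qed
  define s where "s = 2 * pi * \<i> / n"
  have shift: "t + s * of_int N \<in> H" if "t \<in> H" for t N using that by (simp add: H_def s_def)
  define \<delta> where "\<delta> t = L (t + s) - L t" for t
  have exp\<delta>: "exp (\<delta> t) = 1" if "t \<in> H" for t
  proof -
    have ts: "t + s \<in> H" using shift[OF that, of 1] by simp
    have "exp (L (t + s)) = h (z0 + exp (t + s))" using L(2)[OF ts] by simp
    also have "\<dots> = h (z0 + exp s * (z0 + exp t - z0))" by (simp add: exp_add mult.commute)
    also have "\<dots> = h (z0 + exp t)" using inv[OF expH[OF that]] unfolding s_def .
    also have "\<dots> = exp (L t)" using L(2)[OF that] .
    finally show ?thesis by (simp add: \<delta>_def exp_diff)
  qed
  have \<delta>int: "\<exists>q::int. \<delta> t = of_int q * (2 * pi) * \<i>" if "t \<in> H" for t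
    using exp\<delta>[OF that] unfolding exp_eq_1 by (auto simp: complex_eq_iff)
  have norm2pi: "norm (of_int m * (2 * pi) * \<i> :: complex) = \<bar>real_of_int m\<bar> * (2 * pi)" for m
    by (simp add: norm_mult)
  \<comment> \<open>The increment is continuous on a connected set with values in the discrete set
    of multiples of 2 pi i.\<close>
  have "\<delta> constant_on H"
  proof (rule continuous_discrete_range_constant[OF convex_connected[OF convH]])
    show "continuous_on H \<delta>" unfolding \<delta>_def
      by (intro continuous_intros L(1) continuous_on_compose2[OF L(1)]) (use shift[of _ 1] in auto)
    fix t assume t: "t \<in> H"
    show "\<exists>e>0. \<forall>y. y \<in> H \<and> \<delta> y \<noteq> \<delta> t \<longrightarrow> e \<le> norm (\<delta> y - \<delta> t)"
    proof (intro exI[of _ 1] conjI allI impI)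
      fix y assume y: "y \<in> H \<and> \<delta> y \<noteq> \<delta> t"
      obtain q q' :: int where q: "\<delta> y = of_int q * (2 * pi) * \<i>" "\<delta> t = of_int q' * (2 * pi) * \<i>" using \<delta>int y t by meson
      then have "\<delta> y - \<delta> t = of_int (q - q') * (2 * pi) * \<i>" by (simp add: algebra_simps)
      then have "norm (\<delta> y - \<delta> t) = \<bar>real_of_int (q - q')\<bar> * (2 * pi)"
        using norm2pi[of "q - q'"] by (simp only:)
      moreover have "1 \<le> \<bar>real_of_int (q - q')\<bar>" using y q by auto
      moreover have "1 \<le> 2 * pi" using pi_ge_two by simp
      ultimately show "1 \<le> norm (\<delta> y - \<delta> t)" using mult_mono[of 1 "\<bar>real_of_int (q - q')\<bar>" 1 "2 * pi"] by simp
    qed simp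
  qed
  then obtain c where c: "\<And>t. t \<in> H \<Longrightarrow> \<delta> t = c" unfolding constant_on_def by blast
  have "of_real (ln r - 1) \<in> H" by (simp add: H_def)
  then obtain q :: int where q: "c = of_int q * (2 * pi) * \<i>" using \<delta>int c by metis
  have nat_shift: "L (t + s * of_nat N) = L t + of_nat N * c" if "t \<in> H" for t N
  proof (induction N)
    case (Suc N)
    have "t + s * of_nat N \<in> H" using shift[OF that, of "int N"] by simp
    from c[OF this] have "L (t + s * of_nat N + s) = L (t + s * of_nat N) + c" by (simp add: \<delta>_def algebra_simps)
    then show ?case using Suc by (simp add: algebra_simps)
  qed simp
  obtain l where l: "n = k * l" using k by (elim dvdE)
  define M where "M t = exp (L t / of_nat k)" for t
  have M_nat: "M (t + 2 * pi * \<i> * of_nat N) = M t" if "t \<in> H" for t N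
  proof -
    have "t + 2 * pi * \<i> * of_nat N = t + s * of_nat (n * N)" using n by (simp add: s_def)
    then have "L (t + 2 * pi * \<i> * of_nat N) = L t + of_nat (n * N) * c" by (simp only: nat_shift[OF that])
    also have "\<dots> / of_nat k = L t / of_nat k + of_int (2 * (int (l * N) * q)) * pi * \<i>"
      using k0 by (simp add: l q field_simps)
    finally show ?thesis unfolding M_def using exp_integer_2pi[of "of_int (int (l * N) * q)"]
      by (simp add: exp_add algebra_simps)
  qed
  have M_eq: "M t = M t'" if H: "t \<in> H" "t' \<in> H" and e: "exp t = exp t'" for t t'
  proof -
    obtain N :: int where N: "t = t' + (of_int (2 * N) * pi) * \<i>" using e exp_eq by blast
    show ?thesis
    proof (cases "N \<ge> 0")
      case True
      then have "t = t' + 2 * pi * \<i> * of_nat (nat N)" using N by (simp add: algebra_simps)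
      then show ?thesis using M_nat H by metis
    next
      case False
      then have "t' = t + 2 * pi * \<i> * of_nat (nat (- N))" using N by (simp add: algebra_simps)
      then show ?thesis using M_nat H by metis
    qed
  qed
  have LnH: "Ln (z - z0) \<in> H" if "z \<in> ball z0 r" "z \<noteq> z0" for z
  proof -
    have "cmod (z - z0) < r" using that by (simp add: dist_norm norm_minus_commute)
    then show ?thesis using that r by (simp add: H_def)
  qed
  define \<eta> where "\<eta> z = (if z = z0 then 0 else M (Ln (z - z0)))" for z
  have pow: "\<eta> z ^ k = h z" if "z \<in> ball z0 r" for z
  proof (cases "z = z0")
    case True
    then show ?thesis using h0[OF that] k0 by (simp add: \<eta>_def power_0_left)
  next
    case False
    have "\<eta> z ^ k = exp (L (Ln (z - z0)))"
      using False k0 by (simp add: \<eta>_def M_def exp_of_nat_mult[symmetric])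
    also have "\<dots> = h z" using L(2)[OF LnH[OF that False]] False by simp
    finally show ?thesis .
  qed
  have contM: "continuous_on H M" unfolding M_def using k0 by (intro continuous_intros L(1)) auto
  have "isCont \<eta> z1" if z1: "z1 \<in> ball z0 r" for z1
  proof (cases "z1 = z0")
    case True
    have "isCont h z0" using h z1 True continuous_on_eq_continuous_at open_ball by blast
    moreover have "h z0 = 0" using h0[of z0] r by simp
    ultimately have lim: "(h \<longlongrightarrow> 0) (at z0)" by (simp add: isCont_def)
    have "(\<eta> \<longlongrightarrow> 0) (at z0)"
    proof (rule tendstoI)
      fix e :: real assume e: "e > 0"
      have "\<forall>\<^sub>F z in at z0. dist (h z) 0 < e ^ k" using tendstoD[OF lim] e by simp
      moreover have "\<forall>\<^sub>F z in at z0. z \<in> ball z0 r" using r by (intro eventually_at_in_open') auto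
      ultimately show "\<forall>\<^sub>F z in at z0. dist (\<eta> z) 0 < e"
      proof eventually_elim
        case (elim z)
        then have "cmod (\<eta> z) ^ k < e ^ k" using pow[of z] by (simp add: norm_power[symmetric])
        then show ?case using e by (simp add: power_less_imp_less_base)
      qed
    qed
    then show ?thesis using True by (simp add: isCont_def \<eta>_def)
  next
    case False
    define a where "a = z1 - z0"
    have a: "a \<noteq> 0" using False by (simp add: a_def)
    define O' where "O' = ball z1 (cmod a) \<inter> ball z0 r"
    \<comment> \<open>A logarithm of z - z0 that is continuous near \<open>z1\<close>. The principal
      branch may jump there, but \<open>M\<close> takes the same value on all logarithms.\<close>
    define t where "t z = Ln ((z - z0) / a) + Ln a" for z
    have O': "open O'" "z1 \<in> O'" using z1 a by (auto simp: O'_def)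
    have nz: "(z - z0) / a \<notin> \<real>\<^sub>\<le>\<^sub>0 \<and> z \<noteq> z0" if "z \<in> O'" for z
    proof -
      have "cmod ((z - z0) / a - 1) = cmod (z - z1) / cmod a"
        using a by (simp add: norm_divide[symmetric] a_def field_simps)
      also have "\<dots> < 1" using that a by (simp add: O'_def dist_norm norm_minus_commute)
      finally have *: "cmod ((z - z0) / a - 1) < 1" .
      have "Re ((z - z0) / a) > 0" using abs_Re_le_cmod[of "(z - z0) / a - 1"] * by simp
      then show ?thesis by (auto simp: complex_nonpos_Reals_iff)
    qed
    have expt: "exp (t z) = z - z0" if "z \<in> O'" for z
      using nz[OF that] a by (simp add: t_def exp_add)
    have tH: "t z \<in> H" if "z \<in> O'" for z
    proof -
      have "exp (Re (t z)) = cmod (z - z0)" using expt[OF that] by (metis norm_exp_eq_Re)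
      also have "\<dots> < exp (ln r)" using that r by (simp add: O'_def dist_norm norm_minus_commute)
      finally show ?thesis by (simp add: H_def)
    qed
    have "continuous_on O' (\<lambda>z. M (t z))"
    proof (rule continuous_on_compose2[OF contM])
      show "continuous_on O' t" unfolding t_def using nz a by (intro continuous_intros) auto
    qed (use tH in auto)
    moreover have "M (t z) = \<eta> z" if "z \<in> O'" for z
    proof -
      have "M (t z) = M (Ln (z - z0))"
        using expt[OF that] nz[OF that] tH[OF that] LnH[of z] that by (intro M_eq) (auto simp: O'_def)
      then show ?thesis using nz[OF that] by (simp add: \<eta>_def)
    qed
    ultimately have "continuous_on O' \<eta>" using continuous_on_cong by (metis (no_types, lifting))
    then show ?thesis using O' continuous_on_eq_continuous_at by blast
  qed
  then have "continuous_on (ball z0 r) \<eta>" by (simp add: continuous_at_imp_continuous_on)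
  then show thesis using pow that by blast
qed

text \<open>On a circle about 0 the quotient of \<open>\<rho>\<close> by exp (i t / k) takes
  finitely many values and so is constant; after one turn this would give exp (2 pi i / k) =
  1.\<close>

lemma no_continuous_root:
  fixes \<rho> :: "complex \<Rightarrow> complex"
  assumes e: "e > 0" and k: "k \<ge> 2" and cont: "continuous_on (ball 0 e) \<rho>" and root: "\<And>z. z \<in> ball 0 e \<Longrightarrow> \<rho> z ^ k = z"
  shows False
proof -
  define c where "c t = of_real (e / 2) * exp (\<i> * of_real t)" for t
  define q where "q t = \<rho> (c t) / exp (\<i> * of_real t / of_nat k)" for t
  have c: "c t \<in> ball 0 e" for t using e by (simp add: c_def norm_mult)
  have qk: "q t ^ k = of_real (e / 2)" for t
    using root[OF c[of t]] k by (simp add: q_def power_divide exp_of_nat_mult[symmetric] c_def)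
  have "q constant_on UNIV"
  proof (rule continuous_finite_range_constant)
    show "continuous_on UNIV q" unfolding q_def
      by (intro continuous_intros continuous_on_compose2[OF cont]) (use k c in \<open>auto simp: c_def intro!: continuous_intros\<close>)
    have "range q \<subseteq> {z. z ^ k = of_real (e / 2)}" using qk by blast
    moreover have "finite {z::complex. z ^ k = of_real (e / 2)}" using k by (intro finite_nth_roots) simp
    ultimately show "finite (range q)" using finite_subset by blast
  qed simp
  then have "q 0 = q (2 * pi)" unfolding constant_on_def by (metis UNIV_I)
  moreover have "c (2 * pi) = c 0" unfolding c_def using exp_two_pi_i by (simp add: mult_ac)
  moreover have "q 0 \<noteq> 0" using qk[of 0] e k by (auto simp: power_0_left)
  ultimately have "exp (\<i> * of_real (2 * pi) / of_nat k) = 1" by (simp add: q_def field_simps)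
  then have "exp (2 * of_real pi * \<i> * of_nat 1 / of_nat k) = 1" by (simp add: mult_ac)
  then have "k dvd 1" using complex_root_unity_eq_1[of k 1] k by simp
  then show False using k by simp
qed

section \<open>Generic points of the plane\<close>

lemma countable_eis: "countable eis"
proof -
  have "eis = (\<lambda>(a, b). of_int a + of_int b * \<omega>) ` (UNIV :: (int \<times> int) set)" by (auto simp: eis_def)
  then show ?thesis by (metis countable_image countableI_type)
qed

text \<open>\<open>\<theta>\<close> and 2 both divide 6, so every cone point becomes a lattice point
  when multiplied by 6.\<close>

lemma countable_cone: "countable {z. ord6 z \<noteq> 1}"
proof -
  have "{z. ord6 z \<noteq> 1} \<subseteq> (\<lambda>q. q / 6) ` eis"
  proof
    fix z assume "z \<in> {z. ord6 z \<noteq> 1}"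
    then consider "z \<in> eis" | "\<theta> * z \<in> eis" | "2 * z \<in> eis" by (auto simp: ord6_def split: if_splits)
    then have "6 * z \<in> eis"
    proof cases
      case 1
      then show ?thesis by (rule eis_mult[OF eis_numeral])
    next
      case 2
      have "6 * z = 2 * (\<theta> * (2 + \<omega>)) * z" unfolding theta_mult_cnj by simp
      also have "\<dots> = 2 * ((2 + \<omega>) * (\<theta> * z))" by (simp add: algebra_simps)
      finally have "6 * z = 2 * ((2 + \<omega>) * (\<theta> * z))" .
      moreover have "2 + \<omega> \<in> eis" by (intro eis_add) auto
      ultimately show ?thesis using 2 by (metis eis_mult eis_numeral)
    next
      case 3
      have "6 * z = 3 * (2 * z)" by simp
      then show ?thesis using 3 by (metis eis_mult eis_numeral)
    qed
    then show "z \<in> (\<lambda>q. q / 6) ` eis" by (intro image_eqI[of _ _ "6 * z"]) auto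
  qed
  then show ?thesis by (rule countable_subset) (intro countable_image countable_eis)
qed

lemma generic_point: assumes "open D" "D \<noteq> {}" obtains z where "z \<in> D" "ord6 z = 1"
proof -
  have "\<not> D \<subseteq> {z. ord6 z \<noteq> 1}"
  proof
    assume "D \<subseteq> {z. ord6 z \<noteq> 1}"
    then have "countable D" using countable_cone countable_subset by blast
    moreover obtain z e where "e > 0" "ball z e \<subseteq> D" using assms openE by blast
    ultimately show False using uncountable_ball countable_subset by blast
  qed
  then show thesis using that by blast
qed

lemma p6_near:
  assumes "openin sphtop V" "p6 z0 \<in> V"
  obtains r where "r > 0" "p6 ` ball z0 r \<subseteq> V"
proof -
  obtain T where T: "open T" "V = sph \<inter> T" using assms(1) by (auto simp: openin_open)
  have "open (p6 -` T)" using continuous_p6 T(1) by (simp add: open_vimage)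
  moreover have "z0 \<in> p6 -` T" using assms(2) T(2) by auto
  ultimately obtain r where "r > 0" "ball z0 r \<subseteq> p6 -` T" using openE by blast
  moreover from this have "p6 ` ball z0 r \<subseteq> V" unfolding T(2) using c6.p_in_sph by blast
  ultimately show thesis using that by blast
qed

lemma homeomorphism_of_maps:
  assumes "homeomorphic_maps (top_of_set U) (top_of_set A) \<phi> \<psi>" shows "homeomorphism U A \<phi> \<psi>"
proof -
  have c: "continuous_on U \<phi>" "\<phi> ` U \<subseteq> A" "continuous_on A \<psi>" "\<psi> ` A \<subseteq> U"
    and inv: "\<And>x. x \<in> U \<Longrightarrow> \<psi> (\<phi> x) = x" "\<And>y. y \<in> A \<Longrightarrow> \<phi> (\<psi> y) = y"
    using assms unfolding homeomorphic_maps_def continuous_map_in_subtopology by auto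
  then show ?thesis by (intro homeomorphismI) auto
qed

lemma p6_cone_points: "ord6 w \<noteq> 1 \<Longrightarrow> p6 w \<in> {p6 0, p6 (1 / \<theta>), p6 (1 / 2)}"
  using ord6_6[of w] ord6_3[of w] ord6_2[of w] by (auto simp: ord6_def split: if_splits)

lemma open_generic: "open {z. ord6 z = 1}"
proof -
  have "{z. ord6 z = 1} = p6 -` (- {p6 0, p6 (1 / \<theta>), p6 (1 / 2)})"
  proof (rule subset_antisym; rule subsetI)
    fix z assume z: "z \<in> {z. ord6 z = 1}"
    show "z \<in> p6 -` (- {p6 0, p6 (1 / \<theta>), p6 (1 / 2)})"
    proof (rule ccontr)
      assume "z \<notin> p6 -` (- {p6 0, p6 (1 / \<theta>), p6 (1 / 2)})"
      then consider "p6 z = p6 0" | "p6 z = p6 (1 / \<theta>)" | "p6 z = p6 (1 / 2)" by auto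
      then show False using ord6_orbit[of z] ord6_special z by cases fastforce+
    qed
  next
    fix z assume "z \<in> p6 -` (- {p6 0, p6 (1 / \<theta>), p6 (1 / 2)})"
    then show "z \<in> {z. ord6 z = 1}" using p6_cone_points[of z] by blast
  qed
  moreover have "open (- {p6 0, p6 (1 / \<theta>), p6 (1 / 2)})" by (intro open_Compl finite_imp_closed) auto
  ultimately show ?thesis using continuous_p6 by (simp only: open_vimage)
qed

text \<open>\<open>f\<close> branches at most as much as \<open>p6\<close>, in the sense of
  divisibility of the orders, which is what lifting needs locally. Finite fibres yield a common
  radius for the local lifts at all preimages.\<close>

locale lift_problem =
  fixes f :: "complex \<times> real \<Rightarrow> complex \<times> real"
  assumes cont_f: "continuous_on sph f" and f_sph: "f ` sph \<subseteq> sph"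
    and deg_f: "\<And>x z. x \<in> sph \<Longrightarrow> f x = p6 z \<Longrightarrow> \<exists>k. has_local_degree sphtop sphtop f x k \<and> k dvd ord6 z"
    and fin_f: "\<And>y. y \<in> sph \<Longrightarrow> finite {x\<in>sph. f x = y}"
begin

definition lift_on :: "complex set \<Rightarrow> (complex \<Rightarrow> complex \<times> real) \<Rightarrow> bool" where
  "lift_on D F \<longleftrightarrow> continuous_on D F \<and> F ` D \<subseteq> sph \<and> (\<forall>z\<in>D. f (F z) = p6 z)"

lemma lift_on_subset: "lift_on D F \<Longrightarrow> D' \<subseteq> D \<Longrightarrow> lift_on D' F"
  unfolding lift_on_def using continuous_on_subset by blast

lemma liftD: "lift_on D F \<Longrightarrow> z \<in> D \<Longrightarrow> F z \<in> sph" "lift_on D F \<Longrightarrow> z \<in> D \<Longrightarrow> f (F z) = p6 z"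
  unfolding lift_on_def by blast+

lemma chart_f:
  assumes "has_local_degree sphtop sphtop f x k"
  obtains U V A B \<phi> \<phi>' \<psi> \<psi>' where "openin sphtop U" "x \<in> U" "openin sphtop V" "f ` U \<subseteq> V" "open (A :: complex set)" "open (B :: complex set)"
    "homeomorphism U A \<phi> \<phi>'" "\<phi> x = 0" "continuous_on V \<psi>" "inj_on \<psi> V" "\<psi> ` V = B" "\<psi> (f x) = 0" "\<forall>u\<in>U. \<psi> (f u) = \<phi> u ^ k" "k \<ge> 1" "homeomorphism V B \<psi> \<psi>'"
proof -
  obtain U V A B \<phi> \<psi> where c: "openin sphtop U" "x \<in> U" "openin sphtop V" "f ` U \<subseteq> V" "open (A::complex set)" "open (B::complex set)"
    "homeomorphic_map (subtopology sphtop U) (top_of_set A) \<phi>" "\<phi> x = 0"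
    "homeomorphic_map (subtopology sphtop V) (top_of_set B) \<psi>" "\<psi> (f x) = 0" "\<forall>u\<in>U. \<psi> (f u) = \<phi> u ^ k" "k \<ge> 1"
    using assms unfolding has_local_degree_def by auto
  have US: "U \<subseteq> sph" "V \<subseteq> sph" using c(1,3) openin_imp_subset by blast+
  have top: "subtopology sphtop U = top_of_set U" "subtopology sphtop V = top_of_set V"
    using US by (simp_all add: subtopology_subtopology Int_absorb1)
  obtain \<phi>' where "homeomorphic_maps (top_of_set U) (top_of_set A) \<phi> \<phi>'"
    using c(7) unfolding top homeomorphic_map_maps by blast
  then have "homeomorphism U A \<phi> \<phi>'" by (rule homeomorphism_of_maps)
  moreover obtain \<psi>' where "homeomorphic_maps (top_of_set V) (top_of_set B) \<psi> \<psi>'"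
    using c(9) unfolding top homeomorphic_map_maps by blast
  then have hV: "homeomorphism V B \<psi> \<psi>'" by (rule homeomorphism_of_maps)
  then have "continuous_on V \<psi>" "inj_on \<psi> V" "\<psi> ` V = B"
    unfolding homeomorphism_def by (auto intro: inj_on_inverseI)
  ultimately show thesis using that[of U V A B \<phi> \<phi>' \<psi> \<psi>'] c hV by blast
qed

text \<open>In charts \<open>f\<close> is a k-th power, while \<open>p6\<close> vanishes only at
  \<open>z0\<close> and is invariant under a rotation whose order is a multiple of k, so it has a
  continuous k-th root. A root of unity adjusts the value at \<open>z1\<close>, which permits every
  starting point in \<open>W\<close>.\<close>

lemma local_lift_at:
  assumes x: "x \<in> sph" "f x = p6 z0"
  obtains W r0 where "openin sphtop W" "x \<in> W" "r0 > 0"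
    "\<And>r z1 x1. 0 < r \<Longrightarrow> r \<le> r0 \<Longrightarrow> z1 \<in> ball z0 r \<Longrightarrow> x1 \<in> W \<Longrightarrow> f x1 = p6 z1 \<Longrightarrow> \<exists>F. lift_on (ball z0 r) F \<and> F z1 = x1"
proof -
  obtain k where k: "has_local_degree sphtop sphtop f x k" "k dvd ord6 z0" using deg_f[OF x] by blast
  obtain U V A B \<phi> \<phi>' \<psi> \<psi>' where c: "openin sphtop U" "x \<in> U" "openin sphtop V" "f ` U \<subseteq> V" "open (A :: complex set)" "open (B :: complex set)"
    "homeomorphism U A \<phi> \<phi>'" "\<phi> x = 0" "continuous_on V \<psi>" "inj_on \<psi> V" "\<psi> ` V = B" "\<psi> (f x) = 0" "\<forall>u\<in>U. \<psi> (f u) = \<phi> u ^ k" "k \<ge> 1" "homeomorphism V B \<psi> \<psi>'"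
    using chart_f[OF k(1)] .
  have "0 \<in> A" using c(2,7,8) unfolding homeomorphism_def by force
  then obtain \<epsilon> where \<epsilon>: "\<epsilon> > 0" "ball 0 \<epsilon> \<subseteq> A" using c(5) openE by blast
  have fxV: "p6 z0 \<in> V" using c(2,4) x(2) by force
  have "openin sphtop {y\<in>V. \<psi> y \<in> ball 0 (\<epsilon> ^ k)}"
  proof -
    have "openin (top_of_set V) (V \<inter> \<psi> -` ball 0 (\<epsilon> ^ k))"
      using c(9) continuous_openin_preimage_gen open_ball by blast
    then have "openin sphtop (V \<inter> \<psi> -` ball 0 (\<epsilon> ^ k))" using c(3) openin_trans by blast
    moreover have "V \<inter> \<psi> -` ball 0 (\<epsilon> ^ k) = {y\<in>V. \<psi> y \<in> ball 0 (\<epsilon> ^ k)}" by blast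
    ultimately show ?thesis by simp
  qed
  moreover have "p6 z0 \<in> {y\<in>V. \<psi> y \<in> ball 0 (\<epsilon> ^ k)}" using fxV c(12) x(2) \<epsilon> by simp
  ultimately obtain r1 where r1: "r1 > 0" "p6 ` ball z0 r1 \<subseteq> {y\<in>V. \<psi> y \<in> ball 0 (\<epsilon> ^ k)}" by (rule p6_near)
  obtain r2 where r2: "r2 > 0" "\<And>z w. z \<in> ball z0 r2 \<Longrightarrow> w \<in> ball z0 r2 \<Longrightarrow>
    p6 z = p6 w \<longleftrightarrow> (z - z0) ^ ord6 z0 = (w - z0) ^ ord6 z0" using c6.local_form by blast
  show thesis
  proof (rule that[OF c(1,2)])
    show "min r1 r2 > 0" using r1 r2 by simp
    fix r z1 x1 assume r: "0 < r" "r \<le> min r1 r2" and z1: "z1 \<in> ball z0 r" and x1: "x1 \<in> U" "f x1 = p6 z1"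
    define h where "h z = \<psi> (p6 z)" for z
    have inV: "p6 z \<in> V" "cmod (h z) < \<epsilon> ^ k" if "z \<in> ball z0 r" for z
    proof -
      have "z \<in> ball z0 r1" using that r by simp
      then have "p6 z \<in> {y\<in>V. \<psi> y \<in> ball 0 (\<epsilon> ^ k)}" using r1(2) by blast
      then show "p6 z \<in> V" "cmod (h z) < \<epsilon> ^ k" by (auto simp: h_def)
    qed
    have form: "p6 z = p6 w \<longleftrightarrow> (z - z0) ^ ord6 z0 = (w - z0) ^ ord6 z0" if "z \<in> ball z0 r" "w \<in> ball z0 r" for z w
      using r2(2)[of z w] that r by simp
    have cont_h: "continuous_on (ball z0 r) h" unfolding h_def
      by (rule continuous_on_compose2[OF c(9) continuous_on_subset[OF continuous_p6]]) (use inV in auto)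
    have h0: "h z = 0 \<longleftrightarrow> z = z0" if "z \<in> ball z0 r" for z
    proof -
      have "h z = 0 \<longleftrightarrow> \<psi> (p6 z) = \<psi> (p6 z0)" using c(12) x(2) by (simp add: h_def)
      also have "\<dots> \<longleftrightarrow> p6 z = p6 z0" using c(10) inV(1)[OF that] fxV by (auto simp: inj_on_def)
      also have "\<dots> \<longleftrightarrow> z = z0" using form[OF that, of z0] r c6.ord_pos[of z0] by (simp add: power_0_left)
      finally show ?thesis .
    qed
    have inv: "h (z0 + exp (2 * pi * \<i> / ord6 z0) * (z - z0)) = h z" if "z \<in> ball z0 r" for z
    proof -
      have "exp (2 * pi * \<i> / ord6 z0) ^ ord6 z0 = 1"
        using c6.ord_pos[of z0] by (simp add: exp_of_nat_mult[symmetric])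
      moreover have "cmod (exp (2 * pi * \<i> / ord6 z0)) = 1" by simp
      moreover from this have "z0 + exp (2 * pi * \<i> / ord6 z0) * (z - z0) \<in> ball z0 r"
        using that by (simp add: dist_norm norm_mult norm_minus_commute)
      ultimately have "p6 (z0 + exp (2 * pi * \<i> / ord6 z0) * (z - z0)) = p6 z"
        unfolding form[OF \<open>z0 + exp (2 * pi * \<i> / ord6 z0) * (z - z0) \<in> ball z0 r\<close> that]
        by (simp add: power_mult_distrib)
      then show ?thesis by (simp add: h_def)
    qed
    obtain \<eta> where \<eta>: "continuous_on (ball z0 r) \<eta>" "\<And>z. z \<in> ball z0 r \<Longrightarrow> \<eta> z ^ k = h z"
      using continuous_root_of_invariant[OF r(1) cont_h h0 c6.ord_pos k(2) inv] by blast
    have eq1: "\<phi> x1 ^ k = \<eta> z1 ^ k" using c(13) x1 \<eta>(2)[OF z1] by (metis h_def)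
    \<comment> \<open>If \<open>\<eta> z1\<close> vanishes then so does \<open>\<phi> x1\<close>,
      and any root of unity will do.\<close>
    define \<xi> where "\<xi> = (if \<eta> z1 = 0 then 1 else \<phi> x1 / \<eta> z1)"
    have \<xi>: "\<xi> ^ k = 1" "\<xi> * \<eta> z1 = \<phi> x1"
      using eq1 c(14) by (auto simp: \<xi>_def power_divide power_0_left)
    have n\<xi>: "cmod \<xi> = 1" using \<xi>(1) c(14)
      by (metis norm_one norm_power power_eq_1_iff norm_ge_zero not_one_le_zero)
    define F where "F z = \<phi>' (\<xi> * \<eta> z)" for z
    have inA: "\<xi> * \<eta> z \<in> A" if "z \<in> ball z0 r" for z
    proof -
      have "cmod (\<eta> z) ^ k < \<epsilon> ^ k" using \<eta>(2)[OF that] inV(2)[OF that] by (simp add: norm_power[symmetric])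
      then have "cmod (\<eta> z) < \<epsilon>" using \<epsilon>(1) by (simp add: power_less_imp_less_base)
      then show ?thesis using \<epsilon>(2) n\<xi> by (auto simp: norm_mult)
    qed
    have FU: "F z \<in> U" "\<phi> (F z) = \<xi> * \<eta> z" if "z \<in> ball z0 r" for z
      using c(7) inA[OF that] unfolding homeomorphism_def F_def by auto
    have "lift_on (ball z0 r) F" unfolding lift_on_def
    proof (intro conjI ballI)
      show "continuous_on (ball z0 r) F" unfolding F_def
        by (rule continuous_on_compose2[of A \<phi>']) (use c(7) inA \<eta>(1) in \<open>auto simp: homeomorphism_def intro!: continuous_intros\<close>)
      show "F ` ball z0 r \<subseteq> sph" using FU(1) c(1) openin_imp_subset by blast
      fix z assume z: "z \<in> ball z0 r"
      have "\<psi> (f (F z)) = \<psi> (p6 z)"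
        using c(13) FU[OF z] \<eta>(2)[OF z] \<xi>(1) by (simp add: power_mult_distrib h_def)
      moreover have "f (F z) \<in> V" using FU(1)[OF z] c(4) by blast
      ultimately show "f (F z) = p6 z" using c(10) inV(1)[OF z] by (auto simp: inj_on_def)
    qed
    moreover have "F z1 = x1" using \<xi>(2) x1(1) c(7) unfolding F_def homeomorphism_def by auto
    ultimately show "\<exists>F. lift_on (ball z0 r) F \<and> F z1 = x1" by blast
  qed
qed

text \<open>The neighbourhoods of the finitely many preimages of \<open>p6 z0\<close> contain all
  preimages of nearby values, because the image of the compact rest of the sphere misses
  \<open>p6 z0\<close>. So one radius serves all starting points.\<close>

lemma local_lift:
  "\<exists>r>0. \<forall>z1\<in>ball z0 r. \<forall>x1\<in>sph. f x1 = p6 z1 \<longrightarrow> (\<exists>F. lift_on (ball z0 r) F \<and> F z1 = x1)"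
proof -
  define X where "X = {x\<in>sph. f x = p6 z0}"
  have finX: "finite X" unfolding X_def by (rule fin_f[OF c6.p_in_sph])
  define P where "P x W r0 \<longleftrightarrow> openin sphtop W \<and> x \<in> W \<and> r0 > 0 \<and> (\<forall>r z1 x1. 0 < r \<longrightarrow> r \<le> r0 \<longrightarrow> z1 \<in> ball z0 r \<longrightarrow> x1 \<in> W \<longrightarrow> f x1 = p6 z1 \<longrightarrow> (\<exists>F. lift_on (ball z0 r) F \<and> F z1 = x1))"
    for x W r0
  have "\<exists>W r0. P x W r0" if "x \<in> X" for x
  proof -
    have "x \<in> sph" "f x = p6 z0" using that by (auto simp: X_def)
    then obtain W r0 where "openin sphtop W" "x \<in> W" "r0 > 0"
      "\<And>r z1 x1. 0 < r \<Longrightarrow> r \<le> r0 \<Longrightarrow> z1 \<in> ball z0 r \<Longrightarrow> x1 \<in> W \<Longrightarrow> f x1 = p6 z1 \<Longrightarrow> \<exists>F. lift_on (ball z0 r) F \<and> F z1 = x1"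
      by (rule local_lift_at) blast
    then show ?thesis by (intro exI[of _ W] exI[of _ r0]) (auto simp: P_def)
  qed
  then obtain W \<rho> where "\<And>x. x \<in> X \<Longrightarrow> P x (W x) (\<rho> x)" by metis
  then have W: "\<And>x. x \<in> X \<Longrightarrow> openin sphtop (W x)" "\<And>x. x \<in> X \<Longrightarrow> x \<in> W x" "\<And>x. x \<in> X \<Longrightarrow> \<rho> x > 0"
    "\<And>x r z1 x1. x \<in> X \<Longrightarrow> 0 < r \<Longrightarrow> r \<le> \<rho> x \<Longrightarrow> z1 \<in> ball z0 r \<Longrightarrow> x1 \<in> W x \<Longrightarrow> f x1 = p6 z1 \<Longrightarrow> \<exists>F. lift_on (ball z0 r) F \<and> F z1 = x1"
    unfolding P_def by blast+
  define C where "C = f ` (sph - (\<Union>x\<in>X. W x))"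
  have "openin sphtop (\<Union>x\<in>X. W x)" using W(1) by blast
  then have "closedin sphtop (sph - (\<Union>x\<in>X. W x))" by (intro closedin_diff) auto
  then have "compact (sph - (\<Union>x\<in>X. W x))" using closedin_compact compact_sphere by blast
  then have "compact C" unfolding C_def using continuous_on_subset[OF cont_f] by (intro compact_continuous_image) auto
  then have "openin sphtop (sph - C)" by (intro openin_diff closed_subset) (auto simp: compact_imp_closed C_def dest: subsetD[OF f_sph, OF imageI])
  moreover have "p6 z0 \<in> sph - C"
    using W(2) c6.p_in_sph[of z0] by (auto simp: C_def X_def)
  ultimately obtain r1 where r1: "r1 > 0" "p6 ` ball z0 r1 \<subseteq> sph - C" by (rule p6_near)
  define r where "r = Min (insert r1 (\<rho> ` X))"
  have r: "r > 0" "r \<le> r1" "\<And>x. x \<in> X \<Longrightarrow> r \<le> \<rho> x"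
    unfolding r_def using finX W(3) r1(1) by (auto simp: Min_gr_iff)
  show ?thesis
  proof (rule exI, rule conjI[OF r(1)], intro ballI impI)
    fix z1 x1 assume z1: "z1 \<in> ball z0 r" and x1: "x1 \<in> sph" "f x1 = p6 z1"
    have "z1 \<in> ball z0 r1" using z1 r(2) by simp
    then have "p6 z1 \<in> sph - C" using r1(2) by blast
    then have "f x1 \<notin> C" using x1(2) by simp
    then obtain x where x: "x \<in> X" "x1 \<in> W x" using x1(1) unfolding C_def by blast
    show "\<exists>F. lift_on (ball z0 r) F \<and> F z1 = x1" by (rule W(4)[OF x(1) r(1) r(3)[OF x(1)] z1 x(2) x1(2)])
  qed
qed

lemma f_injective_near:
  assumes "x \<in> sph" "f x = p6 z" "ord6 z = 1"
  obtains U where "openin sphtop U" "x \<in> U" "inj_on f U"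
proof -
  obtain k where k: "has_local_degree sphtop sphtop f x k" "k dvd ord6 z" using deg_f[OF assms(1,2)] by blast
  then have "k = 1" using assms(3) by simp
  obtain U V A B \<phi> \<phi>' \<psi> \<psi>' where c: "openin sphtop U" "x \<in> U" "openin sphtop V" "f ` U \<subseteq> V" "open (A :: complex set)" "open (B :: complex set)"
    "homeomorphism U A \<phi> \<phi>'" "\<phi> x = 0" "continuous_on V \<psi>" "inj_on \<psi> V" "\<psi> ` V = B" "\<psi> (f x) = 0" "\<forall>u\<in>U. \<psi> (f u) = \<phi> u ^ k" "k \<ge> 1" "homeomorphism V B \<psi> \<psi>'"
    using chart_f[OF k(1)] .
  have "inj_on f U"
  proof (rule inj_onI)
    fix u v assume "u \<in> U" "v \<in> U" "f u = f v"
    then have "\<phi> u = \<phi> v" using c(13) \<open>k = 1\<close> by (metis power_one_right)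
    then show "u = v" using c(7) \<open>u \<in> U\<close> \<open>v \<in> U\<close> unfolding homeomorphism_def by metis
  qed
  then show thesis using that c by blast
qed

text \<open>Over generic points \<open>f\<close> is locally injective, so the coincidence set is
  open and closed in \<open>D\<close> without the cone points, and removing countably many points
  keeps \<open>D\<close> connected. Agreement at a cone point would not suffice: composing a lift
  with a rotation about that point keeps its value there.\<close>

lemma lift_unique:
  assumes F: "lift_on D F" and G: "lift_on D G" and D: "open D" "connected D" and z1: "z1 \<in> D" "ord6 z1 = 1" "F z1 = G z1"
    and z: "z \<in> D"
  shows "F z = G z"
proof -
  define D' where "D' = D - {z. ord6 z \<noteq> 1}"
  have conn: "connected D'" unfolding D'_def using D countable_cone by (intro connected_open_diff_countable) auto
  have cF: "continuous_on D F" and cG: "continuous_on D G" using F G by (auto simp: lift_on_def)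
  have cl: "closedin (top_of_set E) {z\<in>E. F z = G z}" if "E \<subseteq> D" for E
  proof -
    have "closedin (top_of_set E) (E \<inter> (\<lambda>z. F z - G z) -` {0})"
      using continuous_on_subset[OF cF that] continuous_on_subset[OF cG that]
      by (intro continuous_closedin_preimage continuous_intros) auto
    moreover have "E \<inter> (\<lambda>z. F z - G z) -` {0} = {z\<in>E. F z = G z}" by auto
    ultimately show ?thesis by simp
  qed
  have "openin (top_of_set D') {z\<in>D'. F z = G z}"
  proof (subst openin_subopen, rule ballI)
    fix z assume z: "z \<in> {z\<in>D'. F z = G z}"
    then have zD: "z \<in> D" "ord6 z = 1" "F z = G z" by (auto simp: D'_def)
    have "F z \<in> sph" "f (F z) = p6 z" using F zD by (auto simp: lift_on_def)
    then obtain U where U: "openin sphtop U" "F z \<in> U" "inj_on f U" using f_injective_near zD(2) by blast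
    obtain T where T: "open T" "U = sph \<inter> T" using U(1) by (auto simp: openin_open)
    have "open (D \<inter> F -` T)" "open (D \<inter> G -` T)" using continuous_open_preimage cF cG D(1) T(1) by blast+
    then have "open ((D \<inter> F -` T) \<inter> (D \<inter> G -` T))" by blast
    then have op: "openin (top_of_set D') (D' \<inter> ((D \<inter> F -` T) \<inter> (D \<inter> G -` T)))" by (rule openin_open_Int)
    show "\<exists>O'. openin (top_of_set D') O' \<and> z \<in> O' \<and> O' \<subseteq> {z\<in>D'. F z = G z}"
    proof (intro exI conjI, rule op)
      show "z \<in> D' \<inter> ((D \<inter> F -` T) \<inter> (D \<inter> G -` T))" using z zD U(2) T(2) by auto
      show "D' \<inter> ((D \<inter> F -` T) \<inter> (D \<inter> G -` T)) \<subseteq> {z\<in>D'. F z = G z}"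
      proof
        fix w assume w: "w \<in> D' \<inter> ((D \<inter> F -` T) \<inter> (D \<inter> G -` T))"
        then have "F w \<in> U" "G w \<in> U" "f (F w) = f (G w)" using F G T(2) by (auto simp: lift_on_def)
        then have "F w = G w" using U(3) by (auto simp: inj_on_def)
        then show "w \<in> {z\<in>D'. F z = G z}" using w by simp
      qed
    qed
  qed
  moreover have "closedin (top_of_set D') {z\<in>D'. F z = G z}" by (rule cl) (auto simp: D'_def)
  moreover have "z1 \<in> {z\<in>D'. F z = G z}" using z1 by (auto simp: D'_def)
  ultimately have all: "{z\<in>D'. F z = G z} = D'" using conn unfolding connected_clopen by blast
  \<comment> \<open>The set of disagreement is open and contains no generic point, hence is
    empty.\<close>
  have "openin (top_of_set D) (D - {z\<in>D. F z = G z})" using cl[of D] by (intro openin_diff) auto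
  then have "open (D - {z\<in>D. F z = G z})" using D(1) openin_open_eq by blast
  moreover have "ord6 w \<noteq> 1" if "w \<in> D - {z\<in>D. F z = G z}" for w using that all unfolding D'_def by blast
  ultimately have "D - {z\<in>D. F z = G z} = {}" using generic_point by metis
  then show ?thesis using z by blast
qed

end

lemma countable_p3_fibre: "countable {z. p3 z = y}"
proof (cases "\<exists>w. p3 w = y")
  case True
  then obtain w where w: "p3 w = y" by blast
  have "{z. p3 z = y} \<subseteq> (\<lambda>(u, b). u * w + b) ` ({u. u ^ 3 = 1} \<times> eis)"
  proof
    fix z assume "z \<in> {z. p3 z = y}"
    then have "p3 w = p3 z" using w by simp
    then obtain u b where "u ^ 3 = 1" "b \<in> eis" "z = u * w + b" unfolding p3_eq_iff by blast
    then show "z \<in> (\<lambda>(u, b). u * w + b) ` ({u. u ^ 3 = 1} \<times> eis)" by (intro image_eqI[of _ _ "(u, b)"]) auto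
  qed
  moreover have "countable ({u::complex. u ^ 3 = 1} \<times> eis)"
    by (intro countable_SIGMA[OF countable_finite countable_eis] finite_roots_unity) auto
  ultimately show ?thesis using countable_image countable_subset by blast
qed auto

text \<open>The sphere minus \<open>K\<close> is the image under \<open>p3\<close> of the plane
  minus a countable set.\<close>

lemma connected_sph_minus_finite:
  assumes "finite K" shows "connected (sph - K)"
proof -
  have "{z. p3 z \<in> K} = (\<Union>y\<in>K. {z. p3 z = y})" by blast
  then have "countable {z. p3 z \<in> K}" using assms countable_p3_fibre by (simp add: countable_UN countable_finite)
  then have "connected (UNIV - {z. p3 z \<in> K})" by (intro connected_open_diff_countable) auto
  then have "connected (p3 ` (UNIV - {z. p3 z \<in> K}))"
    by (intro connected_continuous_image continuous_on_subset[OF continuous_p3]) auto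
  moreover have "p3 ` (UNIV - {z. p3 z \<in> K}) = sph - K"
  proof (rule subset_antisym; rule subsetI)
    fix x assume x: "x \<in> sph - K"
    then have "x \<in> range p3" using range_p3 by simp
    then show "x \<in> p3 ` (UNIV - {z. p3 z \<in> K})" using x by auto
  next
    fix x assume "x \<in> p3 ` (UNIV - {z. p3 z \<in> K})"
    then show "x \<in> sph - K" using c3.p_in_sph by auto
  qed
  ultimately show ?thesis by simp
qed

section \<open>Global lifts\<close>

context lift_problem
begin

lemma glue_lifts:
  assumes lift: "\<And>i. i \<in> I \<Longrightarrow> lift_on (D i) (F i)" and op: "\<And>i. i \<in> I \<Longrightarrow> open (D i)"
    and agree: "\<And>i j z. i \<in> I \<Longrightarrow> j \<in> I \<Longrightarrow> z \<in> D i \<Longrightarrow> z \<in> D j \<Longrightarrow> F i z = F j z"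
  obtains G where "lift_on (\<Union>i\<in>I. D i) G" "\<And>i z. i \<in> I \<Longrightarrow> z \<in> D i \<Longrightarrow> G z = F i z"
proof -
  define G where "G z = F (SOME i. i \<in> I \<and> z \<in> D i) z" for z
  have G: "G z = F i z" if "i \<in> I" "z \<in> D i" for i z
  proof -
    have "(SOME i. i \<in> I \<and> z \<in> D i) \<in> I \<and> z \<in> D (SOME i. i \<in> I \<and> z \<in> D i)"
      by (rule someI[of _ i]) (use that in blast)
    then show ?thesis unfolding G_def using agree that by blast
  qed
  have "lift_on (\<Union>i\<in>I. D i) G" unfolding lift_on_def
  proof (intro conjI ballI)
    have "continuous_on (D i) G" if "i \<in> I" for i
      using lift[OF that] G[OF that] unfolding lift_on_def by (metis continuous_on_cong)
    then show "continuous_on (\<Union>i\<in>I. D i) G" using op by (intro continuous_on_open_UN) auto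
    show "G ` (\<Union>i\<in>I. D i) \<subseteq> sph"
    proof
      fix y assume "y \<in> G ` (\<Union>i\<in>I. D i)"
      then obtain i z where "i \<in> I" "z \<in> D i" "y = G z" by blast
      then show "y \<in> sph" using lift[of i] G[of i z] unfolding lift_on_def by auto
    qed
    fix z assume "z \<in> (\<Union>i\<in>I. D i)"
    then obtain i where "i \<in> I" "z \<in> D i" by blast
    then show "f (G z) = p6 z" using lift[of i] G[of i z] unfolding lift_on_def by simp
  qed
  then show thesis using that G by blast
qed

text \<open>Local lifts at the points of the bounding circle are glued to \<open>F\<close>. Two of
  them agree because the overlap of their discs reaches into the given disc, and compactness of the
  closed disc provides the larger radius.\<close>

lemma extend_lift:
  assumes R: "R > 0" and F: "lift_on (ball a R) F"
  obtains R' G where "R' > R" "lift_on (ball a R') G" "\<And>z. z \<in> ball a R \<Longrightarrow> G z = F z"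
proof -
  have "\<exists>r G. r > 0 \<and> lift_on (ball c r) G \<and> (\<forall>z\<in>ball c r \<inter> ball a R. G z = F z)" if c: "c \<in> sphere a R" for c
  proof -
    obtain r where r: "r > 0" "\<And>z1 x1. z1 \<in> ball c r \<Longrightarrow> x1 \<in> sph \<Longrightarrow> f x1 = p6 z1 \<Longrightarrow> \<exists>F. lift_on (ball c r) F \<and> F z1 = x1"
      using local_lift[of c] by blast
    have "c \<in> closure (ball a R)" using c R by simp
    then have "ball c r \<inter> ball a R \<noteq> {}" using r(1)
      by (metis centre_in_ball open_Int_closure_eq_empty open_ball IntI empty_iff)
    then obtain z1 where z1: "z1 \<in> ball c r \<inter> ball a R" "ord6 z1 = 1"
      using generic_point[of "ball c r \<inter> ball a R"] by (metis open_Int open_ball)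
    have "F z1 \<in> sph" "f (F z1) = p6 z1" using liftD[OF F] z1(1) by blast+
    then obtain G where G: "lift_on (ball c r) G" "G z1 = F z1" using r(2) z1(1) by blast
    have "\<forall>z\<in>ball c r \<inter> ball a R. G z = F z"
      using lift_unique[of "ball c r \<inter> ball a R" G F z1] lift_on_subset[OF G(1)] lift_on_subset[OF F] z1 G(2)
      by (auto simp: open_Int convex_connected convex_Int)
    then show ?thesis using r(1) G(1) by blast
  qed
  then obtain r G where rG: "\<And>c. c \<in> sphere a R \<Longrightarrow> r c > 0" "\<And>c. c \<in> sphere a R \<Longrightarrow> lift_on (ball c (r c)) (G c)"
    "\<And>c z. c \<in> sphere a R \<Longrightarrow> z \<in> ball c (r c) \<Longrightarrow> z \<in> ball a R \<Longrightarrow> G c z = F z" by (metis IntI)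
  have agree: "G c z = G c' z" if c: "c \<in> sphere a R" "c' \<in> sphere a R" and z: "z \<in> ball c (r c)" "z \<in> ball c' (r c')" for c c' z
  proof (cases "c = c'")
    case False
    define D where "D = ball c (r c) \<inter> ball c' (r c')"
    \<comment> \<open>Dividing the segment in the ratio of the radii puts \<open>w\<close> into both
      discs; strict convexity puts it into the given one.\<close>
    define s where "s = r c / (r c + r c')"
    have rr: "r c > 0" "r c' > 0" using rG(1) c by auto
    have s: "0 < s" "s < 1" using rr by (auto simp: s_def field_simps)
    have dcc: "dist c c' < r c + r c'" using z dist_triangle[of c c' z] by (simp add: dist_commute)
    define w where "w = c + s *\<^sub>R (c' - c)"
    have "w \<in> open_segment c c'"
      unfolding in_segment w_def using s False by (auto intro!: exI[of _ s] simp: algebra_simps)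
    from dist_decreases_open_segment[OF this, of a] have "w \<in> ball a R" using c by auto
    moreover have "w \<in> D"
    proof -
      have "dist c w = s * dist c c'" using s by (simp add: w_def dist_norm norm_minus_commute)
      also have "\<dots> < s * (r c + r c')" using dcc s by simp
      also have "\<dots> = r c" using rr by (simp add: s_def)
      finally have 1: "dist c w < r c" .
      have "c' - w = (1 - s) *\<^sub>R (c' - c)" by (simp add: w_def algebra_simps)
      then have "dist c' w = (1 - s) * dist c c'" using s by (simp add: dist_norm norm_minus_commute)
      also have "\<dots> < (1 - s) * (r c + r c')" using dcc s by simp
      also have "\<dots> = r c'" using rr by (simp add: s_def field_simps)
      finally show ?thesis using 1 by (simp add: D_def)
    qed
    ultimately have "D \<inter> ball a R \<noteq> {}" by blast
    then obtain z1 where z1: "z1 \<in> D \<inter> ball a R" "ord6 z1 = 1"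
      using generic_point[of "D \<inter> ball a R"] unfolding D_def by (metis open_Int open_ball)
    have "G c z1 = G c' z1" using rG(3)[OF c(1)] rG(3)[OF c(2)] z1(1) by (auto simp: D_def)
    then show ?thesis
      using lift_unique[of D "G c" "G c'" z1 z] lift_on_subset[OF rG(2)[OF c(1)], of D] lift_on_subset[OF rG(2)[OF c(2)], of D] z1 z
      by (auto simp: D_def open_Int convex_connected convex_Int)
  qed simp
  define I where "I = insert None (Some ` sphere a R)"
  define D where "D i = (case i of None \<Rightarrow> ball a R | Some c \<Rightarrow> ball c (r c))" for i
  define H where "H i = (case i of None \<Rightarrow> F | Some c \<Rightarrow> G c)" for i
  have li: "lift_on (D i) (H i)" if "i \<in> I" for i
    using that F rG(2) by (cases i) (auto simp: I_def D_def H_def)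
  have op: "open (D i)" if "i \<in> I" for i by (auto simp: D_def split: option.split)
  have ag: "H i z = H j z" if "i \<in> I" "j \<in> I" "z \<in> D i" "z \<in> D j" for i j z
  proof (cases i)
    case None
    then show ?thesis using that rG(3) by (cases j) (auto simp: I_def D_def H_def)
  next
    case (Some c)
    show ?thesis
    proof (cases j)
      case None
      then show ?thesis using Some that rG(3)[of c z] by (simp add: I_def D_def H_def image_iff)
    next
      case (Some c')
      then show ?thesis using \<open>i = Some c\<close> that agree[of c c' z] by (simp add: I_def D_def H_def image_iff)
    qed
  qed
  obtain K where K: "lift_on (\<Union>i\<in>I. D i) K" "\<And>i z. i \<in> I \<Longrightarrow> z \<in> D i \<Longrightarrow> K z = H i z"
  proof (rule glue_lifts[of I D H], goal_cases)
    case (1 i)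
    show ?case by (rule li[OF 1(2)])
  next
    case (2 i)
    show ?case by (rule op[OF 2(2)])
  next
    case (3 i j z)
    show ?case by (rule ag[OF 3(2-5)])
  next
    case (4 K)
    show ?case by (rule 4(1)[OF 4(2,3)])
  qed
  have "cball a R \<subseteq> (\<Union>i\<in>I. D i)"
  proof
    fix z assume "z \<in> cball a R"
    then consider "z \<in> ball a R" | "z \<in> sphere a R" by fastforce
    then show "z \<in> (\<Union>i\<in>I. D i)"
    proof cases
      case 2
      then have "Some z \<in> I" "z \<in> D (Some z)" using rG(1) by (auto simp: I_def D_def)
      then show ?thesis by blast
    qed (auto simp: I_def D_def)
  qed
  moreover have "open (\<Union>i\<in>I. D i)" using op by blast
  ultimately obtain e where e: "e > 0" "(\<Union>x\<in>cball a R. ball x e) \<subseteq> (\<Union>i\<in>I. D i)"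
    using compact_subset_open_imp_ball_epsilon_subset[OF compact_cball] by metis
  have "ball a (R + e) \<subseteq> (\<Union>x\<in>cball a R. ball x e)"
  proof
    fix z assume z: "z \<in> ball a (R + e)"
    show "z \<in> (\<Union>x\<in>cball a R. ball x e)"
    proof (cases "z \<in> cball a R")
      case True
      then show ?thesis using e(1) by (intro UN_I[of z]) auto
    next
      case False
      define t where "t = R / dist a z"
      have d: "dist a z > R" using False by simp
      moreover from this have "dist a z > 0" using R by linarith
      ultimately have t: "0 < t" "t < 1" "t * dist a z = R" using R by (simp_all only: t_def) (auto simp: field_simps)
      define x where "x = a + t *\<^sub>R (z - a)"
      have "dist a x = R" using t by (simp add: x_def dist_norm norm_minus_commute)
      moreover have "z - x = (1 - t) *\<^sub>R (z - a)" by (simp add: x_def algebra_simps)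
      then have "norm (z - x) = (1 - t) * norm (z - a)" using t by simp
      then have "dist x z = (1 - t) * dist a z" by (simp add: dist_norm norm_minus_commute)
      then have "dist x z < e" using z t(3) by (simp add: algebra_simps)
      ultimately show ?thesis by (intro UN_I[of x]) auto
    qed
  qed
  then have "lift_on (ball a (R + e)) K" by (intro lift_on_subset[OF K(1)] order_trans[OF _ e(2)])
  moreover have "K z = F z" if "z \<in> ball a R" for z
    using K(2)[of None z] that by (simp add: I_def D_def H_def)
  ultimately show thesis using that[of "R + e" K] e(1) by simp
qed

text \<open>If the radii were bounded, the lifts would glue to one on the disc of supremal radius,
  which could be extended further.\<close>

lemma global_lift:
  assumes a: "ord6 a = 1" and x: "x \<in> sph" "f x = p6 a"
  obtains F where "lift_on UNIV F" "F a = x"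
proof -
  define P where "P R F \<longleftrightarrow> lift_on (ball a R) F \<and> F a = x" for R F
  define S where "S = {R. R > 0 \<and> (\<exists>F. P R F)}"
  have same: "F z = G z" if "P R F" "P R' G" "z \<in> ball a R" "z \<in> ball a R'" for R R' F G z
  proof -
    have "a \<in> ball a (min R R')"
      using that by (metis centre_in_ball mem_ball min_less_iff_conj zero_le_dist le_less_trans min_def)
    moreover have "lift_on (ball a (min R R')) F" "lift_on (ball a (min R R')) G"
      using that lift_on_subset unfolding P_def by (meson subset_ball min.cobounded1 min.cobounded2)+
    ultimately show ?thesis
      using lift_unique[of "ball a (min R R')" F G a z] a that by (simp add: P_def)
  qed
  have union: "\<exists>G. lift_on (\<Union>R\<in>T. ball a R) G \<and> G a = x" if T: "T \<subseteq> S" "T \<noteq> {}" for T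
  proof -
    have "\<forall>R\<in>T. \<exists>F. P R F" using T by (auto simp: S_def)
    then obtain F where F: "\<And>R. R \<in> T \<Longrightarrow> P R (F R)" by metis
    obtain G where G: "lift_on (\<Union>R\<in>T. ball a R) G" "\<And>R z. R \<in> T \<Longrightarrow> z \<in> ball a R \<Longrightarrow> G z = F R z"
    proof (rule glue_lifts[of T "ball a" F], goal_cases)
      case (3 R R' z)
      then show ?case using same[OF F F] by blast
    next
      case (4 G)
      show ?case by (rule 4(1)[OF 4(2,3)])
    qed (use F in \<open>auto simp: P_def\<close>)
    obtain R where R: "R \<in> T" using T by blast
    then have "G a = x" using G(2)[OF R, of a] F[OF R] T by (auto simp: P_def S_def)
    then show ?thesis using G(1) by blast
  qed
  have nonempty: "S \<noteq> {}"
  proof -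
    obtain r where r: "r > 0" "\<And>z1 x1. z1 \<in> ball a r \<Longrightarrow> x1 \<in> sph \<Longrightarrow> f x1 = p6 z1 \<Longrightarrow> \<exists>F. lift_on (ball a r) F \<and> F z1 = x1"
      using local_lift[of a] by blast
    then have "r \<in> S" using r(2)[of a x] x by (auto simp: S_def P_def)
    then show ?thesis by blast
  qed
  have "\<not> bdd_above S"
  proof
    assume bdd: "bdd_above S"
    define R where "R = Sup S"
    have R: "R > 0" using nonempty bdd unfolding R_def
      by (metis (mono_tags, lifting) S_def cSup_upper ex_in_conv less_le_trans mem_Collect_eq)
    have "(\<Union>R\<in>S. ball a R) = ball a R"
    proof (rule subset_antisym; rule subsetI)
      fix z assume "z \<in> (\<Union>R\<in>S. ball a R)"
      then obtain t where "t \<in> S" "dist a z < t" by auto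
      then show "z \<in> ball a R" using cSup_upper[OF _ bdd, of t] unfolding R_def by simp
    next
      fix z assume "z \<in> ball a R"
      then have "dist a z < Sup S" by (simp add: R_def)
      then obtain t where "t \<in> S" "dist a z < t" using less_cSupE[OF _ nonempty] by blast
      then show "z \<in> (\<Union>R\<in>S. ball a R)" by auto
    qed
    then obtain G where G: "lift_on (ball a R) G" "G a = x" using union[OF order_refl nonempty] by metis
    obtain R' H where H: "R' > R" "lift_on (ball a R') H" "\<And>z. z \<in> ball a R \<Longrightarrow> H z = G z"
      using extend_lift[OF R G(1)] by blast
    then have "R' \<in> S" using R G(2) by (auto simp: S_def P_def intro!: exI[of _ H])
    then show False using cSup_upper[OF _ bdd] H(1) unfolding R_def by fastforce
  qed
  then have "(\<Union>R\<in>S. ball a R) = UNIV"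
    unfolding bdd_above_def by (auto simp: not_le) 
  then show thesis using union[OF order_refl nonempty] that by metis
qed

text \<open>A start at a cone point is carried along a local lift to a generic point nearby;
  uniqueness brings the prescribed value back to \<open>a\<close>.\<close>

lemma global_lift':
  assumes x: "x \<in> sph" "f x = p6 a"
  obtains F where "lift_on UNIV F" "F a = x"
proof -
  obtain r where r: "r > 0" "\<And>z1 x1. z1 \<in> ball a r \<Longrightarrow> x1 \<in> sph \<Longrightarrow> f x1 = p6 z1 \<Longrightarrow> \<exists>F. lift_on (ball a r) F \<and> F z1 = x1"
    using local_lift[of a] by blast
  have a: "a \<in> ball a r" using r(1) by simp
  obtain G where G: "lift_on (ball a r) G" "G a = x" using r(2)[OF a x] by blast
  obtain z1 where z1: "z1 \<in> ball a r" "ord6 z1 = 1" using generic_point[of "ball a r"] a by blast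
  have "G z1 \<in> sph" "f (G z1) = p6 z1" using liftD G(1) z1(1) by blast+
  then obtain F where F: "lift_on UNIV F" "F z1 = G z1" using global_lift[OF z1(2)] by blast
  have "F a = G a"
    by (rule lift_unique[OF lift_on_subset[OF F(1)] G(1) open_ball _ z1 F(2) a]) auto
  then show thesis using that F(1) G(2) by simp
qed

section \<open>The affine group acting on the lifts\<close>

lemma lift_compose:
  assumes F: "lift_on UNIV F" and u: "u ^ 6 = 1" and b: "b \<in> eis"
  shows "lift_on UNIV (\<lambda>z. F (u * z + b))"
proof -
  have "p6 z = p6 (u * z + b)" for z unfolding p6_eq_iff using u b by blast
  then have "p6 (u * z + b) = p6 z" for z by simp
  moreover have "continuous_on UNIV (\<lambda>z. F (u * z + b))"
    by (rule continuous_on_compose2[of UNIV F]) (use F in \<open>auto simp: lift_on_def intro!: continuous_intros\<close>)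
  ultimately show ?thesis using F by (auto simp: lift_on_def)
qed

lemma lift_eqI:
  assumes "lift_on UNIV F" "lift_on UNIV G" "ord6 a = 1" "F a = G a" shows "F = G"
  using lift_unique[OF assms(1,2) open_UNIV connected_UNIV UNIV_I assms(3,4)] by blast

text \<open>With \<open>f\<close> injective on a neighbourhood \<open>U\<close> of \<open>x\<close>,
  the image of a small \<open>N\<close> under \<open>F\<close> is the part of \<open>U\<close> that
  \<open>f\<close> sends into the open image of \<open>N\<close> under \<open>p6\<close>.\<close>

lemma lift_image_open:
  assumes F: "lift_on UNIV F"
  shows "openin sphtop (F ` {z. ord6 z = 1})"
proof (subst openin_subopen, rule ballI)
  fix x assume "x \<in> F ` {z. ord6 z = 1}"
  then obtain z where z: "x = F z" "ord6 z = 1" by blast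
  have cF: "continuous_on UNIV F" using F by (simp add: lift_on_def)
  have x: "x \<in> sph" "f x = p6 z" using liftD[OF F UNIV_I] z by auto
  obtain U where U: "openin sphtop U" "x \<in> U" "inj_on f U" using f_injective_near[OF x z(2)] .
  obtain T where T: "open T" "U = sph \<inter> T" using U(1) by (auto simp: openin_open)
  define K where "K = {y. ord6 y \<noteq> 1}"
  have "open (F -` T)" using cF T(1) by (simp add: open_vimage)
  moreover have "z \<in> F -` T" using z U(2) T(2) by auto
  ultimately have "open (F -` T \<inter> {z. ord6 z = 1})" "z \<in> F -` T \<inter> {z. ord6 z = 1}" using open_generic z by auto
  then obtain N where N: "open N" "z \<in> N" "N \<subseteq> F -` T" "\<And>y. y \<in> N \<Longrightarrow> ord6 y = 1" by blast
  have "openin sphtop (p6 ` N)" by (rule c6.open_map[OF N(1)])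
  then obtain T2 where T2: "open T2" "p6 ` N = sph \<inter> T2" by (auto simp: openin_open)
  have "openin sphtop (sph \<inter> f -` T2)" using continuous_openin_preimage_gen[OF cont_f T2(1)] .
  then have "openin sphtop (U \<inter> (sph \<inter> f -` T2))" using U(1) by blast
  moreover have "U \<inter> (sph \<inter> f -` T2) = F ` N"
  proof (rule subset_antisym; rule subsetI)
    fix w assume w: "w \<in> U \<inter> (sph \<inter> f -` T2)"
    then have "f w \<in> p6 ` N" using T2(2) f_sph by blast
    then obtain y where y: "y \<in> N" "f w = p6 y" by blast
    have "F y \<in> U" using N(3) y(1) T(2) liftD(1)[OF F UNIV_I] by blast
    moreover have "f (F y) = f w" using liftD(2)[OF F UNIV_I] y by simp
    ultimately have "w = F y" using U(3) w unfolding inj_on_def by blast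
    then show "w \<in> F ` N" using y by blast
  next
    fix w assume "w \<in> F ` N"
    then obtain y where y: "y \<in> N" "w = F y" by blast
    have "w \<in> sph" "f w = p6 y" using liftD[OF F UNIV_I] y by auto
    moreover have "p6 y \<in> T2" using y T2(2) by blast
    ultimately show "w \<in> U \<inter> (sph \<inter> f -` T2)" using y N(3) T(2) by auto
  qed
  ultimately have "openin sphtop (F ` N)" by simp
  moreover have "x \<in> F ` N" "F ` N \<subseteq> F ` {z. ord6 z = 1}" using z N by auto
  ultimately show "\<exists>T. openin sphtop T \<and> x \<in> T \<and> T \<subseteq> F ` {z. ord6 z = 1}" by blast
qed

text \<open>The images of the generic points under the orbit of \<open>F\<close> and under all other
  lifts are disjoint open sets. They cover the sphere minus the finite set over the cone values,
  which is connected, and the first is not empty; so there are no other lifts.\<close>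

lemma lifts_transitive:
  assumes F: "lift_on UNIV F" and G: "lift_on UNIV G"
  obtains u b where "u ^ 6 = 1" "b \<in> eis" "G = (\<lambda>z. F (u * z + b))"
proof -
  note inv = ord6_orbit
  have cone: "finite (p6 ` {z. ord6 z \<noteq> 1})"
    by (rule finite_subset[of _ "{p6 0, p6 (1 / \<theta>), p6 (1 / 2)}"]) (use p6_cone_points in blast, simp)
  define C where "C = {z. ord6 z = 1}"
  define K where "K = {x\<in>sph. f x \<in> p6 ` {z. ord6 z \<noteq> 1}}"
  have "K = (\<Union>y\<in>p6 ` {z. ord6 z \<noteq> 1}. {x\<in>sph. f x = y})" by (auto simp: K_def)
  moreover have "finite (\<Union>y\<in>p6 ` {z. ord6 z \<noteq> 1}. {x\<in>sph. f x = y})"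
    by (rule finite_UN_I[OF cone]) (use fin_f c6.p_in_sph in blast)
  ultimately have "finite K" by simp
  then have conn: "connected (sph - K)" by (rule connected_sph_minus_finite)
  have inC: "H z \<in> sph - K" if "lift_on UNIV H" "z \<in> C" for H z
  proof -
    have "f (H z) = p6 z" "H z \<in> sph" using liftD[OF that(1) UNIV_I] by auto
    moreover have "p6 z \<noteq> p6 w" if "ord6 w \<noteq> 1" for w using inv[of z w] that \<open>z \<in> C\<close> by (auto simp: C_def)
    ultimately show ?thesis by (auto simp: K_def)
  qed
  define same where "same H \<longleftrightarrow> (\<exists>u b. u ^ 6 = 1 \<and> b \<in> eis \<and> H = (\<lambda>z. F (u * z + b)))" for H
  define P where "P = F ` C"
  define Q where "Q = (\<Union>H\<in>{H. lift_on UNIV H \<and> \<not> same H}. H ` C)"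
  have oP: "openin sphtop P" unfolding P_def C_def by (rule lift_image_open[OF F])
  have oQ: "openin sphtop Q" unfolding Q_def C_def using lift_image_open by blast
  have disj: "P \<inter> Q = {}"
  proof (rule ccontr)
    assume "P \<inter> Q \<noteq> {}"
    then obtain x where "x \<in> P" "x \<in> Q" by blast
    then obtain H z w where H: "lift_on UNIV H" "\<not> same H" and zw: "z \<in> C" "w \<in> C" "x = F z" "x = H w"
      unfolding P_def Q_def by blast
    have "p6 w = p6 z" using liftD(2)[OF F UNIV_I, of z] liftD(2)[OF H(1) UNIV_I, of w] zw by simp
    then obtain u b where ub: "u ^ 6 = 1" "b \<in> eis" "z = u * w + b" using p6_eq_iff by blast
    have "H = (\<lambda>z. F (u * z + b))"
      by (rule lift_eqI[OF H(1) lift_compose[OF F ub(1,2)], of w]) (use zw ub in \<open>auto simp: C_def\<close>)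
    then show False using H(2) ub unfolding same_def by blast
  qed
  have cover: "sph - K \<subseteq> P \<union> Q"
  proof
    fix x assume x: "x \<in> sph - K"
    then have "f x \<in> range p6" unfolding range_p6 using f_sph by blast
    then obtain z where z: "f x = p6 z" by blast
    then have zC: "z \<in> C" using x by (auto simp: K_def C_def)
    then obtain H where H: "lift_on UNIV H" "H z = x" using global_lift[of z x] x z by (auto simp: C_def)
    show "x \<in> P \<union> Q"
    proof (cases "same H")
      case True
      then obtain u b where ub: "u ^ 6 = 1" "b \<in> eis" "H = (\<lambda>z. F (u * z + b))" unfolding same_def by blast
      then have "p6 z = p6 (u * z + b)" unfolding p6_eq_iff by blast
      then have "u * z + b \<in> C" using inv zC by (metis C_def mem_Collect_eq)
      moreover have "x = F (u * z + b)" using H(2) ub(3) by simp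
      ultimately show ?thesis unfolding P_def by blast
    next
      case False
      then show ?thesis using H zC unfolding Q_def by blast
    qed
  qed
  obtain a where a: "a \<in> C" using generic_point[of UNIV] by (auto simp: C_def)
  have PQ: "P \<subseteq> sph - K" "Q \<subseteq> sph - K" using inC F unfolding P_def Q_def by auto
  have "openin (top_of_set (sph - K)) P" "openin (top_of_set (sph - K)) Q"
    using oP oQ PQ openin_subset_trans[of sph] by blast+
  moreover have "P \<noteq> {}" using a P_def by blast
  ultimately have "Q = {}"
    using conn disj cover PQ unfolding connected_openin by (metis subset_antisym Un_least order_refl)
  then have "same G" using G a unfolding Q_def by blast
  then show thesis using that unfolding same_def by blast
qed

text \<open>Lifts exist and are unique for each prescribed value at a generic point, so the degree
  becomes a number of lifts.\<close>

lemma card_lifts: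
  assumes a: "ord6 a = 1"
  shows "bij_betw (\<lambda>F. F a) {F. lift_on UNIV F} {x\<in>sph. f x = p6 a}"
proof (rule bij_betw_imageI)
  show "inj_on (\<lambda>F. F a) {F. lift_on UNIV F}" using lift_eqI[OF _ _ a] by (intro inj_onI) auto
  show "(\<lambda>F. F a) ` {F. lift_on UNIV F} = {x\<in>sph. f x = p6 a}"
  proof (rule subset_antisym; rule subsetI)
    fix x assume "x \<in> (\<lambda>F. F a) ` {F. lift_on UNIV F}"
    then show "x \<in> {x\<in>sph. f x = p6 a}" using liftD by blast
  next
    fix x assume "x \<in> {x\<in>sph. f x = p6 a}"
    then obtain F where "lift_on UNIV F" "F a = x" using global_lift[OF a, of x] by blast
    then show "x \<in> (\<lambda>F. F a) ` {F. lift_on UNIV F}" by blast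
  qed
qed

text \<open>Near a preimage of \<open>F a\<close> the chart turns \<open>F\<close> into a \<open>k\<close>-th root of a function invariant under
  the rotation, so the rotation multiplies this root by a constant \<open>k\<close>-th root of unity.\<close>

lemma lift_rotation_power:
  assumes F: "lift_on UNIV F" and k: "has_local_degree sphtop sphtop f (F a) k"
  defines "u \<equiv> exp (2 * pi * \<i> / ord6 a) ^ k"
  shows "F (a + u * (z - a)) = F z"
proof -
  define v where "v = exp (2 * pi * \<i> / ord6 a)"
  have v1: "v ^ ord6 a = 1" using c6.ord_pos[of a] by (simp add: v_def exp_of_nat_mult[symmetric])
  have v6: "v ^ 6 = 1" "(1 - v) * a \<in> eis" "cmod v = 1"
    using c6.unit_ord[OF v1] ord6_stab v1 c6.unit_norm by blast+
  obtain U V A B \<phi> \<phi>' \<psi> \<psi>' where c: "openin sphtop U" "F a \<in> U" "openin sphtop V" "f ` U \<subseteq> V" "open (A :: complex set)" "open (B :: complex set)"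
    "homeomorphism U A \<phi> \<phi>'" "\<phi> (F a) = 0" "continuous_on V \<psi>" "inj_on \<psi> V" "\<psi> ` V = B" "\<psi> (f (F a)) = 0" "\<forall>u\<in>U. \<psi> (f u) = \<phi> u ^ k" "k \<ge> 1" "homeomorphism V B \<psi> \<psi>'"
    using chart_f[OF k] .
  have cF: "continuous_on UNIV F" using F by (simp add: lift_on_def)
  obtain T where T: "open T" "U = sph \<inter> T" using c(1) by (auto simp: openin_open)
  have "open (F -` T)" using cF T(1) by (simp add: open_vimage)
  moreover have "a \<in> F -` T" using c(2) T(2) by auto
  ultimately obtain r1 where r1: "r1 > 0" "ball a r1 \<subseteq> F -` T" using openE by blast
  obtain r2 where r2: "r2 > 0" "\<And>z w. z \<in> ball a r2 \<Longrightarrow> w \<in> ball a r2 \<Longrightarrow>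
    p6 z = p6 w \<longleftrightarrow> (z - a) ^ ord6 a = (w - a) ^ ord6 a" using c6.local_form by blast
  define r where "r = min r1 r2"
  have r: "r > 0" "r \<le> r1" "r \<le> r2" using r1 r2 by (auto simp: r_def)
  have FU: "F z \<in> U" if "z \<in> ball a r" for z
  proof -
    have "z \<in> ball a r1" using that r by simp
    then show ?thesis using r1(2) T(2) liftD(1)[OF F UNIV_I] by blast
  qed
  define \<eta> where "\<eta> z = \<phi> (F z)" for z
  have cont\<eta>: "continuous_on (ball a r) \<eta>" unfolding \<eta>_def
    by (rule continuous_on_compose2[of U \<phi>]) (use c(7) FU continuous_on_subset[OF cF] in \<open>auto simp: homeomorphism_def\<close>)
  have pow: "\<eta> z ^ k = \<psi> (p6 z)" if "z \<in> ball a r" for z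
    using bspec[OF c(13) FU[OF that]] liftD(2)[OF F UNIV_I, of z] by (simp add: \<eta>_def)
  have rot: "a + v * (z - a) \<in> ball a r" if "z \<in> ball a r" for z
    using that v6(3) by (simp add: dist_norm norm_mult norm_minus_commute)
  have rotk: "a + v ^ j * (z - a) \<in> ball a r" if "z \<in> ball a r" for z j
    using that v6(3) by (simp add: dist_norm norm_mult norm_power norm_minus_commute)
  have p6rot: "p6 (a + v * (z - a)) = p6 z" for z
  proof -
    have "a + v * (z - a) = v * z + (1 - v) * a" by (simp add: algebra_simps)
    then have "p6 z = p6 (a + v * (z - a))" unfolding p6_eq_iff using v6 by blast
    then show ?thesis by simp
  qed
  have \<eta>nz: "\<eta> z \<noteq> 0" if "z \<in> ball a r - {a}" for z
  proof
    assume "\<eta> z = 0"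
    then have "\<psi> (p6 z) = \<psi> (p6 a)"
      using pow[of z] pow[of a] that r c(8,14) by (simp add: power_0_left \<eta>_def)
    moreover have "p6 z \<in> V" "p6 a \<in> V"
      using c(4) FU[of z] FU[of a] that r liftD(2)[OF F UNIV_I] by (metis DiffD1 centre_in_ball image_subset_iff)+
    ultimately have "p6 z = p6 a" using c(10) by (auto simp: inj_on_def)
    then have "(z - a) ^ ord6 a = 0" using r2(2)[of z a] that r c6.ord_pos[of a] by (simp add: power_0_left)
    then show False using that by simp
  qed
  define \<xi> where "\<xi> z = \<eta> (a + v * (z - a)) / \<eta> z" for z
  have \<xi>k: "\<xi> z ^ k = 1" if "z \<in> ball a r - {a}" for z
    using pow[of z] pow[OF rot[of z]] p6rot[of z] \<eta>nz[OF that] that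
    by (simp add: \<xi>_def power_divide) (metis power_not_zero right_inverse_eq)
  have "\<xi> constant_on (ball a r - {a})"
  proof (rule continuous_finite_range_constant)
    show "connected (ball a r - {a})" by (rule connected_punctured_ball) simp
    show "continuous_on (ball a r - {a}) \<xi>" unfolding \<xi>_def
    proof (intro continuous_intros continuous_on_subset[OF cont\<eta>] ballI \<eta>nz)
      show "continuous_on (ball a r - {a}) (\<lambda>z. \<eta> (a + v * (z - a)))"
        by (rule continuous_on_compose2[OF cont\<eta>]) (use rot in \<open>auto intro!: continuous_intros\<close>)
    qed auto
    have "\<xi> ` (ball a r - {a}) \<subseteq> {w. w ^ k = 1}" using \<xi>k by blast
    then show "finite (\<xi> ` (ball a r - {a}))"
      using finite_roots_unity[OF c(14)] finite_subset by blast
  qed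
  then obtain w where w: "\<And>z. z \<in> ball a r - {a} \<Longrightarrow> \<xi> z = w" unfolding constant_on_def by blast
  have step: "\<eta> (a + v * (z - a)) = w * \<eta> z" if "z \<in> ball a r - {a}" for z
    using w[OF that] \<eta>nz[OF that] by (simp add: \<xi>_def field_simps)
  have v0: "v \<noteq> 0" using v6 by auto
  have iter: "\<eta> (a + v ^ j * (z - a)) = w ^ j * \<eta> z" if "z \<in> ball a r - {a}" for z j
  proof (induction j)
    case (Suc j)
    have "a + v ^ j * (z - a) \<in> ball a r - {a}" using rotk[of z j] that v0 by auto
    from step[OF this] Suc show ?case by (simp add: mult.assoc)
  qed simp
  have ne: "ball a r - {a} \<noteq> {}"
  proof -
    have "a + of_real (r / 2) \<in> ball a r - {a}" using r(1) by (simp add: dist_norm)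
    then show ?thesis by blast
  qed
  \<comment> \<open>Uniqueness of lifts has to start from a generic point near
    \<open>a\<close>.\<close>
  then obtain z1 where z1: "z1 \<in> ball a r - {a}" "ord6 z1 = 1"
    using generic_point[of "ball a r - {a}"] by (metis open_ball open_delete)
  have "\<eta> (a + v ^ k * (z1 - a)) = \<eta> z1" using iter[OF z1(1), of k] \<xi>k[OF z1(1)] w[OF z1(1)] by simp
  moreover have "F (a + v ^ k * (z1 - a)) \<in> U" "F z1 \<in> U" using FU rotk z1 by auto
  ultimately have eq: "F (a + v ^ k * (z1 - a)) = F z1"
    using c(7) unfolding \<eta>_def homeomorphism_def by metis
  have vk: "(v ^ k) ^ ord6 a = 1" using v1 by (metis mult.commute power_mult power_one)
  then have "(v ^ k) ^ 6 = 1" "(1 - v ^ k) * a \<in> eis" using c6.unit_ord[OF vk] ord6_stab by blast+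
  note L = lift_compose[OF F this]
  have "a + v ^ k * (z - a) = v ^ k * z + (1 - v ^ k) * a" for z by (simp add: algebra_simps)
  then have "(\<lambda>z. F (v ^ k * z + (1 - v ^ k) * a)) = F" using lift_eqI[OF L F z1(2)] eq by simp
  then show ?thesis unfolding u_def v_def[symmetric]
    using \<open>\<And>z. a + v ^ k * (z - a) = v ^ k * z + (1 - v ^ k) * a\<close> by (metis (no_types))
qed

text \<open>Otherwise \<open>F\<close> would factor through \<^const>\<open>p6\<close> near \<open>a\<close> and yield a continuous \<open>k\<close>-th root on
  a neighbourhood of \<open>0\<close>.\<close>

lemma lift_rotation_not_invariant:
  assumes F: "lift_on UNIV F" and k: "has_local_degree sphtop sphtop f (F a) k" "k \<ge> 2"
  shows "\<exists>z. F (a + exp (2 * pi * \<i> / ord6 a) * (z - a)) \<noteq> F z"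
proof (rule ccontr)
  assume "\<nexists>z. F (a + exp (2 * pi * \<i> / ord6 a) * (z - a)) \<noteq> F z"
  then have inv: "F (a + exp (2 * pi * \<i> / ord6 a) * (z - a)) = F z" for z by blast
  define n where "n = ord6 a"
  have n0: "n > 0" unfolding n_def by (rule c6.ord_pos)
  have invj: "F (a + exp (2 * pi * \<i> / n) ^ j * (z - a)) = F z" for z j
  proof (induction j)
    case (Suc j)
    then show ?case using inv[of "a + exp (2 * pi * \<i> / n) ^ j * (z - a)"] by (simp add: n_def mult.assoc)
  qed simp
  have unit: "F (a + u * (z - a)) = F z" if u: "u ^ n = 1" for u z
  proof -
    have "u \<in> {exp (2 * of_real pi * \<i> * of_nat j / of_nat n) | j. j < n}"
      unfolding complex_roots_unity[of n, symmetric, OF n0[unfolded less_eq_Suc_le One_nat_def[symmetric]]] using u by simp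
    then obtain j where "u = exp (2 * of_real pi * \<i> * of_nat j / of_nat n)" by blast
    then have "u = exp (2 * pi * \<i> / n) ^ j" by (simp add: exp_of_nat_mult[symmetric] algebra_simps)
    then show ?thesis using invj by simp
  qed
  obtain U V A B \<phi> \<phi>' \<psi> \<psi>' where c: "openin sphtop U" "F a \<in> U" "openin sphtop V" "f ` U \<subseteq> V" "open (A :: complex set)" "open (B :: complex set)"
    "homeomorphism U A \<phi> \<phi>'" "\<phi> (F a) = 0" "continuous_on V \<psi>" "inj_on \<psi> V" "\<psi> ` V = B" "\<psi> (f (F a)) = 0" "\<forall>u\<in>U. \<psi> (f u) = \<phi> u ^ k" "k \<ge> 1" "homeomorphism V B \<psi> \<psi>'"
    using chart_f[OF k(1)] .
  obtain r where r: "r > 0" "\<And>z w. z \<in> ball a r \<Longrightarrow> w \<in> ball a r \<Longrightarrow>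
    p6 z = p6 w \<longleftrightarrow> (z - a) ^ n = (w - a) ^ n" using c6.local_form unfolding n_def by blast
  have F_p6: "F z = F w" if "z \<in> ball a r" "w \<in> ball a r" "p6 z = p6 w" for z w
  proof (cases "z = a")
    case True
    then show ?thesis using r(2)[OF that(1,2)] that(3) n0 by (auto simp: power_0_left split: if_splits)
  next
    case False
    define u where "u = (w - a) / (z - a)"
    have eq: "(z - a) ^ n = (w - a) ^ n" using r(2)[OF that(1,2)] that(3) by simp
    have "u ^ n = 1" using eq[symmetric] False by (simp add: u_def power_divide)
    moreover have "w = a + u * (z - a)" using False by (simp add: u_def)
    ultimately show ?thesis using unit[of u z] by simp
  qed
  define O' where "O' = p6 ` ball a r"
  define g where "g y = F (SOME z. z \<in> ball a r \<and> p6 z = y)" for y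
  have g: "g (p6 z) = F z" if "z \<in> ball a r" for z
  proof -
    have "(SOME w. w \<in> ball a r \<and> p6 w = p6 z) \<in> ball a r \<and> p6 (SOME w. w \<in> ball a r \<and> p6 w = p6 z) = p6 z"
      by (rule someI[of _ z]) (use that in simp)
    then show ?thesis unfolding g_def using F_p6 that by blast
  qed
  have cF: "continuous_on UNIV F" using F by (simp add: lift_on_def)
  have og: "openin sphtop {y\<in>O'. g y \<in> T}" if "open T" for T
  proof -
    have "open (ball a r \<inter> F -` T)" using cF that by (simp add: open_vimage open_Int)
    then have "openin sphtop (p6 ` (ball a r \<inter> F -` T))" by (rule c6.open_map)
    moreover have "p6 ` (ball a r \<inter> F -` T) = {y\<in>O'. g y \<in> T}" using g by (auto simp: O'_def)
    ultimately show ?thesis by simp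
  qed
  obtain T where T: "open T" "U = sph \<inter> T" using c(1) by (auto simp: openin_open)
  \<comment> \<open>On \<open>V1\<close> the factor \<open>g\<close> of \<open>F\<close> through
    \<open>p6\<close> stays in the domain \<open>U\<close> of the chart and is a section of
    \<open>f\<close>.\<close>
  define V1 where "V1 = V \<inter> {y\<in>O'. g y \<in> T}"
  have oV1: "openin sphtop V1" unfolding V1_def using og[OF T(1)] c(3) by blast
  have gU: "g y \<in> U \<and> f (g y) = y" if "y \<in> V1" for y
  proof -
    from that obtain z where z: "z \<in> ball a r" "y = p6 z" by (auto simp: V1_def O'_def)
    then have "g y = F z" using g by simp
    then show ?thesis using that z(2) liftD[OF F UNIV_I, of z] T(2) by (auto simp: V1_def)
  qed
  have fa: "f (F a) = p6 a" using liftD(2)[OF F UNIV_I] .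
  have aV: "p6 a \<in> V" using c(2,4) fa by (metis imageI subsetD)
  have aV1: "p6 a \<in> V1"
    using aV r(1) c(2,4) T(2) g[of a] fa by (auto simp: V1_def O'_def)
  have cg: "continuous_on V1 g"
  proof (subst continuous_on_open_invariant, intro allI impI)
    fix T' :: "(complex \<times> real) set" assume "open T'"
    then have "openin sphtop {y\<in>O'. g y \<in> T'}" by (rule og)
    then obtain T2 where "open T2" "{y\<in>O'. g y \<in> T'} = sph \<inter> T2" by (auto simp: openin_open)
    moreover have "V1 \<subseteq> sph" "V1 \<subseteq> O'" using oV1 openin_imp_subset by (blast, auto simp: V1_def)
    ultimately show "\<exists>A. open A \<and> A \<inter> V1 = g -` T' \<inter> V1" by (intro exI[of _ T2]) blast
  qed
  define B1 where "B1 = \<psi> ` V1"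
  have V1: "V1 \<subseteq> V" by (auto simp: V1_def)
  have "openin (top_of_set V) V1" using oV1 c(3) V1 openin_subset_trans openin_imp_subset by metis
  then have "openin (top_of_set B) B1" unfolding B1_def using homeomorphism_imp_open_map c(15) by blast
  then have "open B1" using c(6) openin_open_eq by blast
  moreover have "0 \<in> B1" unfolding B1_def using aV1 c(12) fa by force
  ultimately obtain e where e: "e > 0" "ball 0 e \<subseteq> B1" using openE by blast
  have inv: "\<psi>' b \<in> V1 \<and> \<psi> (\<psi>' b) = b" if "b \<in> ball 0 e" for b
  proof -
    have "b \<in> B1" using that e(2) by blast
    then obtain y where "y \<in> V1" "b = \<psi> y" unfolding B1_def by blast
    moreover from this have "\<psi>' b = y" using V1 c(15) unfolding homeomorphism_def by auto
    ultimately show ?thesis by simp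
  qed
  have "B1 \<subseteq> B" using V1 c(11) by (auto simp: B1_def)
  then have c\<psi>': "continuous_on (ball 0 e) \<psi>'" using e(2) c(15) continuous_on_subset unfolding homeomorphism_def by (metis subset_trans)
  show False
  proof (rule no_continuous_root[OF e(1) k(2), of "\<lambda>b. \<phi> (g (\<psi>' b))"])
    have cg': "continuous_on (ball 0 e) (\<lambda>b. g (\<psi>' b))" by (rule continuous_on_compose2[OF cg c\<psi>']) (use inv in blast)
    have "continuous_on U \<phi>" using c(7) by (simp add: homeomorphism_def)
    then show "continuous_on (ball 0 e) (\<lambda>b. \<phi> (g (\<psi>' b)))"
      by (rule continuous_on_compose2[OF _ cg']) (use gU inv in blast)
    fix b :: complex assume b: "b \<in> ball 0 e"
    have gb: "g (\<psi>' b) \<in> U" using gU inv[OF b] by blast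
    have "\<phi> (g (\<psi>' b)) ^ k = \<psi> (f (g (\<psi>' b)))" using bspec[OF c(13) gb] by simp
    also have "f (g (\<psi>' b)) = \<psi>' b" using gU inv[OF b] by blast
    also have "\<psi> (\<psi>' b) = b" using inv[OF b] by blast
    finally show "\<phi> (g (\<psi>' b)) ^ k = b" .
  qed
qed

text \<open>The translations fixing \<open>F\<close> form an ideal \<open>m\<close> since \<open>F\<close> is fixed by a rotation of order 3. As no
  lift is fixed by a rotation of order 6, the lifts \<open>z \<mapsto> F (z + b)\<close> and \<open>z \<mapsto> F (b - z)\<close> are different
  and form two orbits of size \<open>\<bar>m\<bar>\<^sup>2\<close>.\<close>

lemma degree_from_lattice:
  assumes a: "ord6 a = 1" and F: "lift_on UNIV F"
    and rot: "b0 \<in> eis" "\<And>z. F (\<omega> * z + b0) = F z"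
    and no6: "\<And>G b. lift_on UNIV G \<Longrightarrow> b \<in> eis \<Longrightarrow> \<exists>z. G ((1 + \<omega>) * z + b) \<noteq> G z"
  shows "\<exists>m\<in>eis. real (card {x\<in>sph. f x = p6 a}) = 2 * (cmod m)\<^sup>2"
proof -
  define LL where "LL = {G. lift_on UNIV G}"
  have card: "card LL = card {x\<in>sph. f x = p6 a}" "finite LL"
    using bij_betw_same_card[OF card_lifts[OF a]] bij_betw_finite[OF card_lifts[OF a]] fin_f[OF c6.p_in_sph]
    unfolding LL_def by auto
  define T where "T b = (\<lambda>z. F (1 * z + b))" for b
  define T' where "T' b = (\<lambda>z. F ((- 1) * z + b))" for b
  have TL: "T b \<in> LL" "T' b \<in> LL" if "b \<in> eis" for b
    unfolding LL_def T_def T'_def using lift_compose[OF F _ that, of 1] lift_compose[OF F _ that, of "- 1"] by simp_all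
  define I where "I = {b\<in>eis. \<forall>z. F (z + b) = F z}"
  have T_eq: "T b = T c \<longleftrightarrow> b - c \<in> I" if "b \<in> eis" "c \<in> eis" for b c
  proof
    assume eq: "T b = T c"
    have "F (z + (b - c)) = F z" for z using fun_cong[OF eq, of "z - c"] by (simp add: T_def algebra_simps)
    then show "b - c \<in> I" using that by (auto simp: I_def)
  next
    assume "b - c \<in> I"
    then have "F (z + c + (b - c)) = F (z + c)" for z unfolding I_def by blast
    then have "F (z + b) = F (z + c)" for z by simp
    then have "T b z = T c z" for z by (simp only: T_def mult_1)
    then show "T b = T c" by (rule ext)
  qed
  have T'_eq: "T' b = T' c \<longleftrightarrow> T b = T c" for b c
  proof -
    have "T' b = (\<lambda>z. T b (- z))" "T b = (\<lambda>z. T' b (- z))" for b by (simp_all add: T_def T'_def add.commute)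
    then show ?thesis by metis
  qed
  have I: "I \<subseteq> eis" "\<And>x y. x \<in> I \<Longrightarrow> y \<in> I \<Longrightarrow> x - y \<in> I" "\<And>x. x \<in> I \<Longrightarrow> \<omega> * x \<in> I"
  proof -
    show "I \<subseteq> eis" by (auto simp: I_def)
    fix x y assume x: "x \<in> I" and y: "y \<in> I"
    have "F (z + (x - y)) = F z" for z
    proof -
      have "F (z - y + x) = F (z - y)" "F (z - y + y) = F (z - y)" using x y unfolding I_def by blast+
      then show ?thesis by (simp add: algebra_simps)
    qed
    then show "x - y \<in> I" using x y by (auto simp: I_def)
  next
    fix x assume x: "x \<in> I"
    have "F (z + \<omega> * x) = F z" for z
    proof -
      define w where "w = (z - b0) / \<omega>"
      have w: "z = \<omega> * w + b0" by (simp add: w_def)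
      have "z + \<omega> * x = \<omega> * (w + x) + b0" by (simp add: w algebra_simps)
      then have "F (z + \<omega> * x) = F (w + x)" using rot(2) by simp
      also have "\<dots> = F w" using x unfolding I_def by blast
      also have "\<dots> = F z" using rot(2)[of w] w by simp
      finally show ?thesis .
    qed
    then show "\<omega> * x \<in> I" using x by (auto simp: I_def)
  qed
  have nz: "\<exists>x\<in>I. x \<noteq> 0"
  proof -
    \<comment> \<open>There are only finitely many lifts, so two different translations give the
      same one.\<close>
    have "\<not> inj_on T eis"
    proof
      assume "inj_on T eis"
      moreover have "T ` eis \<subseteq> LL" using TL by blast
      ultimately have "finite eis" using card(2) finite_subset finite_imageD by metis
      moreover have "range (of_nat :: nat \<Rightarrow> complex) \<subseteq> eis" by auto
      ultimately have "finite (range (of_nat :: nat \<Rightarrow> complex))" using finite_subset by blast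
      then show False using finite_imageD[OF _ inj_of_nat] by auto
    qed
    then obtain b c where "b \<in> eis" "c \<in> eis" "T b = T c" "b \<noteq> c" unfolding inj_on_def by blast
    then show ?thesis using T_eq by (intro bexI[of _ "b - c"]) auto
  qed
  obtain m where m: "m \<in> eis" "m \<noteq> 0" "I = (*) m ` eis" using eis_ideal_principal[OF I nz] by blast
  obtain R where R: "eis_reps m R" using eis_reps_exist[OF m(1,2)] by blast
  note Rc = eis_reps_card[OF m(1,2) R]
  have Rs: "R \<subseteq> eis" by (rule eis_reps_subset[OF R])
  have mod_iff: "eis_mod m b c \<longleftrightarrow> b - c \<in> I" for b c unfolding eis_mod_def m(3) by blast
  have injT: "inj_on T R"
  proof (rule inj_onI)
    fix b c assume "b \<in> R" "c \<in> R" "T b = T c"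
    then have "eis_mod m b c" using T_eq mod_iff Rs by blast
    then show "b = c" using eis_reps_unique[OF R] \<open>b \<in> R\<close> \<open>c \<in> R\<close> by blast
  qed
  have injT': "inj_on T' R" using injT T'_eq unfolding inj_on_def by blast
  have TR: "T b \<in> T ` R" "T' b \<in> T' ` R" if b: "b \<in> eis" for b
  proof -
    obtain r where r: "r \<in> R" "eis_mod m b r" using eis_reps_ex[OF R b] by blast
    then have "T b = T r" using T_eq mod_iff b Rs by blast
    then show "T b \<in> T ` R" "T' b \<in> T' ` R" using r(1) T'_eq by blast+
  qed
  have disj: "T ` R \<inter> T' ` R = {}"
  proof (rule ccontr)
    assume "T ` R \<inter> T' ` R \<noteq> {}"
    then obtain G where "G \<in> T ` R" "G \<in> T' ` R" by blast
    then obtain b c where bc: "b \<in> R" "c \<in> R" and "G = T b" "G = T' c" by blast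
    then have eq: "T b = T' c" by simp
    \<comment> \<open>A lift in both orbits makes \<open>F\<close> invariant under the half-turn z
      \<mapsto> d - z. With the rotation of order 3 this gives one by 1 + \<omega> = - \<omega>^2,
      of order 6.\<close>
    define d where "d = b + c"
    have d: "d \<in> eis" using bc Rs by (auto simp: d_def)
    have Fd: "F (d - z) = F z" for z
      using fun_cong[OF eq, of "z - b"] by (simp add: T_def T'_def d_def algebra_simps)
    have "F ((1 + \<omega>) * z + (d - (\<omega> * b0 + b0))) = F z" for z
    proof -
      have "(1 + \<omega>) * z = - (\<omega> * \<omega>) * z" by (simp add: omega_square)
      then have "(1 + \<omega>) * z + (d - (\<omega> * b0 + b0)) = d - (\<omega> * (\<omega> * z + b0) + b0)" by (simp add: algebra_simps)
      then have "F ((1 + \<omega>) * z + (d - (\<omega> * b0 + b0))) = F (d - (\<omega> * (\<omega> * z + b0) + b0))" by (rule arg_cong)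
      also have "\<dots> = F z" unfolding Fd rot(2) ..
      finally show ?thesis .
    qed
    moreover have "d - (\<omega> * b0 + b0) \<in> eis" using d rot(1) eis_omega by blast
    ultimately show False using no6[OF F] by blast
  qed
  have "LL = T ` R \<union> T' ` R"
  proof (rule subset_antisym; rule subsetI)
    fix G assume "G \<in> LL"
    then have "lift_on UNIV G" by (simp add: LL_def)
    then obtain u b where u: "u ^ 6 = 1" and b: "b \<in> eis" and G: "G = (\<lambda>z. F (u * z + b))" using lifts_transitive[OF F] by blast
    have w: "(1 + \<omega>) = - (\<omega> * \<omega>)" "- 1 - \<omega> = \<omega> * \<omega>" by (simp_all add: omega_square)
    \<comment> \<open>A factor \<open>\<omega>\<close> is removed at the cost of another
      translation, which reduces the six rotation parts to 1 and - 1.\<close>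
    have red: "\<exists>c\<in>eis. \<forall>z. F (\<omega> * v * z + b) = F (v * z + c)" if "b \<in> eis" for v b
    proof (intro bexI allI)
      fix z
      have "\<omega> * v * z + b = \<omega> * (v * z + (- 1 - \<omega>) * (b - b0)) + b0"
      proof -
        have "\<omega> * ((- 1 - \<omega>) * (b - b0)) = (- \<omega> - \<omega> * \<omega>) * (b - b0)" by (simp add: algebra_simps)
        also have "\<dots> = b - b0" by (simp add: omega_square)
        finally show ?thesis by (simp add: algebra_simps)
      qed
      then show "F (\<omega> * v * z + b) = F (v * z + (- 1 - \<omega>) * (b - b0))" using rot(2) by simp
      have "- 1 - \<omega> \<in> eis" by (intro eis_diff) auto
      then show "(- 1 - \<omega>) * (b - b0) \<in> eis" using that rot(1) by blast
    qed
    obtain s c where s: "s = 1 \<or> s = - 1" and c: "c \<in> eis" and Gs: "\<And>z. G z = F (s * z + c)"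
    proof -
      consider (1) "u = 1 \<or> u = - 1" | (2) s where "s = 1 \<or> s = - 1" "u = \<omega> * s" | (3) s where "s = 1 \<or> s = - 1" "u = \<omega> * (\<omega> * s)"
        using u unfolding root_unity_6 insert_iff empty_iff w by fastforce
      then show thesis
      proof cases
        case 1 then show thesis using that b G by blast
      next
        case 2
        obtain c where "c \<in> eis" "\<forall>z. F (\<omega> * s * z + b) = F (s * z + c)" using red[OF b] by blast
        then show thesis using that[of s c] 2 G by simp
      next
        case 3
        obtain c where c: "c \<in> eis" "\<forall>z. F (\<omega> * (\<omega> * s) * z + b) = F (\<omega> * s * z + c)" using red[OF b] by blast
        obtain c' where "c' \<in> eis" "\<forall>z. F (\<omega> * s * z + c) = F (s * z + c')" using red[OF c(1)] by blast
        then show thesis using that[of s c'] 3 G c by simp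
      qed
    qed
    have "G = T c \<or> G = T' c" using s Gs by (auto simp: T_def T'_def)
    then show "G \<in> T ` R \<union> T' ` R" using TR[OF c] by blast
  next
    fix G assume "G \<in> T ` R \<union> T' ` R"
    then show "G \<in> LL" using TL Rs by blast
  qed
  then have "card LL = 2 * card R"
    using card_Un_disjoint[OF _ _ disj] Rc(1) card_image[OF injT] card_image[OF injT'] by simp
  then show ?thesis using card(1) Rc(2) m(1) by (intro bexI[of _ m]) auto
qed

text \<open>A local degree 2 over the value of order 6 lets the square of the rotation fix a lift,
  and a local degree 1 over the value of order 3 lets the rotation itself do so: either way a
  rotation of order 3. A rotation by 1 + \<omega> has its centre in \<open>eis\<close>, where the
  local degree is at least 2, and so fixes no lift.\<close>

lemma degree_is_norm:
  assumes a: "ord6 a = 1"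
    and deg6: "\<And>x. x \<in> sph \<Longrightarrow> f x = p6 0 \<Longrightarrow> \<exists>k\<ge>2. has_local_degree sphtop sphtop f x k"
    and special: "(\<exists>x\<in>sph. f x = p6 0 \<and> has_local_degree sphtop sphtop f x 2) \<or>
      (\<exists>x\<in>sph. f x = p6 (1 / \<theta>) \<and> has_local_degree sphtop sphtop f x 1)"
  shows "\<exists>m\<in>eis. real (card {x\<in>sph. f x = p6 a}) = 2 * (cmod m)\<^sup>2"
proof -
  have e3: "exp (2 * pi * \<i> / 3) = \<omega>"
  proof -
    have "exp (2 * pi * \<i> / 3) = cis (2 * pi / 3)" by (simp add: cis_conv_exp mult_ac)
    also have "\<dots> = \<omega>" using cos_120 sin_120 by (simp add: omega_def complex_eq_iff)
    finally show ?thesis .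
  qed
  have e6: "exp (2 * pi * \<i> / 6) = 1 + \<omega>"
  proof -
    have "exp (2 * pi * \<i> / 6) = cis (pi / 3)" by (simp add: cis_conv_exp mult_ac)
    also have "\<dots> = 1 + \<omega>" using cos_60 sin_60 by (simp add: omega_def complex_eq_iff)
    finally show ?thesis .
  qed
  have "\<exists>F b0. lift_on UNIV F \<and> b0 \<in> eis \<and> (\<forall>z. F (\<omega> * z + b0) = F z)"
    using special
  proof
    assume "\<exists>x\<in>sph. f x = p6 0 \<and> has_local_degree sphtop sphtop f x 2"
    then obtain x where x: "x \<in> sph" "f x = p6 0" "has_local_degree sphtop sphtop f x 2" by blast
    obtain F where F: "lift_on UNIV F" "F 0 = x" using global_lift'[OF x(1,2)] .
    have "(1 + \<omega>) ^ 2 = \<omega>" by (simp add: power2_eq_square algebra_simps omega_square)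
    then have "F (\<omega> * z + 0) = F z" for z
      using lift_rotation_power[OF F(1), of 0 2 z] F(2) x(3) e6 ord6_special by simp
    then show ?thesis using F(1) eis_0 by blast
  next
    assume "\<exists>x\<in>sph. f x = p6 (1 / \<theta>) \<and> has_local_degree sphtop sphtop f x 1"
    then obtain x where x: "x \<in> sph" "f x = p6 (1 / \<theta>)" "has_local_degree sphtop sphtop f x 1" by blast
    obtain F where F: "lift_on UNIV F" "F (1 / \<theta>) = x" using global_lift'[OF x(1,2)] .
    have "F (\<omega> * z + 1) = F z" for z
    proof -
      have "c + \<omega> * (z - c) = \<omega> * z + \<theta> * c" for c by (simp add: algebra_simps)
      from this[of "1 / \<theta>"] have "1 / \<theta> + \<omega> * (z - 1 / \<theta>) = \<omega> * z + 1" by simp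
      then show ?thesis using lift_rotation_power[OF F(1), of "1 / \<theta>" 1 z] F(2) x(3) e3 ord6_special by simp
    qed
    then show ?thesis using F(1) eis_1 by blast
  qed
  then obtain F b0 where F: "lift_on UNIV F" "b0 \<in> eis" "\<And>z. F (\<omega> * z + b0) = F z" by blast
  have "\<exists>z. G ((1 + \<omega>) * z + b) \<noteq> G z" if G: "lift_on UNIV G" and b: "b \<in> eis" for G b
  proof -
    \<comment> \<open>The centre of the rotation, from - \<omega> c = b and the fact that 1 +
      \<omega> is the inverse of - \<omega>.\<close>
    define c where "c = (1 + \<omega>) * b"
    have c: "c \<in> eis" unfolding c_def using b by (intro eis_mult eis_add) auto
    then have oc: "ord6 c = 6" by (simp add: ord6_def)
    have "- \<omega> * c = b" by (simp add: c_def omega_square algebra_simps mult.assoc[symmetric])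
    moreover have "c + (1 + \<omega>) * (z - c) = (1 + \<omega>) * z + - \<omega> * c" for z by (simp add: algebra_simps)
    ultimately have eq: "c + (1 + \<omega>) * (z - c) = (1 + \<omega>) * z + b" for z by simp
    have "f (G c) = p6 0" using liftD(2)[OF G UNIV_I] ord6_6[OF oc] by simp
    then obtain k where k: "has_local_degree sphtop sphtop f (G c) k" "k \<ge> 2" using deg6 liftD(1)[OF G UNIV_I] by blast
    show ?thesis using lift_rotation_not_invariant[OF G k] unfolding oc using e6 eq by simp
  qed
  then show ?thesis by (rule degree_from_lattice[OF a F])
qed

end

text \<open>Without a spare point the sphere is a plane, where a homeomorphism that is the identity
  off a disc moves the points. Being the identity near the spare point, it extends.\<close>

lemma homeomorphism_sph_moving_points:
  assumes K: "finite K" and v: "\<And>i. i \<in> K \<Longrightarrow> v i \<in> sph" and w: "\<And>i. i \<in> K \<Longrightarrow> w i \<in> sph"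
    and inj: "inj_on v K" "inj_on w K"
  obtains h h' where "homeomorphism sph sph h h'" "\<And>i. i \<in> K \<Longrightarrow> h (v i) = w i"
proof -
  have "uncountable sph"
  proof
    assume "countable sph"
    then have "countable (\<Union>y\<in>sph. {z. p3 z = y})" using countable_p3_fibre by (intro countable_UN) auto
    moreover have "(\<Union>y\<in>sph. {z. p3 z = y}) = UNIV" using c3.p_in_sph by auto
    ultimately show False using uncountable_UNIV_complex by simp
  qed
  moreover have "countable (v ` K \<union> w ` K)" using K by (simp add: countable_finite)
  ultimately obtain b where b: "b \<in> sph" "b \<notin> v ` K \<union> w ` K" by (metis countable_subset subsetI)
  have "(sph - {b}) homeomorphic (UNIV :: complex set)"
    by (rule homeomorphic_punctured_sphere_affine) (use b in auto)
  then obtain \<phi> \<phi>' where \<phi>: "homeomorphism (sph - {b}) (UNIV :: complex set) \<phi> \<phi>'" unfolding homeomorphic_def by blast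
  have \<phi>c: "continuous_on (sph - {b}) \<phi>" "continuous_on UNIV \<phi>'" and \<phi>i: "\<And>x. x \<in> sph - {b} \<Longrightarrow> \<phi>' (\<phi> x) = x" "\<And>y. \<phi> (\<phi>' y) = y"
    and \<phi>'r: "range \<phi>' = sph - {b}"
    using \<phi> unfolding homeomorphism_def by auto
  have \<phi>'s: "\<phi>' y \<in> sph - {b}" for y using \<phi>'r by blast
  have pw: "pairwise (\<lambda>i j. \<phi> (v i) \<noteq> \<phi> (v j) \<and> \<phi> (w i) \<noteq> \<phi> (w j)) K"
  proof (rule pairwiseI)
    fix i j assume ij: "i \<in> K" "j \<in> K" "i \<noteq> j"
    have inb: "v i \<in> sph - {b}" "v j \<in> sph - {b}" "w i \<in> sph - {b}" "w j \<in> sph - {b}" using b v w ij by auto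
    have ne: "v i \<noteq> v j" "w i \<noteq> w j" using inj ij by (auto simp: inj_on_def)
    show "\<phi> (v i) \<noteq> \<phi> (v j) \<and> \<phi> (w i) \<noteq> \<phi> (w j)" using \<phi>i(1)[OF inb(1)] \<phi>i(1)[OF inb(2)] \<phi>i(1)[OF inb(3)] \<phi>i(1)[OF inb(4)] ne by auto
  qed
  obtain f g where fg: "homeomorphism (UNIV :: complex set) UNIV f g" "\<And>i. i \<in> K \<Longrightarrow> f (\<phi> (v i)) = \<phi> (w i)"
      and bd: "bounded {x. \<not> (f x = x \<and> g x = x)}"
  proof (rule homeomorphism_moving_points_exists[of "UNIV :: complex set" UNIV K "\<lambda>i. \<phi> (v i)" "\<lambda>i. \<phi> (w i)"], goal_cases)
    case (11 f g)
    show ?case by (rule 11(1)[OF 11(2,3,5)])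
  qed (use K pw in auto)
  obtain R where R: "{x. \<not> (f x = x \<and> g x = x)} \<subseteq> cball 0 R" using bounded_subset_ballD[OF bd, of 0] ball_subset_cball by blast
  define ext where "ext q x = (if x = b then b else \<phi>' (q (\<phi> x)))" for q x
  have cont_ext: "continuous_on sph (ext q)" if q: "continuous_on UNIV q" "\<And>x. x \<notin> cball 0 R \<Longrightarrow> q x = x" for q
  proof -
    define O' where "O' = sph - \<phi>' ` cball 0 R"
    have "compact (\<phi>' ` cball 0 R)" using continuous_on_subset[OF \<phi>c(2)] by (intro compact_continuous_image) auto
    then have "openin sphtop O'" unfolding O'_def
      using \<phi>'s by (intro openin_diff closed_subset compact_imp_closed) auto
    moreover have "openin sphtop (sph - {b})" using b by (intro openin_diff closed_subset) auto
    moreover have "b \<notin> range \<phi>'" using \<phi>'r by blast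
    then have "b \<in> O'" using b(1) unfolding O'_def by blast
    then have cover: "sph = O' \<union> (sph - {b})" using b by (auto simp: O'_def)
    moreover have "continuous_on O' (ext q)"
    proof (rule continuous_on_eq[of O' "\<lambda>x. x"])
      fix x assume x: "x \<in> O'"
      show "x = ext q x"
      proof (cases "x = b")
        case False
        then have "x \<in> sph - {b}" using x by (simp add: O'_def)
        moreover from this have "\<phi> x \<notin> cball 0 R" using x \<phi>i(1) unfolding O'_def by (metis DiffD2 image_eqI)
        ultimately show ?thesis using q(2) \<phi>i(1) by (simp add: ext_def)
      qed (simp add: ext_def)
    qed simp
    moreover have "continuous_on (sph - {b}) (ext q)"
    proof (rule continuous_on_eq[of _ "\<lambda>x. \<phi>' (q (\<phi> x))"])
      show "continuous_on (sph - {b}) (\<lambda>x. \<phi>' (q (\<phi> x)))"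
        by (intro continuous_on_compose2[OF \<phi>c(2)] continuous_on_compose2[OF q(1)] \<phi>c(1)) auto
    qed (simp add: ext_def)
    ultimately show ?thesis using continuous_on_Un_local_open[of O' "sph - {b}" "ext q"] by metis
  qed
  have fgi: "f (g x) = x" "g (f x) = x" "continuous_on UNIV f" "continuous_on UNIV g" for x
    using fg(1) unfolding homeomorphism_def by auto
  have inv: "ext q (ext q' x) = x" "ext q' x \<in> sph" if "x \<in> sph" "\<And>y. q (q' y) = y" for q q' x
    using that \<phi>i \<phi>'s b(1) by (auto simp: ext_def)
  have "homeomorphism sph sph (ext f) (ext g)"
  proof (rule homeomorphismI)
    show "continuous_on sph (ext f)" "continuous_on sph (ext g)" using R by (auto intro!: cont_ext fgi)
  qed (use inv[of _ f g] inv[of _ g f] fgi in \<open>auto\<close>)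
  moreover have "ext f (v i) = w i" if "i \<in> K" for i
  proof -
    have "v i \<noteq> b" "w i \<in> sph - {b}" using b w[OF that] that by auto
    then show ?thesis using fg(2)[OF that] \<phi>i(1) by (simp add: ext_def)
  qed
  ultimately show thesis using that by blast
qed

lemma image_mset_mset_set_add:
  assumes "image_mset f (mset_set B) = add_mset a M"
  obtains v where "v \<in> B" "f v = a" "image_mset f (mset_set (B - {v})) = M"
proof -
  have fin: "finite B" using assms by (metis empty_not_add_mset image_mset_empty mset_set.infinite)
  have "a \<in># image_mset f (mset_set B)" by (simp add: assms)
  then obtain v where v: "v \<in> B" "f v = a" using fin by auto
  have "mset_set B = add_mset v (mset_set (B - {v}))" using fin v(1) by (simp add: mset_set.remove)
  then have "add_mset a (image_mset f (mset_set (B - {v}))) = add_mset a M" using assms v(2) by simp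
  then show thesis using that v by simp
qed

text \<open>Moving the branching points to the cone values of \<open>p6\<close> turns the
  divisibility conditions on the partitions into the assumptions of \<open>lift_problem\<close>, and
  \<open>special\<close> supplies the rotation of order 3.\<close>

lemma realizable_degree_is_norm:
  assumes r: "realizable sphtop sphtop d {#M2, M3, M6#}"
    and M: "M2 \<noteq> {#}" "M3 \<noteq> {#}" "M6 \<noteq> {#}"
    and dvd: "\<And>k. k \<in># M2 \<Longrightarrow> k dvd 2" "\<And>k. k \<in># M3 \<Longrightarrow> k dvd 3" "\<And>k. k \<in># M6 \<Longrightarrow> k dvd 6 \<and> k \<ge> 2"
    and special: "2 \<in># M6 \<or> 1 \<in># M3"
  shows "\<exists>m\<in>eis. real d = 2 * (cmod m)\<^sup>2"
proof -
  obtain f where bc: "branched_cover sphtop sphtop f" and deg: "has_degree sphtop sphtop f d"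
    and Bs: "image_mset (local_degrees_over sphtop sphtop f) (mset_set (branching_points sphtop sphtop f)) = {#M2, M3, M6#}"
    using r unfolding realizable_def by blast
  define B where "B = branching_points sphtop sphtop f"
  let ?l = "local_degrees_over sphtop sphtop f" and ?ld = "local_degree sphtop sphtop f"
  have finB: "finite B" using Bs unfolding B_def[symmetric] by (metis empty_not_add_mset image_mset_empty mset_set.infinite)
  obtain v2 where v2: "v2 \<in> B" "?l v2 = M2" "image_mset ?l (mset_set (B - {v2})) = {#M3, M6#}"
    using image_mset_mset_set_add[OF Bs[folded B_def]] .
  obtain v3 where v3: "v3 \<in> B - {v2}" "?l v3 = M3" "image_mset ?l (mset_set (B - {v2} - {v3})) = {#M6#}"
    using image_mset_mset_set_add[OF v2(3)] .
  obtain v6 where v6: "v6 \<in> B - {v2} - {v3}" "?l v6 = M6" "image_mset ?l (mset_set (B - {v2} - {v3} - {v6})) = {#}"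
    using image_mset_mset_set_add[OF v3(3)] .
  have "B - {v2} - {v3} - {v6} = {}" using v6(3) finB by (simp add: mset_set_empty_iff)
  then have Beq: "B = {v2, v3, v6}" using v2(1) v3(1) v6(1) by blast
  have Bsph: "B \<subseteq> sph" by (auto simp: B_def branching_points_def)
  define v where "v i = (if i = (0::nat) then v2 else if i = 1 then v3 else v6)" for i
  define w where "w i = (if i = (0::nat) then p6 (1 / 2) else if i = 1 then p6 (1 / \<theta>) else p6 0)" for i
  have distinct: "p6 (1 / 2) \<noteq> p6 (1 / \<theta>)" "p6 (1 / 2) \<noteq> p6 0" "p6 (1 / \<theta>) \<noteq> p6 0"
    using ord6_orbit ord6_special by (metis numeral_eq_iff semiring_norm)+
  obtain h h' where h: "homeomorphism sph sph h h'" "\<And>i. i \<in> {0, 1, 2} \<Longrightarrow> h (v i) = w i"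
  proof (rule homeomorphism_sph_moving_points[of "{0, 1, 2::nat}" v w], goal_cases)
    case (2 i) then show ?case using Bsph v2(1) v3(1) v6(1) by (auto simp: v_def)
  next
    case (3 i) then show ?case using c6.p_in_sph by (auto simp: w_def)
  next
    case 4 then show ?case using v3(1) v6(1) by (auto simp: v_def inj_on_def)
  next
    case 5 then show ?case using distinct by (auto simp: w_def inj_on_def)
  next
    case (6 h h') show ?case by (rule 6(1)[OF 6(2,3)])
  qed simp
  have hv: "h v2 = p6 (1 / 2)" "h v3 = p6 (1 / \<theta>)" "h v6 = p6 0"
    using h(2)[of 0] h(2)[of 1] h(2)[of 2] by (simp_all add: v_def w_def)
  have hh: "continuous_on sph h" "continuous_on sph h'" "\<And>x. x \<in> sph \<Longrightarrow> h' (h x) = x" "\<And>x. x \<in> sph \<Longrightarrow> h (h' x) = x"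
    "h ` sph = sph" "h' ` sph = sph"
    using h(1) unfolding homeomorphism_def by auto
  have cf: "continuous_on sph f" and fs: "f ` sph \<subseteq> sph"
    using bc unfolding branched_cover_def by (auto simp: continuous_map_in_subtopology)
  define F where "F x = h (f x)" for x
  have hmaps: "homeomorphic_maps sphtop sphtop h h'"
    using hh unfolding homeomorphic_maps_def by (auto simp: continuous_map_in_subtopology)
  have idmap: "homeomorphic_map sphtop sphtop id" by (simp add: homeomorphic_map_id)
  have Fdeg: "has_local_degree sphtop sphtop F x (?ld x)" if "x \<in> sph" for x
    using has_local_degree_transfer[of sphtop sphtop f id x "?ld x" sphtop sphtop h h'] branched_cover_local_degree[OF bc, of x] hmaps idmap fs that
    by (simp add: F_def[abs_def] comp_def)
  have fibre_eq: "{x\<in>sph. F x = y} = fibre sphtop f (h' y)" if "y \<in> sph" for y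
  proof -
    have "F x = y \<longleftrightarrow> f x = h' y" if "x \<in> sph" for x
      using hh(3)[of "f x"] hh(4)[OF \<open>y \<in> sph\<close>] fs that unfolding F_def by (metis image_subset_iff)
    then show ?thesis by (auto simp: fibre_def)
  qed
  \<comment> \<open>\<open>mset_set\<close> of an infinite set is empty, so a nonempty partition
    over a branching point forces a finite fibre; elsewhere the degree does.\<close>
  have finv: "finite (fibre sphtop f y)" if "y \<in> sph" for y
  proof (cases "y \<in> B")
    case True
    then have "?l y \<noteq> {#}" using Beq v2(2) v3(2) v6(2) M by auto
    then show ?thesis by (metis image_mset_empty local_degrees_over_def mset_set.infinite)
  next
    case False
    then show ?thesis using deg that unfolding has_degree_def B_def by auto
  qed
  have mem: "?ld x \<in># ?l (f x)" if "x \<in> sph" for x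
  proof -
    have "f x \<in> sph" using subsetD[OF fs imageI[OF that]] .
    moreover have "x \<in> fibre sphtop f (f x)" using that by (auto simp: fibre_def)
    ultimately show ?thesis unfolding local_degrees_over_def using finv[of "f x"] by simp
  qed
  have preim: "f x = v" if "x \<in> sph" "F x = h v" "v \<in> B" for x v
    using that hh(3) fs Bsph unfolding F_def by (metis image_subset_iff subsetD)
  have ld6: "?ld x \<in># M6" if "x \<in> sph" "F x = p6 0" for x
    using mem[OF that(1)] preim[OF that(1), of v6] that hv Beq v6 by simp
  have ld3: "?ld x \<in># M3" if "x \<in> sph" "F x = p6 (1 / \<theta>)" for x
    using mem[OF that(1)] preim[OF that(1), of v3] that hv Beq v3 by simp
  have ld2: "?ld x \<in># M2" if "x \<in> sph" "F x = p6 (1 / 2)" for x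
    using mem[OF that(1)] preim[OF that(1), of v2] that hv Beq v2 by simp
  have ld1: "?ld x = 1" if "x \<in> sph" "F x = p6 z" "ord6 z = 1" for x z
  proof -
    have "f x \<notin> B"
    proof
      assume "f x \<in> B"
      then have "F x \<in> {p6 (1 / 2), p6 (1 / \<theta>), p6 0}" using Beq hv by (auto simp: F_def)
      then show False using that(2,3) ord6_orbit[of z "1 / 2"] ord6_orbit[of z "1 / \<theta>"] ord6_orbit[of z 0] ord6_special by auto
    qed
    moreover have "f x \<in> sph" using fs that(1) by blast
    moreover have "x \<in> fibre sphtop f (f x)" using that(1) by (simp add: fibre_def)
    ultimately have "\<not> ?ld x > 1" unfolding B_def branching_points_def topspace_euclidean_subtopology by blast
    moreover have "?ld x \<ge> 1" using Fdeg[OF that(1)] unfolding has_local_degree_def by blast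
    ultimately show ?thesis by simp
  qed
  interpret lift_problem F
  proof
    show "continuous_on sph F" unfolding F_def by (rule continuous_on_compose2[OF hh(1) cf fs])
    show "F ` sph \<subseteq> sph" using fs hh(5) by (auto simp: F_def)
    show "finite {x\<in>sph. F x = y}" if "y \<in> sph" for y
      unfolding fibre_eq[OF that] using that hh(6) by (intro finv) auto
    fix x z assume x: "x \<in> sph" "F x = p6 z"
    have "?ld x dvd ord6 z"
    proof -
      consider "ord6 z = 1" | "ord6 z = 6" | "ord6 z = 3" | "ord6 z = 2" unfolding ord6_def by metis
      then show ?thesis
      proof cases
        case 1 then show ?thesis using ld1[OF x] by simp
      next
        case 2 then show ?thesis using dvd(3) ld6 x ord6_6 by metis
      next
        case 3 then show ?thesis using dvd(2) ld3 x ord6_3 by metis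
      next
        case 4 then show ?thesis using dvd(1) ld2 x ord6_2 by metis
      qed
    qed
    then show "\<exists>k. has_local_degree sphtop sphtop F x k \<and> k dvd ord6 z" using Fdeg[OF x(1)] by blast
  qed
  obtain a where a: "ord6 a = 1" using generic_point[of UNIV] by auto
  have "h' (p6 a) \<notin> B"
  proof
    assume "h' (p6 a) \<in> B"
    then have "p6 a \<in> h ` B" using hh(4)[OF c6.p_in_sph] by (metis imageI)
    then have "p6 a \<in> {p6 (1 / 2), p6 (1 / \<theta>), p6 0}" using Beq hv by auto
    then show False using a ord6_orbit[of a "1 / 2"] ord6_orbit[of a "1 / \<theta>"] ord6_orbit[of a 0] ord6_special by auto
  qed
  moreover have "h' (p6 a) \<in> sph" using hh(6) c6.p_in_sph by blast
  ultimately have "card (fibre sphtop f (h' (p6 a))) = d" using deg unfolding has_degree_def B_def by auto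
  then have "card {x\<in>sph. F x = p6 a} = d" using fibre_eq[OF c6.p_in_sph] by simp
  moreover have "\<exists>m\<in>eis. real (card {x\<in>sph. F x = p6 a}) = 2 * (cmod m)\<^sup>2"
  proof (rule degree_is_norm[OF a])
    show "\<exists>k\<ge>2. has_local_degree sphtop sphtop F x k" if "x \<in> sph" "F x = p6 0" for x
      using Fdeg ld6 dvd(3) that by blast
    have ex: "\<exists>x\<in>sph. F x = h y \<and> ?ld x = k" if "k \<in># ?l y" "y \<in> B" for k y
    proof -
      have "finite (fibre sphtop f y)" using finv Bsph that(2) by blast
      with that(1) obtain x where "x \<in> fibre sphtop f y" "k = ?ld x" by (auto simp: local_degrees_over_def simp del: split_paired_Ex)
      then show ?thesis unfolding fibre_def F_def topspace_euclidean_subtopology by blast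
    qed
    show "(\<exists>x\<in>sph. F x = p6 0 \<and> has_local_degree sphtop sphtop F x 2) \<or>
      (\<exists>x\<in>sph. F x = p6 (1 / \<theta>) \<and> has_local_degree sphtop sphtop F x 1)"
      using special
    proof
      assume "2 \<in># M6"
      then obtain x where "x \<in> sph" "F x = p6 0" "?ld x = 2" using ex[of 2 v6] v6 hv by auto
      then show ?thesis using Fdeg[of x] by auto
    next
      assume "1 \<in># M3"
      then obtain x where "x \<in> sph" "F x = p6 (1 / \<theta>)" "?ld x = 1" using ex[of 1 v3] v3 hv by auto
      then show ?thesis using Fdeg[of x] by auto
    qed
  qed
  ultimately show ?thesis by simp
qed

section \<open>The standard sphere as a closed orientable surface\<close>

lemma two_sphere_homeomorphic_sph: "two_sphere homeomorphic_space sphtop"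
proof -
  define F :: "(nat \<Rightarrow> real) \<Rightarrow> complex \<times> real" where "F x = (Complex (x 0) (x 1), x 2)" for x
  define G :: "complex \<times> real \<Rightarrow> nat \<Rightarrow> real" where
    "G P i = (if i = 0 then Re (fst P) else if i = 1 then Im (fst P) else if i = 2 then snd P else 0)" for P i
  have top: "topspace two_sphere = {x. (x 0)\<^sup>2 + (x 1)\<^sup>2 + (x 2)\<^sup>2 = 1 \<and> (\<forall>i>2. x i = 0)}"
    by (simp add: nsphere numeral_2_eq_2)
  have normF: "(norm (F x))\<^sup>2 = (x 0)\<^sup>2 + (x 1)\<^sup>2 + (x 2)\<^sup>2" for x
    by (simp add: F_def norm_prod_def cmod_power2)
  have FS: "F x \<in> sph" if "x \<in> topspace two_sphere" for x
    using that normF[of x] unfolding top by (simp add: power2_eq_1_iff) (metis norm_ge_zero neg_0_le_iff_le not_one_le_zero)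
  have FG: "F (G P) = P" for P by (simp add: F_def G_def prod_eq_iff complex_eq_iff)
  have GT: "G P \<in> topspace two_sphere" if "P \<in> sph" for P
    using normF[of "G P"] that unfolding FG top by (auto simp: G_def)
  have GF: "G (F x) = x" if "x \<in> topspace two_sphere" for x
  proof
    fix i :: nat
    have "i = 0 \<or> i = 1 \<or> i = 2 \<or> i > 2" by auto
    then show "G (F x) i = x i" using that unfolding top by (auto simp: G_def F_def)
  qed
  have "continuous_on A (\<lambda>x::nat \<Rightarrow> real. (Complex (x 0) (x 1), x 2))" for A
    unfolding Complex_eq by (intro continuous_intros continuous_on_subset[OF continuous_on_product_coordinates subset_UNIV])
  then have "continuous_map two_sphere euclidean F"
    unfolding nsphere euclidean_product_topology F_def by simp
  then have "continuous_map two_sphere sphtop F" using FS by (auto simp: continuous_map_in_subtopology)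
  moreover have "continuous_map sphtop two_sphere G"
    unfolding nsphere
  proof (rule continuous_map_into_subtopology)
    show "continuous_map sphtop (powertop_real UNIV) G"
      unfolding continuous_map_componentwise_UNIV
    proof
      fix i
      have "continuous_on sph (\<lambda>P::complex \<times> real. G P i)"
        by (cases "i = 0"; cases "i = 1"; cases "i = 2") (simp_all add: G_def continuous_intros)
      then show "continuous_map sphtop euclideanreal (\<lambda>P. G P i)" by simp
    qed
    show "G \<in> topspace sphtop \<rightarrow> {x. (\<Sum>i\<le>2. (x i)\<^sup>2) = 1 \<and> (\<forall>i>2. x i = 0)}"
      using GT unfolding nsphere by auto
  qed
  ultimately show ?thesis unfolding homeomorphic_space_def homeomorphic_maps_def using FG GF by (intro exI[of _ F] exI[of _ G]) auto
qed

section \<open>Homology of the sphere, its Euler characteristic and its orientation\<close>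

lemma abelian_rank_trivial:
  assumes "comm_group G" "trivial_group G" shows "abelian_rank G = 0"
proof -
  interpret comm_group G by (rule assms(1))
  have c: "carrier G = {\<one>\<^bsub>G\<^esub>}" using assms(2) by (simp add: trivial_group_def)
  have empty: "B = {}" if "B \<subseteq> carrier G" "Z_independent G B" for B
  proof (rule ccontr)
    assume "B \<noteq> {}"
    then have B: "B = {\<one>\<^bsub>G\<^esub>}" using that(1) unfolding c by (simp add: subset_singleton_iff)
    have "finprod G (\<lambda>b. b [^]\<^bsub>G\<^esub> (1::int)) B = \<one>\<^bsub>G\<^esub>" unfolding B by simp
    then show False using spec[OF that(2)[unfolded Z_independent_def], of "\<lambda>_. 1"] B by simp
  qed
  have "Z_independent G {}" by (simp add: Z_independent_def)
  show ?thesis unfolding abelian_rank_def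
  proof (intro Greatest_equality)
    show "\<exists>B. finite B \<and> B \<subseteq> carrier G \<and> card B = 0 \<and> Z_independent G B"
      using \<open>Z_independent G {}\<close> by (intro exI[of _ "{}"]) simp
    show "y \<le> 0" if "\<exists>B. finite B \<and> B \<subseteq> carrier G \<and> card B = y \<and> Z_independent G B" for y
      using that empty by (metis card.empty order_refl)
  qed
qed

text \<open>Any two integers p, q satisfy the relation q * p - p * q = 0, so an independent set has
  at most one element.\<close>

lemma abelian_rank_integers:
  assumes "comm_group G" "G \<cong> integer_group" shows "abelian_rank G = 1"
proof -
  interpret comm_group G by (rule assms(1))
  obtain h where h: "h \<in> iso G integer_group" using assms(2) by (auto simp: is_iso_def)
  then have hom: "h \<in> hom G integer_group" and bij: "bij_betw h (carrier G) UNIV"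
    by (auto simp: iso_def)
  have hpow: "h (x [^]\<^bsub>G\<^esub> c) = c * h x" if "x \<in> carrier G" for x and c :: int
    using hom_int_pow[OF hom that is_group group_integer_group, of c] by simp
  have hmult: "h (x \<otimes>\<^bsub>G\<^esub> y) = h x + h y" if "x \<in> carrier G" "y \<in> carrier G" for x y
    using hom_mult[OF hom that] by simp
  have hone: "h \<one>\<^bsub>G\<^esub> = 0" using hmult[of "\<one>\<^bsub>G\<^esub>" "\<one>\<^bsub>G\<^esub>"] by simp
  have h0: "x = \<one>\<^bsub>G\<^esub>" if "x \<in> carrier G" "h x = 0" for x
    using bij that hone one_closed unfolding bij_betw_def inj_on_def by auto
  obtain g where g: "g \<in> carrier G" "h g = 1" using bij unfolding bij_betw_def by (metis UNIV_I imageE)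
  have "Z_independent G {g}" unfolding Z_independent_def
  proof (intro allI impI ballI)
    fix c :: "'a \<Rightarrow> int" and b
    assume "finprod G (\<lambda>b. b [^]\<^bsub>G\<^esub> c b) {g} = \<one>\<^bsub>G\<^esub>" and b: "b \<in> {g}"
    then have "g [^]\<^bsub>G\<^esub> c g = \<one>\<^bsub>G\<^esub>" using g by simp
    then have "c g * h g = 0" using hpow[OF g(1)] hone by metis
    then show "c b = 0" using g b by simp
  qed
  moreover have "card B \<le> 1" if B: "finite B" "B \<subseteq> carrier G" "Z_independent G B" for B
  proof (rule ccontr)
    assume "\<not> card B \<le> 1"
    then obtain x y where xy: "x \<in> B" "y \<in> B" "x \<noteq> y"
      using B(1) by (metis One_nat_def card_le_Suc0_iff_eq)
    have xc: "x \<in> carrier G" "y \<in> carrier G" using xy B(2) by auto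
    define c where "c b = (if b = x then h y else if b = y then - h x else 0)" for b
    have "finprod G (\<lambda>b. b [^]\<^bsub>G\<^esub> c b) B = finprod G (\<lambda>b. b [^]\<^bsub>G\<^esub> c b) {x, y}"
      by (rule finprod_mono_neutral_cong_right) (use B xy xc in \<open>auto simp: c_def\<close>)
    also have "\<dots> = x [^]\<^bsub>G\<^esub> h y \<otimes>\<^bsub>G\<^esub> y [^]\<^bsub>G\<^esub> (- h x)" using xy xc by (simp add: c_def)
    also have "\<dots> = \<one>\<^bsub>G\<^esub>"
      by (rule h0) (use xc in \<open>simp_all only: hmult hpow int_pow_closed m_closed\<close>, simp)
    finally have "\<forall>b\<in>B. c b = 0" using B(3) unfolding Z_independent_def by blast
    then have "c x = 0" "c y = 0" using xy by auto
    then have "h x = 0" "h y = 0" using xy(3) by (auto simp: c_def)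
    then show False using h0 xc xy(3) by metis
  qed
  ultimately show ?thesis unfolding abelian_rank_def
  proof (intro Greatest_equality)
    show "\<exists>B. finite B \<and> B \<subseteq> carrier G \<and> card B = 1 \<and> Z_independent G B"
      using g \<open>Z_independent G {g}\<close> by (intro exI[of _ "{g}"]) simp
  qed blast
qed

lemma sphere_path_connected: "path_connected_space two_sphere"
proof -
  have "path_connected sph" by (intro path_connected_sphere) simp
  then have "path_connectedin euclidean sph" by simp
  then have "path_connected_space sphtop" by (simp only: path_connectedin_def)
  then show ?thesis using two_sphere_homeomorphic_sph homeomorphic_path_connected_space by blast
qed

lemma nsphere_2_homology:
  "homology_group 0 two_sphere \<cong> integer_group" "trivial_group (homology_group 1 two_sphere)" "homology_group 2 two_sphere \<cong> integer_group"
proof -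
  show "homology_group 0 two_sphere \<cong> integer_group"
    by (rule isomorphic_integer_zeroth_homology_group) (use sphere_path_connected in auto)
  show "trivial_group (homology_group 1 two_sphere)"
    using reduced_homology_group_nsphere(2)[of 1 2] un_reduced_homology_group[of 1 two_sphere] by simp
  show "homology_group 2 two_sphere \<cong> integer_group"
    using reduced_homology_group_nsphere(1)[of 2] un_reduced_homology_group[of 2 two_sphere] by simp
qed

lemma euler_char_sphere:
  assumes "X homeomorphic_space two_sphere" shows "euler_char X = 2"
proof -
  have iso: "homology_group p X \<cong> homology_group p two_sphere" for p
    by (rule homeomorphic_space_imp_isomorphic_homology_groups[OF assms])
  have ab: "comm_group (homology_group p X)" for p
    by (simp add: abelian_homology_group)
  have "homology_group 0 X \<cong> integer_group" "homology_group 2 X \<cong> integer_group"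
    using iso_trans[OF iso] nsphere_2_homology by blast+
  moreover have "trivial_group (homology_group 1 X)"
    using isomorphic_group_triviality[OF iso[of 1]] nsphere_2_homology(2) by simp
  ultimately show ?thesis unfolding euler_char_def
    using abelian_rank_integers[OF ab] abelian_rank_trivial[OF ab] by simp
qed

lemma contractible_punctured_sphere:
  assumes "X homeomorphic_space two_sphere" "x \<in> topspace X"
  shows "contractible_space (subtopology X (topspace X - {x}))"
proof -
  have "X homeomorphic_space sphtop" using assms(1) two_sphere_homeomorphic_sph homeomorphic_space_trans by blast
  then obtain g where g: "homeomorphic_map X sphtop g" unfolding homeomorphic_space by blast
  have gx: "g x \<in> sph" using homeomorphic_imp_surjective_map[OF g] assms(2) by auto
  have "g ` (topspace X - {x}) = sph - {g x}"
    using homeomorphic_imp_surjective_map[OF g] homeomorphic_imp_injective_map[OF g] assms(2) unfolding inj_on_def by auto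
  then have "homeomorphic_map (subtopology X (topspace X - {x})) (subtopology sphtop (sph - {g x})) g"
    by (intro homeomorphic_map_subtopologies[OF g]) (auto simp: Int_absorb1)
  moreover have "subtopology sphtop (sph - {g x}) = top_of_set (sph - {g x})" by (simp add: subtopology_subtopology Int_absorb1)
  ultimately have 1: "subtopology X (topspace X - {x}) homeomorphic_space top_of_set (sph - {g x})"
    using homeomorphic_map_imp_homeomorphic_space by metis
  have "(sph - {g x}) homeomorphic (UNIV :: complex set)"
    by (rule homeomorphic_punctured_sphere_affine) (use gx in auto)
  then have "contractible (sph - {g x})"
    using homeomorphic_contractible_eq contractible_UNIV by blast
  then show ?thesis using homeomorphic_space_contractibility[OF 1] by (simp add: contractible_space_top_of_set)
qed

text \<open>The complement of a point is contractible, so the second homology maps isomorphically to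
  each local group. The images of one global generator form a consistent family, with the whole
  surface as the neighbourhood.\<close>

lemma orientable_sphere:
  assumes X: "X homeomorphic_space two_sphere" shows "orientable_surface X"
proof -
  have "homology_group 2 X \<cong> integer_group"
    using iso_trans[OF homeomorphic_space_imp_isomorphic_homology_groups[OF X]] nsphere_2_homology(3) by blast
  then have "cyclic_group (homology_group 2 X)"
    using isomorphic_group_cyclicity[of "homology_group 2 X" integer_group] by simp
  then obtain c where c: "c \<in> carrier (homology_group 2 X)" "generate (homology_group 2 X) {c} = carrier (homology_group 2 X)"
    unfolding cyclic_group_def using carrier_subgroup_generated[of "homology_group 2 X"] by (metis Int_insert_right_if1 Int_empty_right)
  define \<mu> where "\<mu> x = hom_induced 2 X {} X (topspace X - {x}) id c" for x
  have "local_orientation X \<mu>" unfolding local_orientation_def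
  proof (intro conjI ballI)
    fix x assume x: "x \<in> topspace X"
    let ?R = "relative_homology_group 2 X (topspace X - {x})"
    show "\<mu> x \<in> carrier ?R" unfolding \<mu>_def by (rule hom_induced_carrier)
    have ne: "topspace X \<inter> (topspace X - {x}) \<noteq> {}"
    proof
      assume "topspace X \<inter> (topspace X - {x}) = {}"
      then have "topspace X = {x}" using x by blast
      then have "trivial_group (reduced_homology_group 2 X)" by (rule homology_dimension_reduced)
      then have "trivial_group integer_group"
        using \<open>homology_group 2 X \<cong> integer_group\<close> isomorphic_group_triviality[of "homology_group 2 X" integer_group] un_reduced_homology_group[of 2 X] by simp
      then show False by simp
    qed
    have iso: "hom_induced 2 X {} X (topspace X - {x}) id \<in> iso (homology_group 2 X) ?R"
      using iso_reduced_homology_by_contractible[OF contractible_punctured_sphere[OF X x] ne, of 2] un_reduced_homology_group[of 2 X] by simp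
    then interpret group_hom "homology_group 2 X" ?R "hom_induced 2 X {} X (topspace X - {x}) id"
      unfolding group_hom_def group_hom_axioms_def by (simp add: iso_def)
    have "generate ?R (hom_induced 2 X {} X (topspace X - {x}) id ` {c}) = hom_induced 2 X {} X (topspace X - {x}) id ` generate (homology_group 2 X) {c}"
      using c(1) by (intro generate_img) simp
    also have "\<dots> = carrier ?R" unfolding c(2) using iso by (simp add: iso_def bij_betw_def)
    finally show "generate ?R {\<mu> x} = carrier ?R" by (simp add: \<mu>_def)
  next
    fix x assume x: "x \<in> topspace X"
    show "\<exists>U c. openin X U \<and> x \<in> U \<and> c \<in> carrier (relative_homology_group 2 X (topspace X - U)) \<and>
        (\<forall>y\<in>U. hom_induced 2 X (topspace X - U) X (topspace X - {y}) id c = \<mu> y)"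
      using x c(1) by (intro exI[of _ "topspace X"] exI[of _ c]) (auto simp: \<mu>_def)
  qed
  then show ?thesis unfolding orientable_surface_def by blast
qed

text \<open>The charts of the quotient map \<open>p3\<close>, transported along a
  homeomorphism.\<close>

lemma locally_planar_sphere:
  assumes X: "X homeomorphic_space two_sphere" shows "locally_planar X"
  unfolding locally_planar_def
proof
  fix x assume x: "x \<in> topspace X"
  have "X homeomorphic_space sphtop" using assms(1) two_sphere_homeomorphic_sph homeomorphic_space_trans by blast
  then obtain g where g: "homeomorphic_map X sphtop g" unfolding homeomorphic_space by blast
  have "g x \<in> range p3" using homeomorphic_imp_surjective_map[OF g] x range_p3 by auto
  then obtain z0 where z0: "g x = p3 z0" by blast
  obtain r where r: "r > 0" "\<And>\<rho>. 0 < \<rho> \<Longrightarrow> \<rho> \<le> r \<Longrightarrow>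
    \<exists>\<phi>. homeomorphic_map (subtopology sphtop (p3 ` ball z0 \<rho>))
      (top_of_set ((\<lambda>z. (z - z0) ^ ord3 z0) ` ball z0 \<rho>)) \<phi> \<and> (\<forall>z\<in>ball z0 \<rho>. \<phi> (p3 z) = (z - z0) ^ ord3 z0)"
    using c3.chart by blast
  define U where "U = p3 ` ball z0 r"
  define A where "A = (\<lambda>z. (z - z0) ^ ord3 z0) ` ball z0 r"
  have U: "openin sphtop U" unfolding U_def by (rule c3.open_map) simp
  have A: "open A" unfolding A_def by (intro open_power_shift c3.ord_pos open_ball)
  obtain \<phi> where "homeomorphic_map (subtopology sphtop U) (top_of_set A) \<phi>" using r(2)[OF r(1) order_refl] unfolding U_def A_def by blast
  then have "subtopology sphtop U homeomorphic_space top_of_set A" by (rule homeomorphic_map_imp_homeomorphic_space)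
  moreover note V = homeomorphic_map_restrict[OF g U]
  ultimately have "subtopology X {x \<in> topspace X. g x \<in> U} homeomorphic_space top_of_set A"
    using homeomorphic_map_imp_homeomorphic_space[OF V(1)] homeomorphic_space_trans by blast
  moreover have "x \<in> {x \<in> topspace X. g x \<in> U}" using x z0 r(1) by (simp add: U_def)
  ultimately show "\<exists>U (A :: complex set). openin X U \<and> x \<in> U \<and> open A \<and> subtopology X U homeomorphic_space top_of_set A"
    using V(2) A by blast
qed

lemma sphere_is_closed_surface:
  assumes X: "X homeomorphic_space two_sphere" shows "closed_connected_orientable_surface X"
proof -
  have h: "X homeomorphic_space sphtop" using X two_sphere_homeomorphic_sph homeomorphic_space_trans by blast
  have "compact_space sphtop" by (simp add: compact_space_subtopology)
  then have "compact_space X" using homeomorphic_compact_space[OF h] by blast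
  moreover have "Hausdorff_space X" using homeomorphic_Hausdorff_space[OF h] by (simp add: Hausdorff_space_subtopology)
  moreover have "connected_space X"
    using homeomorphic_connected_space[OF X] sphere_path_connected path_connected_imp_connected_space by blast
  moreover have "topspace X \<noteq> {}"
  proof
    assume "topspace X = {}"
    then have "topspace sphtop = {}" using homeomorphic_empty_space[OF h] by (simp only: null_topspace_iff_trivial)
    then show False using c3.p_in_sph by auto
  qed
  ultimately show ?thesis unfolding closed_connected_orientable_surface_def
    using locally_planar_sphere[OF X] orientable_sphere[OF X] by blast
qed

text \<open>All four families at once: the \<open>a\<close> entries 1 and the \<open>b\<close>
  entries 2 are the three cone points of the source, distributed over two partitions.\<close>

definition sphere_data :: "nat \<Rightarrow> nat multiset multiset \<Rightarrow> bool" where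
  "sphere_data d Ps \<longleftrightarrow> (\<exists>n2 n3 n6 a b. n2 \<ge> 1 \<and> n3 \<ge> 1 \<and> n6 \<ge> 1 \<and> a + b = 3 \<and> d = 2 * n2 \<and> d = 3 * n3 + a \<and> d = 6 * n6 + 2 * b
    \<and> Ps = {# replicate_mset n2 2, replicate_mset n3 3 + replicate_mset a 1, replicate_mset n6 6 + replicate_mset b 2 #})"

lemma lcm_partitions:
  assumes "n \<ge> 1"
  shows "lcm_partition (replicate_mset n 2) = 2" "lcm_partition (replicate_mset n 3 + replicate_mset a 1) = 3"
    "lcm_partition (replicate_mset n 6 + replicate_mset b 2) = 6"
proof -
  have "set_mset (replicate_mset n (x::nat)) = {x}" for x using assms by auto
  moreover have "set_mset (replicate_mset a (1::nat)) = (if a = 0 then {} else {1})" "set_mset (replicate_mset b (2::nat)) = (if b = 0 then {} else {2})" by auto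
  ultimately show "lcm_partition (replicate_mset n 2) = 2" "lcm_partition (replicate_mset n 3 + replicate_mset a 1) = 3"
    "lcm_partition (replicate_mset n 6 + replicate_mset b 2) = 6" by (simp_all add: lcm_partition_def lcm_nat_def)
qed

lemma filter_replicate: "filter_mset P (replicate_mset n x) = (if P x then replicate_mset n x else {#})"
  by (induction n) auto

lemma replicate_mset_add: "replicate_mset (m + n) x = replicate_mset m x + replicate_mset n x"
  by (induction m) auto

lemma sphere_data_candidate:
  assumes "sphere_data d Ps" and X: "X homeomorphic_space two_sphere" and Y: "Y homeomorphic_space two_sphere"
  shows "candidate_surface_branched_cover X Y d Ps"
    and "induces_candidate_orbifold_cover X Y Ps (two_sphere, {#3, 3, 3#}) (two_sphere, {#2, 3, 6#})"
proof -
  obtain n2 n3 n6 a b where n: "n2 \<ge> 1" "n3 \<ge> 1" "n6 \<ge> 1" and ab: "a + b = 3" and d: "d = 2 * n2" "d = 3 * n3 + a" "d = 6 * n6 + 2 * b"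
    and Ps: "Ps = {# replicate_mset n2 2, replicate_mset n3 3 + replicate_mset a 1, replicate_mset n6 6 + replicate_mset b 2 #}"
    using assms(1) unfolding sphere_data_def by blast
  \<comment> \<open>Riemann-Hurwitz for two spheres and three partitions: their lengths add up to d
    + 2.\<close>
  have eq: "n2 + (n3 + a) + (n6 + b) = d + 2" using d ab by linarith
  show "candidate_surface_branched_cover X Y d Ps"
    unfolding candidate_surface_branched_cover_def euler_char_sphere[OF X] euler_char_sphere[OF Y]
  proof (intro conjI sphere_is_closed_surface X Y)
    show "2 \<le> d" using d n by simp
    show "1 \<le> size Ps" by (simp add: Ps)
    show "\<forall>P\<in>#Ps. is_partition d P \<and> (\<exists>e\<in>#P. 1 < e)"
      using n d by (auto simp: Ps is_partition_def)
    show "2 - int (\<Sum>P\<in>#Ps. size P) = int d * (2 - int (size Ps))"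
      using eq by (simp add: Ps)
  qed
  define P2 P3 P6 where "P2 = replicate_mset n2 (2::nat)" and "P3 = replicate_mset n3 (3::nat) + replicate_mset a 1"
    and "P6 = replicate_mset n6 (6::nat) + replicate_mset b 2"
  note P = this
  have l: "lcm_partition P2 = 2" "lcm_partition P3 = 3" "lcm_partition P6 = 6"
    unfolding P by (rule lcm_partitions, rule n)+
  have i: "image_mset (\<lambda>e. 2 div e) P2 = replicate_mset n2 1" "image_mset (\<lambda>e. 3 div e) P3 = replicate_mset n3 1 + replicate_mset a 3"
    "image_mset (\<lambda>e. 6 div e) P6 = replicate_mset n6 1 + replicate_mset b 3"
    by (simp_all add: P)
  have Ps': "Ps = {#P2, P3, P6#}" unfolding Ps P ..
  have "replicate_mset a 3 + replicate_mset b 3 = {#3, 3, 3::nat#}"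
    unfolding replicate_mset_add[symmetric] ab by (simp add: numeral_3_eq_3)
  then show "induces_candidate_orbifold_cover X Y Ps (two_sphere, {#3, 3, 3#}) (two_sphere, {#2, 3, 6#})"
    using X Y
    by (simp add: induces_candidate_orbifold_cover_def same_orbifold_def induced_total_def induced_base_def Ps' l i filter_replicate)
qed

lemma replicate_of_two_values:
  assumes "\<And>e. e \<in># P \<Longrightarrow> e = x \<or> e = y" "x \<noteq> y"
  shows "P = replicate_mset (count P x) x + replicate_mset (count P y) y"
  by (rule multiset_eqI) (use assms in \<open>auto simp: count_replicate_mset not_in_iff[symmetric]\<close>)

text \<open>The only nontrivial cone order of the source is 3, so each entry divides the lcm of its
  partition with quotient 1 or 3. This leaves the entry 2 for lcm 2, the entries 1 and 3 for lcm 3,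
  and the entries 2 and 6 for lcm 6.\<close>

lemma candidate_sphere_data:
  assumes cand: "candidate_surface_branched_cover X Y d Ps"
    and ind: "induces_candidate_orbifold_cover X Y Ps (two_sphere, {#3, 3, 3#}) (two_sphere, {#2, 3, 6#})"
  shows "X homeomorphic_space two_sphere" "Y homeomorphic_space two_sphere" "sphere_data d Ps"
proof -
  show "X homeomorphic_space two_sphere" "Y homeomorphic_space two_sphere"
    using ind by (auto simp: induces_candidate_orbifold_cover_def same_orbifold_def induced_total_def induced_base_def)
  have part: "is_partition d P" "\<exists>e\<in>#P. 1 < e" if "P \<in># Ps" for P
    using cand that unfolding candidate_surface_branched_cover_def by blast+
  have dvd: "e dvd lcm_partition P" if "e \<in># P" for e P
    using that by (simp add: lcm_partition_def)
  \<comment> \<open>Each partition has an entry above 1, so none is lost when orders 1 are dropped,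
    and there are exactly three.\<close>
  have "lcm_partition P \<noteq> 1" if "P \<in># Ps" for P
    using part(2)[OF that] dvd by (metis less_irrefl nat_dvd_1_iff_1)
  then have "filter_mset (\<lambda>p. p \<noteq> 1) (image_mset lcm_partition Ps) = image_mset lcm_partition Ps"
    by (intro filter_mset_eq_conv[THEN iffD2]) auto
  then have lcms: "image_mset lcm_partition Ps = {#2, 3, 6#}"
    using ind by (simp add: induces_candidate_orbifold_cover_def same_orbifold_def induced_base_def)
  obtain P2 Q2 where P2: "Ps = add_mset P2 Q2" "lcm_partition P2 = 2" "image_mset lcm_partition Q2 = {#3, 6#}"
    using msed_map_invR[OF lcms] by blast
  obtain P3 Q3 where P3: "Q2 = add_mset P3 Q3" "lcm_partition P3 = 3" "image_mset lcm_partition Q3 = {#6#}"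
    using msed_map_invR[OF P2(3)] by blast
  obtain P6 Q6 where P6: "Q3 = add_mset P6 Q6" "lcm_partition P6 = 6" "image_mset lcm_partition Q6 = {#}"
    using msed_map_invR[OF P3(3)] by blast
  have Ps: "Ps = {#P2, P3, P6#}" using P2(1) P3(1) P6(1,3) by simp
  have tot: "filter_mset (\<lambda>p. p \<noteq> 1) (image_mset (\<lambda>e. 2 div e) P2 + (image_mset (\<lambda>e. 3 div e) P3 + image_mset (\<lambda>e. 6 div e) P6)) = {#3, 3, 3#}"
    using ind by (simp add: induces_candidate_orbifold_cover_def same_orbifold_def induced_total_def Ps P2(2) P3(2) P6(2))
  have three: "p = 1 \<or> p = 3" if "p \<in># image_mset (\<lambda>e. 2 div e) P2 + (image_mset (\<lambda>e. 3 div e) P3 + image_mset (\<lambda>e. 6 div e) P6)" for p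
  proof (rule ccontr)
    assume "\<not> (p = 1 \<or> p = 3)"
    then have "p \<in># {#3, 3, 3::nat#}" using that unfolding tot[symmetric] by simp
    then show False using \<open>\<not> (p = 1 \<or> p = 3)\<close> by simp
  qed
  have e2: "e = 2" if "e \<in># P2" for e
  proof -
    have "e dvd 2" using dvd[OF that] P2(2) by simp
    then have "e = 1 \<or> e = 2" using prime_nat_iff two_is_prime_nat by blast
    moreover have "2 div e = 1 \<or> 2 div e = 3" using that by (intro three) auto
    ultimately show ?thesis by auto
  qed
  have e3: "e = 3 \<or> e = 1" if "e \<in># P3" for e
  proof -
    have "e dvd 3" using dvd[OF that] P3(2) by simp
    then have "e \<le> 3" "e \<noteq> 2" by (auto dest: dvd_imp_le)
    moreover have "e \<noteq> 0" using \<open>e dvd 3\<close> by (intro notI) simp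
    ultimately show ?thesis by linarith
  qed
  have e6: "e = 6 \<or> e = 2" if "e \<in># P6" for e
  proof -
    have "e dvd 6" using dvd[OF that] P6(2) by simp
    then obtain q where q: "6 = e * q" by (elim dvdE)
    have "6 div e = 1 \<or> 6 div e = 3" using that by (intro three) auto
    moreover have "6 div e = q" using q by (metis nonzero_mult_div_cancel_left mult_zero_left zero_neq_numeral)
    ultimately show ?thesis using q by auto
  qed
  define n2 n3 n6 a b where "n2 = count P2 2" "n3 = count P3 3" "n6 = count P6 6" "a = count P3 1" "b = count P6 2"
  have "P2 = replicate_mset (count P2 2) 2 + replicate_mset (count P2 0) 0" by (rule replicate_of_two_values) (use e2 in auto)
  moreover have "count P2 0 = 0" using e2[of 0] by (intro not_in_iff[THEN iffD1] notI) simp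
  ultimately have "P2 = replicate_mset n2 2" unfolding n2_n3_n6_a_b_def by simp
  have Q3: "P3 = replicate_mset n3 3 + replicate_mset a 1" unfolding n2_n3_n6_a_b_def by (rule replicate_of_two_values) (use e3 in auto)
  have Q6: "P6 = replicate_mset n6 6 + replicate_mset b 2" unfolding n2_n3_n6_a_b_def by (rule replicate_of_two_values) (use e6 in auto)
  note Q2 = \<open>P2 = replicate_mset n2 2\<close>
  have "replicate_mset (a + b) 3 = {#3, 3, 3::nat#}"
    using tot unfolding Q2 Q3 Q6 by (simp add: filter_replicate replicate_mset_add)
  then have ab: "a + b = 3" by (metis size_replicate_mset size_add_mset size_empty numeral_3_eq_3)
  have sums: "d = 2 * n2" "d = 3 * n3 + a" "d = 6 * n6 + 2 * b"
    using part(1)[of P2] part(1)[of P3] part(1)[of P6] by (simp_all add: Ps Q2 Q3 Q6 is_partition_def mult.commute)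
  have "d \<ge> 2" using cand by (simp add: candidate_surface_branched_cover_def)
  then have "n2 \<ge> 1" using sums by simp
  \<comment> \<open>Without an entry 3 the lcm would divide 1; likewise, without an entry 6 the last
    one would divide 2.\<close>
  moreover have "n3 \<ge> 1"
  proof (rule ccontr)
    assume "\<not> n3 \<ge> 1"
    then have "set_mset P3 \<subseteq> {1}" using Q3 by auto
    then have "lcm_partition P3 dvd 1" unfolding lcm_partition_def by (intro Lcm_least) auto
    then show False using P3(2) by simp
  qed
  moreover have "n6 \<ge> 1"
  proof (rule ccontr)
    assume "\<not> n6 \<ge> 1"
    then have "set_mset P6 \<subseteq> {2}" using Q6 by auto
    then have "lcm_partition P6 dvd 2" unfolding lcm_partition_def by (intro Lcm_least) auto
    then show False using P6(2) by simp
  qed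
  ultimately show "sphere_data d Ps" unfolding sphere_data_def
    using ab sums Ps Q2 Q3 Q6 by blast
qed

text \<open>Here \<open>k\<close> is the number of entries 6, and the number b = 0, 1, 2, 3 of
  entries 2 selects the family, with d = 6 k + 2 b.\<close>

lemma sphere_data_iff:
  "sphere_data d Ps \<longleftrightarrow> (\<exists>k\<ge>1.
     d = 6 * k \<and> Ps = {# replicate_mset (3 * k) 2, replicate_mset (2 * k - 1) 3 + {#1, 1, 1#}, replicate_mset k 6 #} \<or>
     d = 6 * k + 2 \<and> Ps = {# replicate_mset (3 * k + 1) 2, replicate_mset (2 * k) 3 + {#1, 1#}, replicate_mset k 6 + {#2#} #} \<or>
     d = 6 * k + 4 \<and> Ps = {# replicate_mset (3 * k + 2) 2, replicate_mset (2 * k + 1) 3 + {#1#}, replicate_mset k 6 + {#2, 2#} #} \<or>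
     d = 6 * k + 6 \<and> Ps = {# replicate_mset (3 * k + 3) 2, replicate_mset (2 * k + 2) 3, replicate_mset k 6 + {#2, 2, 2#} #})"
  (is "_ \<longleftrightarrow> (\<exists>k\<ge>1. ?R k)")
proof
  have r: "replicate_mset 1 x = {#x#}" "replicate_mset 2 x = {#x, x#}" "replicate_mset 3 x = {#x, x, x#}" for x :: nat
    by (simp_all add: numeral_2_eq_2 numeral_3_eq_3)
  {
    assume "sphere_data d Ps"
    then obtain n2 n3 n6 a b where n: "n2 \<ge> 1" "n3 \<ge> 1" "n6 \<ge> 1" and ab: "a + b = 3" and d: "d = 2 * n2" "d = 3 * n3 + a" "d = 6 * n6 + 2 * b"
      and Ps: "Ps = {# replicate_mset n2 2, replicate_mset n3 3 + replicate_mset a 1, replicate_mset n6 6 + replicate_mset b 2 #}"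
      unfolding sphere_data_def by blast
    have n2: "n2 = 3 * n6 + b" using d by linarith
    have n3: "n3 = 2 * n6 + b - 1" using d ab by linarith
    consider "a = 3" "b = 0" | "a = 2" "b = 1" | "a = 1" "b = 2" | "a = 0" "b = 3" using ab by linarith
    then have "?R n6"
    proof cases
      case 1 then show ?thesis unfolding Ps n2 n3 using d by (intro disjI1) (simp only: r add_0_right replicate_mset_0 mult_0_right HOL.simp_thms)
    next
      case 2
      have "2 * n6 + 1 - 1 = 2 * n6" by simp
      then show ?thesis unfolding Ps n2 n3 using d 2 by (intro disjI2[OF disjI1]) (simp only: r mult_1_right HOL.simp_thms)
    next
      case 3
      have "2 * n6 + 2 - 1 = 2 * n6 + 1" "(2::nat) * 2 = 4" by simp_all
      then show ?thesis unfolding Ps n2 n3 using d 3 by (intro disjI2[OF disjI2[OF disjI1]]) (simp only: r HOL.simp_thms)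
    next
      case 4
      have "2 * n6 + 3 - 1 = 2 * n6 + 2" "(2::nat) * 3 = 6" by simp_all
      then show ?thesis unfolding Ps n2 n3 using d 4 by (intro disjI2) (simp only: r add_0_right replicate_mset_0 HOL.simp_thms)
    qed
    then show "\<exists>k\<ge>1. ?R k" using n(3) by blast
  next
    assume "\<exists>k\<ge>1. ?R k"
    then obtain k where k: "k \<ge> 1" "?R k" by blast
    let ?ok = "\<lambda>n2 n3 a b. n2 \<ge> 1 \<and> n3 \<ge> 1 \<and> k \<ge> 1 \<and> a + b = 3 \<and> d = 2 * n2 \<and> d = 3 * n3 + a \<and> d = 6 * k + 2 * b
      \<and> Ps = {# replicate_mset n2 2, replicate_mset n3 3 + replicate_mset a 1, replicate_mset k 6 + replicate_mset b 2 #}"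
    from k(2) have "?ok (3 * k) (2 * k - 1) 3 0 \<or> ?ok (3 * k + 1) (2 * k) 2 1 \<or> ?ok (3 * k + 2) (2 * k + 1) 1 2 \<or> ?ok (3 * k + 3) (2 * k + 2) 0 3"
      (is "?A \<or> ?B \<or> ?C \<or> ?D")
    proof (elim disjE conjE)
      assume "d = 6 * k" "Ps = {# replicate_mset (3 * k) 2, replicate_mset (2 * k - 1) 3 + {#1, 1, 1#}, replicate_mset k 6 #}"
      then have ?A using k(1) unfolding r by (intro conjI) (auto)
      then show ?thesis ..
    next
      assume "d = 6 * k + 2" "Ps = {# replicate_mset (3 * k + 1) 2, replicate_mset (2 * k) 3 + {#1, 1#}, replicate_mset k 6 + {#2#} #}"
      then have ?B using k(1) unfolding r by (intro conjI) auto
      then show ?thesis by blast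
    next
      assume "d = 6 * k + 4" "Ps = {# replicate_mset (3 * k + 2) 2, replicate_mset (2 * k + 1) 3 + {#1#}, replicate_mset k 6 + {#2, 2#} #}"
      then have ?C using k(1) unfolding r by (intro conjI) auto
      then show ?thesis by blast
    next
      assume "d = 6 * k + 6" "Ps = {# replicate_mset (3 * k + 3) 2, replicate_mset (2 * k + 2) 3, replicate_mset k 6 + {#2, 2, 2#} #}"
      then have ?D using k(1) unfolding r by (intro conjI) auto
      then show ?thesis by blast
    qed
    then show "sphere_data d Ps" unfolding sphere_data_def by blast
  }
qed

section \<open>Degrees of realizable data as values of quadratic forms\<close>

lemma realizable_iff_sphere:
  assumes "X homeomorphic_space two_sphere" "Y homeomorphic_space two_sphere"
  shows "realizable X Y d Ps \<longleftrightarrow> realizable sphtop sphtop d Ps"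
proof -
  have h: "X homeomorphic_space sphtop" "Y homeomorphic_space sphtop"
    using assms two_sphere_homeomorphic_sph homeomorphic_space_trans by blast+
  then have "sphtop homeomorphic_space X" "sphtop homeomorphic_space Y" using homeomorphic_space_sym by blast+
  then show ?thesis using realizable_transfer[OF h] realizable_transfer[of sphtop X sphtop Y] by (intro iffI)
qed

lemma realizable_degree_loeschian:
  assumes "realizable sphtop sphtop (2 * n) {#M2, M3, M6#}"
    and "M2 \<noteq> {#}" "M3 \<noteq> {#}" "M6 \<noteq> {#}"
    and "\<And>k. k \<in># M2 \<Longrightarrow> k dvd 2" "\<And>k. k \<in># M3 \<Longrightarrow> k dvd 3" "\<And>k. k \<in># M6 \<Longrightarrow> k dvd 6 \<and> k \<ge> 2"
    and "2 \<in># M6 \<or> 1 \<in># M3"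
  obtains i j :: nat where "n = i\<^sup>2 + i * j + j\<^sup>2"
proof -
  obtain m where m: "m \<in> eis" "real (2 * n) = 2 * (cmod m)\<^sup>2" using realizable_degree_is_norm[OF assms] by blast
  obtain i j :: nat where "(cmod m)\<^sup>2 = real (i\<^sup>2 + i * j + j\<^sup>2)" using eis_norm_nat[OF m(1)] by blast
  then have "n = i\<^sup>2 + i * j + j\<^sup>2" using m(2) by (simp only: of_nat_mult of_nat_numeral mult_cancel_left of_nat_eq_iff) simp
  then show ?thesis by (rule that)
qed

lemma loeschian_multiple_of_3:
  fixes i j n :: nat
  assumes "3 * n = i\<^sup>2 + i * j + j\<^sup>2"
  shows "\<exists>x y :: nat. n = x\<^sup>2 + 3 * x * y + 3 * y\<^sup>2"
proof -
  have "(i\<^sup>2 + i * j + j\<^sup>2) mod 3 = 0" using assms[symmetric] by simp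
  then have "[i = j] (mod 3)" using loeschian_mod_3[of i j] by (auto split: if_splits)
  then obtain x y :: nat where "3 * n = 3 * (x\<^sup>2 + 3 * x * y + 3 * y\<^sup>2)" using loeschian_div_3[of i j] assms by metis
  then have "n = x\<^sup>2 + 3 * x * y + 3 * y\<^sup>2" by (subst (asm) mult_left_cancel) simp_all
  then show ?thesis by blast
qed

theorem theorem3p8:
  fixes X :: "'a topology" and Y :: "'b topology"
  shows
    "(\<forall>d Ps.
        candidate_surface_branched_cover X Y d Ps \<and>
        induces_candidate_orbifold_cover X Y Ps
          (two_sphere, {#3, 3, 3#}) (two_sphere, {#2, 3, 6#})
        \<longleftrightarrow>
        X homeomorphic_space two_sphere \<and> Y homeomorphic_space two_sphere \<and>
        (\<exists>k\<ge>1.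
           d = 6 * k \<and>
             Ps = {# replicate_mset (3 * k) 2,
                     replicate_mset (2 * k - 1) 3 + {#1, 1, 1#},
                     replicate_mset k 6 #} \<or>
           d = 6 * k + 2 \<and>
             Ps = {# replicate_mset (3 * k + 1) 2,
                     replicate_mset (2 * k) 3 + {#1, 1#},
                     replicate_mset k 6 + {#2#} #} \<or>
           d = 6 * k + 4 \<and>
             Ps = {# replicate_mset (3 * k + 2) 2,
                     replicate_mset (2 * k + 1) 3 + {#1#},
                     replicate_mset k 6 + {#2, 2#} #} \<or>
           d = 6 * k + 6 \<and>
             Ps = {# replicate_mset (3 * k + 3) 2,
                     replicate_mset (2 * k + 2) 3,
                     replicate_mset k 6 + {#2, 2, 2#} #}))
     \<and>
     (X homeomorphic_space two_sphere \<longrightarrow> Y homeomorphic_space two_sphere \<longrightarrow>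
      (\<forall>k\<ge>1.
        (realizable X Y (6 * k)
           {# replicate_mset (3 * k) 2,
              replicate_mset (2 * k - 1) 3 + {#1, 1, 1#},
              replicate_mset k 6 #}
         \<longleftrightarrow> (\<exists>x y :: nat. 6 * k = 6 * (x\<^sup>2 + 3 * x * y + 3 * y\<^sup>2))) \<and>
        (realizable X Y (6 * k + 2)
           {# replicate_mset (3 * k + 1) 2,
              replicate_mset (2 * k) 3 + {#1, 1#},
              replicate_mset k 6 + {#2#} #}
         \<longleftrightarrow> (\<exists>x y :: nat. 6 * k + 2 = 2 * (x\<^sup>2 + x * y + y\<^sup>2) \<and> \<not> [x = y] (mod 3))) \<and>
        \<not> realizable X Y (6 * k + 4)
           {# replicate_mset (3 * k + 2) 2,
              replicate_mset (2 * k + 1) 3 + {#1#},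
              replicate_mset k 6 + {#2, 2#} #} \<and>
        (realizable X Y (6 * k + 6)
           {# replicate_mset (3 * k + 3) 2,
              replicate_mset (2 * k + 2) 3,
              replicate_mset k 6 + {#2, 2, 2#} #}
         \<longleftrightarrow> (\<exists>x y :: nat. 6 * k + 6 = 6 * (x\<^sup>2 + 3 * x * y + 3 * y\<^sup>2)))))"
proof (intro conjI allI impI)
  fix d Ps
  show "candidate_surface_branched_cover X Y d Ps \<and>
        induces_candidate_orbifold_cover X Y Ps (two_sphere, {#3, 3, 3#}) (two_sphere, {#2, 3, 6#}) \<longleftrightarrow>
        X homeomorphic_space two_sphere \<and> Y homeomorphic_space two_sphere \<and> (\<exists>k\<ge>1.
           d = 6 * k \<and>
             Ps = {# replicate_mset (3 * k) 2,
                     replicate_mset (2 * k - 1) 3 + {#1, 1, 1#},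
                     replicate_mset k 6 #} \<or>
           d = 6 * k + 2 \<and>
             Ps = {# replicate_mset (3 * k + 1) 2,
                     replicate_mset (2 * k) 3 + {#1, 1#},
                     replicate_mset k 6 + {#2#} #} \<or>
           d = 6 * k + 4 \<and>
             Ps = {# replicate_mset (3 * k + 2) 2,
                     replicate_mset (2 * k + 1) 3 + {#1#},
                     replicate_mset k 6 + {#2, 2#} #} \<or>
           d = 6 * k + 6 \<and>
             Ps = {# replicate_mset (3 * k + 3) 2,
                     replicate_mset (2 * k + 2) 3,
                     replicate_mset k 6 + {#2, 2, 2#} #})"
    unfolding sphere_data_iff[symmetric]
    using candidate_sphere_data[of X Y d Ps] sphere_data_candidate[of d Ps X Y] by blast
next
  fix k :: nat
  assume X: "X homeomorphic_space two_sphere" and Y: "Y homeomorphic_space two_sphere" and k: "k \<ge> 1"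
  note sphere = realizable_iff_sphere[OF X Y]
  show "realizable X Y (6 * k) {# replicate_mset (3 * k) 2, replicate_mset (2 * k - 1) 3 + {#1, 1, 1#}, replicate_mset k 6 #}
      \<longleftrightarrow> (\<exists>x y :: nat. 6 * k = 6 * (x\<^sup>2 + 3 * x * y + 3 * y\<^sup>2))" (is "?r \<longleftrightarrow> ?n")
  proof
    assume ?r
    then have "realizable sphtop sphtop (2 * (3 * k)) {# replicate_mset (3 * k) 2, replicate_mset (2 * k - 1) 3 + {#1, 1, 1#}, replicate_mset k 6 #}"
      unfolding sphere by simp
    then obtain i j :: nat where "3 * k = i\<^sup>2 + i * j + j\<^sup>2"
      by (rule realizable_degree_loeschian) (use k in \<open>auto split: if_splits\<close>)
    then show ?n using loeschian_multiple_of_3 by metis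
  next
    assume ?n
    then show ?r unfolding sphere using realizable_case_1(1)[OF k] by blast
  qed
  show "realizable X Y (6 * k + 2) {# replicate_mset (3 * k + 1) 2, replicate_mset (2 * k) 3 + {#1, 1#}, replicate_mset k 6 + {#2#} #}
      \<longleftrightarrow> (\<exists>x y :: nat. 6 * k + 2 = 2 * (x\<^sup>2 + x * y + y\<^sup>2) \<and> \<not> [x = y] (mod 3))" (is "?r \<longleftrightarrow> ?n")
  proof
    assume ?r
    then have "realizable sphtop sphtop (2 * (3 * k + 1)) {# replicate_mset (3 * k + 1) 2, replicate_mset (2 * k) 3 + {#1, 1#}, replicate_mset k 6 + {#2#} #}"
      unfolding sphere by simp
    then obtain i j :: nat where ij: "3 * k + 1 = i\<^sup>2 + i * j + j\<^sup>2"
      by (rule realizable_degree_loeschian) (use k in \<open>auto split: if_splits\<close>)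
    have "(3 * k + 1) mod 3 \<noteq> 0" by presburger
    then have "\<not> [i = j] (mod 3)" using loeschian_mod_3[of i j] unfolding ij by auto
    moreover have "6 * k + 2 = 2 * (i\<^sup>2 + i * j + j\<^sup>2)" unfolding ij[symmetric] by simp
    ultimately show ?n by blast
  next
    assume ?n
    then show ?r unfolding sphere using realizable_case_2[OF k] by blast
  qed
  show "\<not> realizable X Y (6 * k + 4) {# replicate_mset (3 * k + 2) 2, replicate_mset (2 * k + 1) 3 + {#1#}, replicate_mset k 6 + {#2, 2#} #}"
  proof
    assume "realizable X Y (6 * k + 4) {# replicate_mset (3 * k + 2) 2, replicate_mset (2 * k + 1) 3 + {#1#}, replicate_mset k 6 + {#2, 2#} #}"
    then have "realizable sphtop sphtop (2 * (3 * k + 2)) {# replicate_mset (3 * k + 2) 2, replicate_mset (2 * k + 1) 3 + {#1#}, replicate_mset k 6 + {#2, 2#} #}"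
      unfolding sphere by (rule back_subst[of "\<lambda>n. realizable sphtop sphtop n _"]) simp
    then obtain i j :: nat where ij: "3 * k + 2 = i\<^sup>2 + i * j + j\<^sup>2"
      by (rule realizable_degree_loeschian) (use k in \<open>auto split: if_splits\<close>)
    have "(3 * k + 2) mod 3 = 2" by presburger
    then show False using loeschian_mod_3[of i j] unfolding ij by (auto split: if_splits)
  qed
  show "realizable X Y (6 * k + 6) {# replicate_mset (3 * k + 3) 2, replicate_mset (2 * k + 2) 3, replicate_mset k 6 + {#2, 2, 2#} #}
      \<longleftrightarrow> (\<exists>x y :: nat. 6 * k + 6 = 6 * (x\<^sup>2 + 3 * x * y + 3 * y\<^sup>2))" (is "?r \<longleftrightarrow> ?n")
  proof
    assume ?r
    then have "realizable sphtop sphtop (2 * (3 * (k + 1))) {# replicate_mset (3 * k + 3) 2, replicate_mset (2 * k + 2) 3, replicate_mset k 6 + {#2, 2, 2#} #}"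
      unfolding sphere by (simp add: algebra_simps)
    then obtain i j :: nat where "3 * (k + 1) = i\<^sup>2 + i * j + j\<^sup>2"
      by (rule realizable_degree_loeschian) (use k in \<open>auto split: if_splits\<close>)
    then obtain x y :: nat where "k + 1 = x\<^sup>2 + 3 * x * y + 3 * y\<^sup>2" using loeschian_multiple_of_3 by blast
    moreover have "6 * k + 6 = 6 * (k + 1)" by simp
    ultimately show ?n by metis
  next
    assume ?n
    \<comment> \<open>The last family at \<open>k\<close> is the second construction of
      \<open>realizable_case_1\<close> at k + 1, whose requirement k + 1 \<ge> 2 holds as k \<ge>
      1.\<close>
    moreover have e: "6 * k + 6 = 6 * (k + 1)" "3 * k + 3 = 3 * (k + 1)" "2 * k + 2 = 2 * (k + 1)" "k = (k + 1) - 1" by simp_all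
    ultimately obtain x y :: nat where "6 * (k + 1) = 6 * (x\<^sup>2 + 3 * x * y + 3 * y\<^sup>2)" by metis
    from realizable_case_1(2)[OF _ this] show ?r unfolding sphere e(1-3) using k by simp
  qed
qed

end
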